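(* Let $n\ge 5$ and let $P=P(m_1,\dots,m_{n-1})$ be a natural unit interval order with $m_1=r\ge 2$, $m_2=\cdots=m_s=n-1$ and $m_{s+1}=\cdots=m_{n-1}=n$ for some $s$ with $r<s<n-1$. Let $G=\mathrm{inc}(P)$. Then, with $A=\{1^n,2^11^{n-2},2^21^{n-4},3^11^{n-3}\}$ and $A'=\{(n-2,1,1),(n-2,2),(n-1,1),(n)\}$, $$X_G(\mathbf{x},t)=\sum_{\lambda\in A}B_\lambda(t)s_\lambda=\sum_{\mu\in A'}C_\mu(t)e_\mu,$$ where $B_\lambda(t)=\sum_{T}t^{\mathrm{inv}_G(T)}$, summed over all $P$-tableaux $T$ of shape $\lambda$, and $C_{(n-2,1,1)}(t)=B_{3^11^{n-3}}(t)$, $C_{(n-2,2)}(t)=B_{2^21^{n-4}}(t)-B_{3^11^{n-3}}(t)$, $C_{(n-1,1)}(t)=B_{2^11^{n-2}}(t)-B_{2^21^{n-4}}(t)-B_{3^11^{n-3}}(t)$, $C_n(t)=B_{1^n}(t)-B_{2^11^{n-2}}(t)+B_{3^11^{n-3}}(t)$. Moreover these four $C_\mu(t)$ are polynomials in $t$ with nonnegative coefficients; consequently $X_G(\mathbf{x},t)$ is $e$-positive.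
   Context: A natural unit interval order $P(m_1,\dots,m_{n-1})$ is defined for integers $m_1\le\cdots\le m_{n-1}\le n$ with $m_i\ge i$: it is the poset on $[n]$ with $i<_P j$ iff $i<n$ and $j\in\{m_i+1,\dots,n\}$. Its incomparability graph $\mathrm{inc}(P)$ has vertex set $[n]$ and an edge $\{i,j\}$ ($i<j$) iff $j\le m_i$. The chromatic quasisymmetric function of a graph $G$ on $V\subset\mathbb{P}$ is $X_G(\mathbf{x},t)=\sum_\kappa t^{\mathrm{asc}(\kappa)}\prod_v x_{\kappa(v)}$ over proper colorings $\kappa:V\to\mathbb{P}$, with $\mathrm{asc}(\kappa)$ the number of edges $\{i,j\}$, $i<j$, with $\kappa(i)<\kappa(j)$. $s_\lambda$ and $e_\mu$ denote Schur and elementary symmetric functions. A $P$-tableau of shape $\lambda\vdash n$ is a filling $T=[a_{i,j}]$ of the Young diagram of $\lambda$ (English notation) using each element of $P$ exactly once, with $a_{i,j}<_P a_{i,j+1}$ and $a_{i+1,j}\not<_P a_{i,j}$ for all $i,j$. The shape $a^b1^c$ has $b$ rows of length $a$ followed by $c$ rows of length $1$. A $G$-inversion of $T$ is an edge $\{i,j\}$ of $G$ with $i<j$ and $i$ in a lower row than $j$; $\mathrm{inv}_G(T)$ is their number. *)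

theory Defs
  imports Main "HOL-Library.Poly_Mapping" "HOL-Computational_Algebra.Polynomial"
begin

text \<open>Natural unit interval order P(m_1,...,m_{n-1}) on [n] = {1..n};
  m is given as a function on 1..n-1 (values elsewhere irrelevant).\<close>

definition nat_unit_interval_order :: "nat \<Rightarrow> (nat \<Rightarrow> nat) \<Rightarrow> bool" where
  "nat_unit_interval_order n m \<longleftrightarrow>
     (\<forall>i\<in>{1..<n}. i \<le> m i \<and> m i \<le> n) \<and>
     (\<forall>i j. 1 \<le> i \<and> i \<le> j \<and> j < n \<longrightarrow> m i \<le> m j)"

definition nuio_less :: "nat \<Rightarrow> (nat \<Rightarrow> nat) \<Rightarrow> nat \<Rightarrow> nat \<Rightarrow> bool" where
  "nuio_less n m i j \<longleftrightarrow> i \<in> {1..<n} \<and> j \<in> {m i + 1..n}"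

definition inc_edge :: "nat \<Rightarrow> (nat \<Rightarrow> nat) \<Rightarrow> nat \<Rightarrow> nat \<Rightarrow> bool" where
  "inc_edge n m i j \<longleftrightarrow> i \<in> {1..n} \<and> j \<in> {1..n} \<and> i < j \<and> j \<le> m i"

text \<open>Formal power series in x_1, x_2, ... with coefficients in Z[t] are represented by their
  coefficient function on monomials (exponent vectors, finitely supported, indexed by nat;
  index 0 is never used since all colours/entries are positive).\<close>
type_synonym fps_x = "(nat \<Rightarrow>\<^sub>0 nat) \<Rightarrow> int poly"

definition proper_colorings_content ::
  "nat set \<Rightarrow> (nat \<Rightarrow> nat \<Rightarrow> bool) \<Rightarrow> (nat \<Rightarrow>\<^sub>0 nat) \<Rightarrow> (nat \<Rightarrow> nat) set" where
  "proper_colorings_content V E \<alpha> =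
     {\<kappa>. (\<forall>v\<in>V. 1 \<le> \<kappa> v) \<and> (\<forall>v. v \<notin> V \<longrightarrow> \<kappa> v = 0) \<and>
          (\<forall>i\<in>V. \<forall>j\<in>V. i < j \<and> E i j \<longrightarrow> \<kappa> i \<noteq> \<kappa> j) \<and>
          (\<forall>c. card {v\<in>V. \<kappa> v = c} = Poly_Mapping.lookup \<alpha> c)}"

definition asc :: "nat set \<Rightarrow> (nat \<Rightarrow> nat \<Rightarrow> bool) \<Rightarrow> (nat \<Rightarrow> nat) \<Rightarrow> nat" where
  "asc V E \<kappa> = card {(i, j). i \<in> V \<and> j \<in> V \<and> i < j \<and> E i j \<and> \<kappa> i < \<kappa> j}"

definition chrom_qsym :: "nat set \<Rightarrow> (nat \<Rightarrow> nat \<Rightarrow> bool) \<Rightarrow> fps_x" where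
  "chrom_qsym V E \<alpha> = (\<Sum>\<kappa>\<in>proper_colorings_content V E \<alpha>. monom 1 (asc V E \<kappa>))"

text \<open>Partitions as nonincreasing lists of positive parts; Young diagram (English, 0-indexed
  cells (row, column)).\<close>
definition is_partition :: "nat list \<Rightarrow> bool" where
  "is_partition la \<longleftrightarrow> (\<forall>x\<in>set la. 0 < x) \<and> sorted_wrt (\<ge>) la"

definition young :: "nat list \<Rightarrow> (nat \<times> nat) set" where
  "young la = {(i, j). i < length la \<and> j < la ! i}"

definition ssyt_content :: "nat list \<Rightarrow> (nat \<Rightarrow>\<^sub>0 nat) \<Rightarrow> (nat \<times> nat \<Rightarrow> nat) set" where
  "ssyt_content la \<alpha> =
     {T. (\<forall>c\<in>young la. 1 \<le> T c) \<and> (\<forall>c. c \<notin> young la \<longrightarrow> T c = 0) \<and>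
         (\<forall>i j. (i, j + 1) \<in> young la \<longrightarrow> T (i, j) \<le> T (i, j + 1)) \<and>
         (\<forall>i j. (i + 1, j) \<in> young la \<longrightarrow> T (i, j) < T (i + 1, j)) \<and>
         (\<forall>k. card {c\<in>young la. T c = k} = Poly_Mapping.lookup \<alpha> k)}"

definition schur :: "nat list \<Rightarrow> fps_x" where
  "schur la \<alpha> = of_nat (card (ssyt_content la \<alpha>))"

text \<open>Coefficient of x^alpha in e_mu = e_{mu_1} e_{mu_2} ...: number of sequences of sets
  of positive integers S_k with |S_k| = mu_k whose indicator vectors sum to alpha.\<close>
definition elem_sets :: "nat list \<Rightarrow> (nat \<Rightarrow>\<^sub>0 nat) \<Rightarrow> nat set list set" where
  "elem_sets mu \<alpha> =
     {Ss. length Ss = length mu \<and>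
          (\<forall>k<length mu. finite (Ss ! k) \<and> 0 \<notin> Ss ! k \<and> card (Ss ! k) = mu ! k) \<and>
          (\<forall>c. length (filter (\<lambda>S. c \<in> S) Ss) = Poly_Mapping.lookup \<alpha> c)}"

definition elem :: "nat list \<Rightarrow> fps_x" where
  "elem mu \<alpha> = of_nat (card (elem_sets mu \<alpha>))"

definition P_tableaux :: "nat \<Rightarrow> (nat \<Rightarrow> nat) \<Rightarrow> nat list \<Rightarrow> (nat \<times> nat \<Rightarrow> nat) set" where
  "P_tableaux n m la =
     {T. bij_betw T (young la) {1..n} \<and> (\<forall>c. c \<notin> young la \<longrightarrow> T c = 0) \<and>
         (\<forall>i j. (i, j + 1) \<in> young la \<longrightarrow> nuio_less n m (T (i, j)) (T (i, j + 1))) \<and>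
         (\<forall>i j. (i + 1, j) \<in> young la \<longrightarrow> \<not> nuio_less n m (T (i + 1, j)) (T (i, j)))}"

definition inv_G :: "nat \<Rightarrow> (nat \<Rightarrow> nat) \<Rightarrow> nat list \<Rightarrow> (nat \<times> nat \<Rightarrow> nat) \<Rightarrow> nat" where
  "inv_G n m la T = card {(c, d). c \<in> young la \<and> d \<in> young la \<and>
        inc_edge n m (T c) (T d) \<and> fst d < fst c}"

definition B_poly :: "nat \<Rightarrow> (nat \<Rightarrow> nat) \<Rightarrow> nat list \<Rightarrow> int poly" where
  "B_poly n m la = (\<Sum>T\<in>P_tableaux n m la. monom 1 (inv_G n m la T))"

definition nonneg_coeffs :: "int poly \<Rightarrow> bool" where
  "nonneg_coeffs p \<longleftrightarrow> (\<forall>k. 0 \<le> coeff p k)"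

definition e_positive :: "fps_x \<Rightarrow> bool" where
  "e_positive X \<longleftrightarrow> (\<exists>M c. finite M \<and> (\<forall>mu\<in>M. is_partition mu \<and> nonneg_coeffs (c mu)) \<and>
       (\<forall>\<alpha>. X \<alpha> = (\<Sum>mu\<in>M. c mu * elem mu \<alpha>)))"

end

theory Submission
  imports Defs "HOL-Combinatorics.Multiset_Permutations"
begin

text \<open>
  The vertices 2, ..., n-1 form a clique of size N = n-2; vertex 1 is joined to its first a = r-1
  elements and vertex n to its last b = n-1-s elements, with c = s-r elements in between.

  For fixed colours p and q of 1 and n and a fixed colour set S of the clique, the sum of
  t^asc over the colourings of the clique is affine in [a] and affine in [b]: exchanging two
  consecutive colours of the clique yields (1+t) F(a) = t F(a-1) + F(a+1), and likewise for b. It is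
  therefore determined by the four cases a, b \<in> {0, 1}, and summing the result over all (S, p, q) of a
  given content gives the expansion of X in the functions e_{N,1,1}, e_{N,2}, e_{N+1,1}, e_{N+2}.

  The P-tableaux are enumerated directly: a word without P-descents arises from a permutation of the
  clique by inserting 1 directly after one of its neighbours or in front, and n directly before one of
  its neighbours or at the end, so it has [N]! [a+1] [b+1] as generating function; similar
  enumerations give the remaining B. The resulting coefficients of X are

  C_{N,1,1} = t^(a+b) [c] [N-1]!,  C_{N,2} = t^(N-1) [2] [a] [b] [N-2]!,  C_{N+2} = [N+2] [a] [b] [N-1]!,
  C_{N+1,1} = [N-2]! ([N-1] (t^(a+b+1) [c] ([a] + [b]) + t^b [a] [a+1] + t^a [b] [b+1]) - t^(N-1) [2] [a] [b]),

  and writing [N-1] = [a+c-1] + t^(a+c-1) [b] in front of t^b [a] [a+1] absorbs the negative term.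
  Finally the Schur expansion follows from the dual Pieri rules for e_{n-1} e_1, e_{n-2} e_2 and
  e_{n-2} e_1^2, which are proved bijectively.
\<close>

section \<open>q-integers and words\<close>

text \<open>As the colour grows, the weight that vertex 1 gives to a clique colour runs through 1,
  0, t, and that of vertex n through t, 0, 1. Hence (f x - 1)(f y - t) = 0 for x < y, and similarly
  for g. This single relation drives the exchange argument, and it tolerates the value 0: improper
  colourings stay in the sum with weight 0, so the clique word ranges over all permutations of S.
  The recurrence has characteristic roots 1 and t, which is why its solutions are affine in [a]. The
  obstacle is the coefficient of [a] [b]. The first and last letter of a word are distinct, so the
  double sum over S does not factor, and its value depends on the order of p and q and on their
  membership in S. After summation over (S, p, q) the case p = q yields e_{N+2} with the plain
  integer N+2 as a factor; this cancels against an equal term from the pairs p \<noteq> q outside S.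
  The B and the coefficients of X are computed independently and compared at the end. The comparison
  replaces t^k by 1 + (t-1)[k], which leaves polynomial identities.\<close>

definition tvar :: "int poly" where "tvar = monom 1 1"

lemma monom_one_eq_tvar_power: "monom 1 k = tvar ^ k"
  by (simp add: tvar_def monom_power)

definition qint :: "nat \<Rightarrow> int poly" where
  "qint k = (\<Sum>i<k. tvar ^ i)"

definition qfact :: "nat \<Rightarrow> int poly" where
  "qfact k = (\<Prod>i<k. qint (Suc i))"

lemma qint_0 [simp]: "qint 0 = 0"
  and qint_Suc: "qint (Suc k) = qint k + tvar ^ k"
  and qint_1 [simp]: "qint (Suc 0) = 1"
  by (simp_all add: qint_def)

lemma qint_Suc_shift: "qint (Suc k) = 1 + tvar * qint k"
  by (simp add: qint_def sum.lessThan_Suc_shift sum_distrib_left del: sum.lessThan_Suc)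

lemma qint_add: "qint (i + j) = qint i + tvar ^ i * qint j"
  by (induction j) (simp_all add: qint_Suc algebra_simps power_add)

text \<open>Geometric sum. Read from left to right it removes every power of t in favour of
  q-integers, so that mixed identities can be left to \<open>algebra\<close>.\<close>

lemma tvar_power_eq: "tvar ^ k = 1 + (tvar - 1) * qint k"
  using qint_Suc_shift[of k] by (simp add: qint_Suc algebra_simps)

lemma qfact_0 [simp]: "qfact 0 = 1"
  and qfact_Suc: "qfact (Suc k) = qint (Suc k) * qfact k"
  by (simp_all add: qfact_def mult.commute)

lemma nonneg_coeffs_add: "nonneg_coeffs p \<Longrightarrow> nonneg_coeffs q \<Longrightarrow> nonneg_coeffs (p + q)"
  by (simp add: nonneg_coeffs_def)

lemma nonneg_coeffs_mult: "nonneg_coeffs p \<Longrightarrow> nonneg_coeffs q \<Longrightarrow> nonneg_coeffs (p * q)"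
  by (simp add: nonneg_coeffs_def coeff_mult sum_nonneg)

lemma nonneg_coeffs_tvar_power: "nonneg_coeffs (tvar ^ k)"
  by (simp add: nonneg_coeffs_def flip: monom_one_eq_tvar_power)

lemma nonneg_coeffs_tvar: "nonneg_coeffs tvar"
  by (simp add: nonneg_coeffs_def tvar_def)

lemma nonneg_coeffs_1: "nonneg_coeffs 1"
  using nonneg_coeffs_tvar_power[of 0] by simp

lemma nonneg_coeffs_qint: "nonneg_coeffs (qint k)"
proof (induction k)
  case 0
  then show ?case by (simp add: nonneg_coeffs_def)
qed (simp add: qint_Suc nonneg_coeffs_add nonneg_coeffs_tvar_power)

lemma nonneg_coeffs_qfact: "nonneg_coeffs (qfact k)"
  by (induction k)
    (simp_all add: qfact_Suc nonneg_coeffs_mult nonneg_coeffs_1 nonneg_coeffs_qint)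

lemmas nonneg_coeffs_intros = nonneg_coeffs_add nonneg_coeffs_mult nonneg_coeffs_tvar_power
  nonneg_coeffs_tvar nonneg_coeffs_1 nonneg_coeffs_qint nonneg_coeffs_qfact

text \<open>The exponent is the rank of x from the top, which takes each value below
  \<open>card S\<close> exactly once; in the induction the new minimum has the largest rank.\<close>

lemma sum_tvar_power_card_greater:
  fixes S :: "'a::linorder set"
  assumes "finite S"
  shows "(\<Sum>x\<in>S. tvar ^ card {y\<in>S. x < y}) = qint (card S)"
  using assms
proof (induction rule: finite_linorder_min_induct)
  case (insert b A)
  have "{y \<in> insert b A. x < y} = {y \<in> A. x < y}" if "x \<in> A" for x
    using insert.hyps that by auto
  moreover have "{y \<in> insert b A. b < y} = A"
    using insert.hyps by auto
  moreover have "b \<notin> A"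
    using insert.hyps by auto
  ultimately show ?case
    using insert by (simp add: qint_Suc cong: sum.cong)
qed simp

lemma sum_tvar_power_card_less:
  fixes S :: "'a::linorder set"
  assumes "finite S"
  shows "(\<Sum>x\<in>S. tvar ^ card {y\<in>S. y < x}) = qint (card S)"
  using assms
proof (induction rule: finite_linorder_max_induct)
  case (insert b A)
  have "{y \<in> insert b A. y < x} = {y \<in> A. y < x}" if "x \<in> A" for x
    using insert.hyps that by auto
  moreover have "{y \<in> insert b A. y < b} = A"
    using insert.hyps by auto
  moreover have "b \<notin> A"
    using insert.hyps by auto
  ultimately show ?case
    using insert by (simp add: qint_Suc cong: sum.cong)
qed simp

text \<open>Counts the R-related pairs of positions i < j. For (<) these are the non-inversions, for
  (>) the inversions; ascents of colourings and G-inversions of tableaux are both put in this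
  form.\<close>

fun npairs :: "('a \<Rightarrow> 'a \<Rightarrow> bool) \<Rightarrow> 'a list \<Rightarrow> nat" where
  "npairs R [] = 0"
| "npairs R (x # xs) = length (filter (R x) xs) + npairs R xs"

lemma npairs_append:
  "npairs R (xs @ ys) = npairs R xs + npairs R ys + (\<Sum>x\<leftarrow>xs. length (filter (R x) ys))"
  by (induction xs) auto

lemma npairs_snoc: "npairs R (xs @ [y]) = npairs R xs + length (filter (\<lambda>x. R x y) xs)"
  by (induction xs) auto

lemma npairs_rev: "npairs R (rev xs) = npairs (\<lambda>x y. R y x) xs"
  by (induction xs) (simp_all add: npairs_snoc rev_filter[symmetric])

lemma npairs_map: "npairs R (map f xs) = npairs (\<lambda>x y. R (f x) (f y)) xs"
  by (induction xs) (simp_all add: filter_map comp_def)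

lemma npairs_cong:
  "(\<And>x y. x \<in> set xs \<Longrightarrow> y \<in> set xs \<Longrightarrow> R x y = R' x y) \<Longrightarrow> npairs R xs = npairs R' xs"
  by (induction xs) (auto intro!: arg_cong[where f = length] filter_cong)

text \<open>If R never relates a later element of the list to an earlier one, \<open>npairs\<close>
  sees every R-pair exactly once. The list will be the vertices in increasing order for
  \<open>asc\<close> and the cells row by row for \<open>inv_G\<close>.\<close>

lemma card_ordered_pairs_eq_npairs:
  assumes "distinct xs" and "sorted_wrt (\<lambda>x y. \<not> R y x) xs" and "\<And>x. \<not> R x x"
  shows "card {(x, y). x \<in> set xs \<and> y \<in> set xs \<and> R x y} = npairs R xs"
  using assms(1,2)
proof (induction xs)
  case (Cons z zs)
  have "{(x, y). x \<in> set (z # zs) \<and> y \<in> set (z # zs) \<and> R x y} =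
        (\<lambda>y. (z, y)) ` {y \<in> set zs. R z y} \<union> {(x, y). x \<in> set zs \<and> y \<in> set zs \<and> R x y}"
    using Cons.prems assms(3) by auto
  moreover have "finite {(x, y). x \<in> set zs \<and> y \<in> set zs \<and> R x y}"
    by (rule finite_subset[of _ "set zs \<times> set zs"]) auto
  moreover have "card ((\<lambda>y. (z, y)) ` {y \<in> set zs. R z y}) = length (filter (R z) zs)"
    using Cons.prems by (subst card_image) (auto simp: inj_on_def distinct_length_filter Int_def
        intro: arg_cong[where f = card])
  moreover have "(\<lambda>y. (z, y)) ` {y \<in> set zs. R z y} \<inter>
      {(x, y). x \<in> set zs \<and> y \<in> set zs \<and> R x y} = {}"
    using Cons.prems by auto
  ultimately show ?case
    using Cons by (simp add: card_Un_disjoint)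
qed simp

section \<open>Sums over the permutations of a finite set\<close>

abbreviation "perms \<equiv> permutations_of_set"

lemma length_filter_permutation:
  "w \<in> perms S \<Longrightarrow> length (filter P w) = card {x \<in> S. P x}"
  by (auto simp: permutations_of_set_def distinct_length_filter Int_def intro: arg_cong[where f = card])

lemma sum_permutations_of_set_Cons:
  assumes "finite S" "S \<noteq> {}"
  shows "(\<Sum>w\<in>perms S. h w) =
    (\<Sum>x\<in>S. \<Sum>w\<in>perms (S - {x}). (h (x # w) :: 'b::comm_monoid_add))"
proof -
  have "(\<Sum>w\<in>perms S. h w) =
      (\<Sum>x\<in>S. \<Sum>w\<in>(#) x ` perms (S - {x}). h w)"
    using assms by (subst permutations_of_set_nonempty[OF assms(2)], subst sum.UNION_disjoint) auto
  then show ?thesis by (simp add: sum.reindex)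
qed

lemma sum_permutations_of_set_rev:
  "(\<Sum>w\<in>perms S. h w) = (\<Sum>w\<in>perms S. h (rev w))"
  by (subst rev_permutations_of_set[symmetric]) (simp only: sum.reindex inj_on_rev comp_def)

lemma sum_permutations_of_set_snoc:
  assumes "finite S" "S \<noteq> {}"
  shows "(\<Sum>w\<in>perms S. h w) =
    (\<Sum>x\<in>S. \<Sum>w\<in>perms (S - {x}). (h (w @ [x]) :: 'b::comm_monoid_add))"
  by (subst sum_permutations_of_set_rev, subst sum_permutations_of_set_Cons[OF assms])
    (simp, rule sum.cong[OF refl], subst (2) sum_permutations_of_set_rev, rule refl)

text \<open>MacMahon's inversion count: the first letter x forms a pair with each larger letter,
  whatever their order, so it splits off the factor [card S].\<close>

lemma sum_permutations_tvar_npairs_less: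
  fixes S :: "'a::linorder set"
  assumes "finite S"
  shows "(\<Sum>w\<in>perms S. tvar ^ npairs (<) w) = qfact (card S)"
  using assms
proof (induction "card S" arbitrary: S)
  case (Suc k)
  have "(\<Sum>w\<in>perms S. tvar ^ npairs (<) w) =
     (\<Sum>x\<in>S. tvar ^ card {y\<in>S. x < y} *
         (\<Sum>w\<in>perms (S - {x}). tvar ^ npairs (<) w))"
    using Suc.hyps(2) Suc.prems
    by (subst sum_permutations_of_set_Cons)
      (auto simp: sum_distrib_left power_add length_filter_permutation
         intro!: sum.cong arg_cong[where f = card] arg_cong[where f = "(^) tvar"])
  also have "\<dots> = (\<Sum>x\<in>S. tvar ^ card {y\<in>S. x < y} * qfact k)"
  proof (intro sum.cong refl arg_cong[where f = "(*) _"])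
    fix x assume "x \<in> S"
    then have "card (S - {x}) = k"
      using Suc.hyps(2) Suc.prems by simp
    then show "(\<Sum>w\<in>perms (S - {x}). tvar ^ npairs (<) w) = qfact k"
      using Suc.hyps(1)[of "S - {x}"] Suc.prems by simp
  qed
  also have "\<dots> = qfact (card S)"
    using Suc.prems by (simp add: sum_distrib_right[symmetric] sum_tvar_power_card_greater
        qfact_Suc flip: Suc.hyps(2))
  finally show ?case .
qed simp

lemma sum_permutations_tvar_npairs_greater:
  fixes S :: "'a::linorder set"
  assumes "finite S"
  shows "(\<Sum>w\<in>perms S. tvar ^ npairs (>) w) = qfact (card S)"
  by (subst sum_permutations_of_set_rev) (simp add: npairs_rev sum_permutations_tvar_npairs_less assms)

text \<open>Fillings are functions on all cells with the default 0 outside the diagram; this default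
  is what makes reading along \<open>cs\<close> injective. Semistandard tableaux and P-tableaux are
  both turned into words in this way.\<close>

lemma bij_betw_map_default:
  fixes cs :: "'a list" and Q :: "nat list \<Rightarrow> bool"
  assumes "distinct cs"
  shows "bij_betw (\<lambda>T. map T cs) {T. (\<forall>c. c \<notin> set cs \<longrightarrow> T c = 0) \<and> Q (map T cs)}
    {xs. length xs = length cs \<and> Q xs}"
proof (rule bij_betwI')
  fix T T' assume *: "T \<in> {T. (\<forall>c. c \<notin> set cs \<longrightarrow> T c = 0) \<and> Q (map T cs)}"
    "T' \<in> {T. (\<forall>c. c \<notin> set cs \<longrightarrow> T c = 0) \<and> Q (map T cs)}"
  show "(map T cs = map T' cs) = (T = T')"
  proof
    assume "map T cs = map T' cs"
    then have "T c = T' c" for c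
      using * by (cases "c \<in> set cs") auto
    then show "T = T'" by blast
  qed simp
next
  fix xs assume xs: "xs \<in> {xs. length xs = length cs \<and> Q xs}"
  define T where "T c = (case map_of (zip cs xs) c of None \<Rightarrow> 0 | Some x \<Rightarrow> x)" for c
  have "map T cs = xs"
  proof (rule nth_equalityI)
    fix i assume "i < length (map T cs)"
    then show "map T cs ! i = xs ! i"
      using xs assms by (simp add: T_def map_of_zip_nth)
  qed (use xs in simp)
  moreover have "T c = 0" if "c \<notin> set cs" for c
    using that xs by (auto simp: T_def map_of_zip_is_None split: option.splits
        dest: map_of_SomeD set_zip_leftD)
  ultimately show "\<exists>T\<in>{T. (\<forall>c. c \<notin> set cs \<longrightarrow> T c = 0) \<and> Q (map T cs)}. xs = map T cs"
    using xs by (intro bexI[of _ T]) auto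
qed auto

lemma mset_map_eq_iff_card:
  assumes "distinct cs" and "\<And>k. count A k = f k"
  shows "mset (map T cs) = A \<longleftrightarrow> (\<forall>k. card {c \<in> set cs. T c = k} = f k)"
proof -
  have "count (mset (map T cs)) k = card {c \<in> set cs. T c = k}" for k
  proof -
    have "count (mset (map T cs)) k = length (filter (\<lambda>c. T c = k) cs)"
      by (induction cs) auto
    then show ?thesis
      using assms(1) by (auto simp: distinct_length_filter Int_def intro: arg_cong[where f = card])
  qed
  then show ?thesis
    using assms(2) by (auto simp: multiset_eq_iff)
qed

section \<open>Modular relation and insertion\<close>

definition swap_at :: "nat \<Rightarrow> 'a list \<Rightarrow> 'a list" where
  "swap_at i w = w[i := w ! Suc i, Suc i := w ! i]"

lemma swap_at_append: "length u = i \<Longrightarrow> swap_at i (u @ x # y # v) = u @ y # x # v"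
  by (simp add: swap_at_def list_update_append nth_append)

lemma swap_at_cases:
  assumes "Suc i < length w"
  obtains u x y v where "w = u @ x # y # v" "length u = i"
  using assms by (metis Cons_nth_drop_Suc Suc_lessD append_take_drop_id length_take less_imp_le
      min.absorb2)

text \<open>Words are paired by exchanging the letters at positions i and i+1. The ascending word of
  each pair has one more pair in (<), hence an extra factor t, and the hypothesis makes the two
  contributions cancel.\<close>

lemma sum_permutations_eq_0_if_antisym_swap:
  fixes S :: "'a::linorder set" and K :: "'a list \<Rightarrow> int poly"
  assumes "finite S" and i: "Suc i < card S"
    and K: "\<And>u x y v. length u = i \<Longrightarrow> x < y \<Longrightarrow>
      tvar * K (u @ x # y # v) + K (u @ y # x # v) = 0"
  shows "(\<Sum>w\<in>perms S. tvar ^ npairs (<) w * K w) = 0"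
proof -
  let ?P = "perms S"
  let ?A = "{w \<in> ?P. w ! i < w ! Suc i}" and ?B = "{w \<in> ?P. w ! Suc i < w ! i}"
  have split: "\<exists>u x y v. w = u @ x # y # v \<and> length u = i \<and> x \<noteq> y" if "w \<in> ?P" for w
  proof -
    have "Suc i < length w"
      using that i by (simp add: length_finite_permutations_of_set)
    then obtain u x y v where "w = u @ x # y # v" "length u = i"
      by (rule swap_at_cases)
    then show ?thesis
      using that by (auto simp: permutations_of_set_def)
  qed
  have "?P = ?A \<union> ?B"
    using split by (fastforce simp: nth_append)
  moreover have "?A \<inter> ?B = {}"
    by auto
  ultimately have "(\<Sum>w\<in>?P. tvar ^ npairs (<) w * K w) =
      (\<Sum>w\<in>?A. tvar ^ npairs (<) w * K w) + (\<Sum>w\<in>?B. tvar ^ npairs (<) w * K w)"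
    by (metis (no_types, lifting) finite_Un finite_permutations_of_set sum.union_disjoint)
  also have "(\<Sum>w\<in>?B. tvar ^ npairs (<) w * K w) =
      (\<Sum>w\<in>?A. tvar ^ npairs (<) (swap_at i w) * K (swap_at i w))"
  proof (rule sum.reindex_bij_witness[of _ "swap_at i" "swap_at i"])
    show "swap_at i (swap_at i w) = w" if "w \<in> ?A" for w
      using split[of w] that by (auto simp: swap_at_append)
    show "swap_at i (swap_at i w) = w" if "w \<in> ?B" for w
      using split[of w] that by (auto simp: swap_at_append)
    show "swap_at i w \<in> ?B" if "w \<in> ?A" for w
      using split[of w] that by (auto simp: swap_at_append permutations_of_set_def nth_append)
    show "swap_at i w \<in> ?A" if "w \<in> ?B" for w
      using split[of w] that by (auto simp: swap_at_append permutations_of_set_def nth_append)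
    show "tvar ^ npairs (<) (swap_at i (swap_at i w)) * K (swap_at i (swap_at i w)) =
      tvar ^ npairs (<) w * K w" if "w \<in> ?B" for w
      using split[of w] that by (auto simp: swap_at_append)
  qed
  also have "(\<Sum>w\<in>?A. tvar ^ npairs (<) w * K w) +
      (\<Sum>w\<in>?A. tvar ^ npairs (<) (swap_at i w) * K (swap_at i w)) = 0"
    unfolding sum.distrib[symmetric]
  proof (intro sum.neutral ballI)
    fix w assume w: "w \<in> ?A"
    then obtain u x y v where uv: "w = u @ x # y # v" "length u = i" "x < y"
      using split[of w] by (auto simp: nth_append)
    then have "npairs (<) w = Suc (npairs (<) (swap_at i w))"
      by (auto simp: swap_at_append npairs_append intro!: arg_cong[where f = sum_list] map_cong)
    then have "tvar ^ npairs (<) w * K w + tvar ^ npairs (<) (swap_at i w) * K (swap_at i w) =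
        tvar ^ npairs (<) (swap_at i w) * (tvar * K w + K (swap_at i w))"
      by (simp add: algebra_simps)
    then show "tvar ^ npairs (<) w * K w + tvar ^ npairs (<) (swap_at i w) * K (swap_at i w) = 0"
      using K[OF uv(2,3)] uv by (simp add: swap_at_append)
  qed
  finally show ?thesis .
qed

text \<open>In the application, a word lists the colours of the clique; its first a letters belong to the
  neighbours of vertex 1, its last b letters to the neighbours of vertex n.\<close>

definition end_sum ::
    "(nat \<Rightarrow> int poly) \<Rightarrow> (nat \<Rightarrow> int poly) \<Rightarrow> nat set \<Rightarrow> nat \<Rightarrow> nat \<Rightarrow> int poly" where
  "end_sum f g S a b = (\<Sum>w\<in>perms S. tvar ^ npairs (<) w *
     (prod_list (map f (take a w)) * prod_list (map g (drop (card S - b) w))))"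

text \<open>The characteristic polynomial is (z - 1)(z - t), so the solutions are spanned by 1 and
  t^j, equivalently by 1 and [j]. The bound k reflects that the exchange argument is available only
  while the two end blocks are disjoint.\<close>

lemma qint_recurrence_solution:
  fixes F :: "nat \<Rightarrow> int poly"
  assumes rec: "\<And>i. Suc (Suc i) \<le> k \<Longrightarrow> (1 + tvar) * F (Suc i) = tvar * F i + F (Suc (Suc i))"
    and "j \<le> k"
  shows "F j = F 0 + qint j * (F 1 - F 0)"
  using \<open>j \<le> k\<close>
proof (induction j rule: less_induct)
  case (less j)
  consider "j = 0" | "j = 1" | i where "j = Suc (Suc i)"
    by (metis One_nat_def not0_implies_Suc)
  then show ?case
  proof cases
    case (3 i)
    have "F j = (1 + tvar) * F (Suc i) - tvar * F i"
      using rec[of i] less.prems 3 by simp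
    also have "F (Suc i) = F 0 + qint (Suc i) * (F 1 - F 0)"
      using less.IH[of "Suc i"] less.prems 3 by linarith
    also have "F i = F 0 + qint i * (F 1 - F 0)"
      using less.IH[of i] less.prems 3 by linarith
    also have "(1 + tvar) * (F 0 + qint (Suc i) * (F 1 - F 0)) - tvar * (F 0 + qint i * (F 1 - F 0)) =
        F 0 + qint j * (F 1 - F 0)"
      unfolding 3 qint_Suc power_Suc by algebra
    finally show ?thesis .
  qed simp_all
qed

context
  fixes f g :: "nat \<Rightarrow> int poly" and S :: "nat set"
  assumes fin: "finite S"
    and f: "\<And>x y. x < y \<Longrightarrow> f x = 1 \<or> f y = tvar"
    and g: "\<And>x y. x < y \<Longrightarrow> g x = tvar \<or> g y = 1"
begin

text \<open>Apart from the power of t, \<open>K\<close> is the difference of the two sides for one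
  word. Blocks of lengths a, a+1 and a+2 differ only in the letters at positions a and a+1, and for
  letters x < y at these positions the cancellation is the relation (f x - 1)(f y - t) = 0.\<close>

lemma end_sum_left_modular:
  assumes "Suc (Suc a) + b \<le> card S"
  shows "(1 + tvar) * end_sum f g S (Suc a) b =
    tvar * end_sum f g S a b + end_sum f g S (Suc (Suc a)) b"
proof -
  define K where "K w = prod_list (map g (drop (card S - b) w)) *
    ((1 + tvar) * prod_list (map f (take (Suc a) w)) - tvar * prod_list (map f (take a w)) -
     prod_list (map f (take (Suc (Suc a)) w)))" for w
  have "(\<Sum>w\<in>perms S. tvar ^ npairs (<) w * K w) = 0"
  proof (rule sum_permutations_eq_0_if_antisym_swap[OF fin])
    show "Suc a < card S" using assms by simp
    fix u v :: "nat list" and x y :: nat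
    assume u: "length u = a" and "x < y"
    obtain d where d: "card S - b = Suc (Suc a) + d"
      using assms by (metis add_le_imp_le_diff le_Suc_ex)
    have "drop (card S - b) (u @ x # y # v) = drop d v" "drop (card S - b) (u @ y # x # v) = drop d v"
      unfolding d using u by simp_all
    moreover have "(f x - 1) * (f y - tvar) = 0"
      using f[OF \<open>x < y\<close>] by auto
    then have "f x * f y = tvar * f x + f y - tvar"
      by (simp add: algebra_simps)
    moreover have "tvar * (G * ((1 + tvar) * (F * X) - tvar * F - F * (X * Y))) +
       G * ((1 + tvar) * (F * Y) - tvar * F - F * (Y * X)) = 0"
      if "X * Y = tvar * X + Y - tvar" for F G X Y :: "int poly"
      using that by algebra
    ultimately show "tvar * K (u @ x # y # v) + K (u @ y # x # v) = 0"
      using u by (simp add: K_def)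
  qed
  then show ?thesis
    by (simp add: end_sum_def sum_distrib_left K_def algebra_simps sum.distrib sum_subtractf)
qed

lemma end_sum_right_modular:
  assumes "a + Suc (Suc b) \<le> card S"
  shows "(1 + tvar) * end_sum f g S a (Suc b) =
    tvar * end_sum f g S a b + end_sum f g S a (Suc (Suc b))"
proof -
  \<comment> \<open>The block of the b+2 final letters begins at position i, so enlarging the block
    from b to b+2 letters concerns exactly the positions i+1 and i.\<close>
  define i where "i = card S - Suc (Suc b)"
  have i: "card S - b = Suc (Suc i)" "card S - Suc b = Suc i" "card S - Suc (Suc b) = i" "a \<le> i"
    using assms by (auto simp: i_def)
  define K where "K w = prod_list (map f (take a w)) *
    ((1 + tvar) * prod_list (map g (drop (Suc i) w)) - tvar * prod_list (map g (drop (Suc (Suc i)) w)) -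
     prod_list (map g (drop i w)))" for w
  have "(\<Sum>w\<in>perms S. tvar ^ npairs (<) w * K w) = 0"
  proof (rule sum_permutations_eq_0_if_antisym_swap[OF fin])
    show "Suc i < card S" using assms by (simp add: i_def)
    fix u v :: "nat list" and x y :: nat
    assume u: "length u = i" and "x < y"
    have "take a (u @ x # y # v) = take a u" "take a (u @ y # x # v) = take a u"
      using u i by simp_all
    moreover have "(g x - tvar) * (g y - 1) = 0"
      using g[OF \<open>x < y\<close>] by auto
    then have "g x * g y = g x + tvar * g y - tvar"
      by (simp add: algebra_simps)
    moreover have "tvar * (G * ((1 + tvar) * (Y * F) - tvar * F - X * (Y * F))) +
       G * ((1 + tvar) * (X * F) - tvar * F - Y * (X * F)) = 0"
      if "X * Y = X + tvar * Y - tvar" for F G X Y :: "int poly"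
      using that by algebra
    ultimately show "tvar * K (u @ x # y # v) + K (u @ y # x # v) = 0"
      using u by (simp add: K_def)
  qed
  then show ?thesis
    by (simp add: end_sum_def sum_distrib_left K_def algebra_simps sum.distrib sum_subtractf i)
qed

text \<open>The recurrence in a is solved for fixed b, which leaves \<open>M 0 b\<close> and
  \<open>M 1 b\<close>; each of these is then solved in b.\<close>

lemma end_sum_bilinear:
  assumes "1 \<le> a" "1 \<le> b" "a + b \<le> card S"
  defines "M \<equiv> end_sum f g S"
  shows "M a b = M 0 0 + qint a * (M 1 0 - M 0 0) + qint b * (M 0 1 - M 0 0) +
     qint a * qint b * (M 1 1 - M 1 0 - M 0 1 + M 0 0)"
proof -
  have "M a b = M 0 b + qint a * (M 1 b - M 0 b)"
    unfolding M_def using assms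
    by (intro qint_recurrence_solution[where k = a] end_sum_left_modular) auto
  also have "M 0 b = M 0 0 + qint b * (M 0 1 - M 0 0)"
    unfolding M_def using assms
    by (intro qint_recurrence_solution[where k = b] end_sum_right_modular) auto
  also have "M 1 b = M 1 0 + qint b * (M 1 1 - M 1 0)"
    unfolding M_def using assms
    by (intro qint_recurrence_solution[where k = b] end_sum_right_modular) auto
  finally show ?thesis by algebra
qed

end

text \<open>The letter z may stand in front or directly behind a letter of A, and it gains one
  R-pair for each letter of A before it, so the admissible places contribute t^0, ..., t^|V \<inter>
  A|. The third condition on D lets z be deleted again: the letter of A before it may be followed by
  any letter of V.\<close>

lemma sum_permutations_insert:
  fixes V :: "'a set" and R D :: "'a \<Rightarrow> 'a \<Rightarrow> bool"
  assumes V: "finite V" "z \<notin> V"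
    and D: "\<And>x. x \<in> V \<Longrightarrow> D z x" "\<And>x. x \<in> V \<Longrightarrow> D x z \<longleftrightarrow> x \<in> A"
      "\<And>x y. x \<in> V \<Longrightarrow> y \<in> V \<Longrightarrow> x \<in> A \<Longrightarrow> D x y"
    and R: "\<And>x. x \<in> V \<Longrightarrow> \<not> R z x" "\<And>x. x \<in> V \<Longrightarrow> R x z \<longleftrightarrow> x \<in> A"
  shows "(\<Sum>w | w \<in> perms (insert z V) \<and> successively D w. tvar ^ npairs R w) =
    qint (Suc (card (V \<inter> A))) * (\<Sum>w | w \<in> perms V \<and> successively D w. tvar ^ npairs R w)"
proof -
  define ins where "ins i w = take i w @ z # drop i w" for i and w :: "'a list"
  define ok where "ok w = {i. i \<le> length w \<and> (i = 0 \<or> w ! (i - 1) \<in> A)}" for w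
  let ?W = "{w. w \<in> perms V \<and> successively D w}"
  have fin_ok: "finite (ok w)" for w
    by (rule finite_subset[of _ "{..length w}"]) (auto simp: ok_def)
  have succ_ins: "successively D (ins i w) \<longleftrightarrow> successively D w \<and> i \<in> ok w"
    if w: "w \<in> perms V" and i: "i \<le> length w" for w i
  proof -
    define u v where "u = take i w" and "v = drop i w"
    have uv: "w = u @ v" "i = length u" "set u \<subseteq> V" "set v \<subseteq> V"
      using w i by (auto simp: u_def v_def permutations_of_set_def dest: in_set_takeD in_set_dropD)
    have "i \<in> ok w \<longleftrightarrow> u = [] \<or> last u \<in> A"
      using uv by (cases "u = []") (auto simp: ok_def last_conv_nth nth_append)
    moreover have "last u \<in> V" if "u \<noteq> []"
      using that uv by auto
    moreover have "hd v \<in> V" if "v \<noteq> []"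
      using that uv by auto
    ultimately show ?thesis
      using D uv unfolding ins_def u_def[symmetric] v_def[symmetric]
      by (auto simp: successively_append_iff successively_Cons)
  qed
  have npairs_ins: "npairs R (ins i w) = npairs R w + length (filter (\<lambda>x. x \<in> A) (take i w))"
    if w: "w \<in> perms V" and i: "i \<le> length w" for w i
  proof -
    define u v where uv_def: "u = take i w" "v = drop i w"
    then have uv: "w = u @ v" "set u \<subseteq> V" "set v \<subseteq> V"
      using w i by (auto simp: permutations_of_set_def dest: in_set_takeD in_set_dropD)
    have "filter (R z) v = []"
      using uv R by (auto simp: filter_empty_conv)
    moreover have "(\<Sum>x\<leftarrow>u. length (filter (R x) (z # v))) =
        (\<Sum>x\<leftarrow>u. length (filter (R x) v)) + length (filter (\<lambda>x. x \<in> A) u)"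
      using uv(2) R(2) by (induction u) auto
    ultimately show ?thesis
      unfolding ins_def uv_def[symmetric] by (simp add: uv(1) npairs_append)
  qed
  \<comment> \<open>Appending a letter of A opens exactly one further place, the end of the word,
    and its exponent is one more than the largest so far.\<close>
  have ok_sum: "(\<Sum>i\<in>ok w. tvar ^ length (filter (\<lambda>x. x \<in> A) (take i w))) =
      qint (Suc (length (filter (\<lambda>x. x \<in> A) w)))" for w
  proof (induction w rule: rev_induct)
    case (snoc x w)
    have "ok (w @ [x]) = (if x \<in> A then insert (Suc (length w)) (ok w) else ok w)"
      by (auto simp: ok_def nth_append le_Suc_eq split: if_splits)
    moreover have "Suc (length w) \<notin> ok w"
      by (simp add: ok_def)
    moreover have "(\<Sum>i\<in>ok w. tvar ^ length (filter (\<lambda>x. x \<in> A) (take i (w @ [x])))) =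
        (\<Sum>i\<in>ok w. tvar ^ length (filter (\<lambda>x. x \<in> A) (take i w)))"
      by (intro sum.cong) (auto simp: ok_def)
    ultimately show ?case
      using snoc fin_ok[of w] by (auto simp: qint_Suc)
  next
    case Nil
    have "ok [] = {0}"
      by (auto simp: ok_def)
    then show ?case by simp
  qed
  have bij: "bij_betw (\<lambda>p. ins (snd p) (fst p)) (Sigma ?W ok)
       {w. w \<in> perms (insert z V) \<and> successively D w}"
  proof (rule bij_betwI')
    fix p q assume "p \<in> Sigma ?W ok" and "q \<in> Sigma ?W ok"
    then obtain w i w' i' where p: "p = (w, i)" "w \<in> ?W" "i \<in> ok w"
      and q: "q = (w', i')" "w' \<in> ?W" "i' \<in> ok w'"
      by auto
    have z: "z \<notin> set w" "z \<notin> set w'"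
      using p(2) q(2) V(2) by (auto simp: permutations_of_set_def)
    show "(ins (snd p) (fst p) = ins (snd q) (fst q)) = (p = q)"
    proof
      assume "ins (snd p) (fst p) = ins (snd q) (fst q)"
      then have "take i w @ z # drop i w = take i' w' @ z # drop i' w'"
        by (simp add: ins_def p(1) q(1))
      moreover have "z \<notin> set (take i w)" "z \<notin> set (drop i w)"
        using z(1) by (auto dest: in_set_takeD in_set_dropD)
      ultimately have eq: "take i w = take i' w'" "drop i w = drop i' w'"
        by (simp_all add: append_Cons_eq_iff)
      then have "w = w'"
        by (metis append_take_drop_id)
      moreover have "i = i'"
        using arg_cong[OF eq(1), of length] p(3) q(3) by (simp add: ok_def)
      ultimately show "p = q" by (simp add: p(1) q(1))
    qed simp
  next
    fix p assume "p \<in> Sigma ?W ok"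
    then obtain w i where wi: "p = (w, i)" "w \<in> ?W" "i \<in> ok w"
      by auto
    have "set (take i w) \<inter> set (drop i w) = {}"
      using wi by (intro set_take_disj_set_drop_if_distinct) (auto simp: permutations_of_set_def)
    moreover have "set (take i w) \<union> set (drop i w) = V"
      using wi by (simp add: permutations_of_set_def flip: set_append)
    ultimately have "ins i w \<in> perms (insert z V)"
      using V wi by (auto simp: permutations_of_set_def ins_def)
    then show "ins (snd p) (fst p) \<in> {w. w \<in> perms (insert z V) \<and> successively D w}"
      using wi succ_ins[of w i] by (auto simp: ok_def)
  next
    fix w assume w: "w \<in> {w. w \<in> perms (insert z V) \<and> successively D w}"
    then have "z \<in> set w"
      by (auto simp: permutations_of_set_def)
    then obtain u v where uv: "w = u @ z # v"
      by (meson split_list)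
    have "u @ v \<in> perms V"
      using w uv V by (auto simp: permutations_of_set_def)
    moreover have "w = ins (length u) (u @ v)"
      by (simp add: uv ins_def)
    moreover from this have "successively D (u @ v)" "length u \<in> ok (u @ v)"
      using w succ_ins[of "u @ v" "length u"] calculation(1) by auto
    ultimately show "\<exists>p\<in>Sigma ?W ok. w = ins (snd p) (fst p)"
      by (intro bexI[of _ "(u @ v, length u)"]) auto
  qed
  have "(\<Sum>w | w \<in> perms (insert z V) \<and> successively D w. tvar ^ npairs R w) =
      (\<Sum>(w, i)\<in>Sigma ?W ok. tvar ^ npairs R (ins i w))"
    using sum.reindex_bij_betw[OF bij, of "\<lambda>w. tvar ^ npairs R w"] by (simp add: case_prod_beta)
  also have "\<dots> = (\<Sum>w\<in>?W. \<Sum>i\<in>ok w. tvar ^ npairs R (ins i w))"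
    using fin_ok by (subst sum.Sigma) auto
  also have "\<dots> = (\<Sum>w\<in>?W. tvar ^ npairs R w * qint (Suc (card (V \<inter> A))))"
  proof (rule sum.cong[OF refl])
    fix w assume w: "w \<in> ?W"
    have "(\<Sum>i\<in>ok w. tvar ^ npairs R (ins i w)) =
        tvar ^ npairs R w * (\<Sum>i\<in>ok w. tvar ^ length (filter (\<lambda>x. x \<in> A) (take i w)))"
      using w npairs_ins[of w] by (auto simp: sum_distrib_left ok_def power_add intro!: sum.cong)
    then show "(\<Sum>i\<in>ok w. tvar ^ npairs R (ins i w)) = tvar ^ npairs R w * qint (Suc (card (V \<inter> A)))"
      using w length_filter_permutation[of w V "\<lambda>x. x \<in> A"] by (simp add: ok_sum Int_def)
  qed
  finally show ?thesis
    by (simp add: sum_distrib_left mult.commute)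
qed

section \<open>Weighted sums over permutations of a colour set\<close>

lemma sum_permutations_hd:
  fixes S :: "nat set" and u :: "nat \<Rightarrow> int poly"
  assumes "finite S" "card S = Suc k"
  shows "(\<Sum>w\<in>perms S. tvar ^ npairs (<) w * u (hd w)) =
    qfact k * (\<Sum>x\<in>S. tvar ^ card {z\<in>S. x < z} * u x)"
proof -
  have "(\<Sum>w\<in>perms (S - {x}). tvar ^ npairs (<) (x # w) * u (hd (x # w))) =
      qfact k * (tvar ^ card {z\<in>S. x < z} * u x)" if "x \<in> S" for x
  proof -
    have "{z \<in> S - {x}. x < z} = {z\<in>S. x < z}" by auto
    then have "(\<Sum>w\<in>perms (S - {x}). tvar ^ npairs (<) (x # w) * u (hd (x # w))) =
       (\<Sum>w\<in>perms (S - {x}). tvar ^ card {z\<in>S. x < z} * u x * tvar ^ npairs (<) w)"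
      by (intro sum.cong) (simp_all add: length_filter_permutation power_add)
    then show ?thesis
      using assms that
      by (simp add: sum_permutations_tvar_npairs_less flip: sum_distrib_left)
  qed
  moreover have "S \<noteq> {}" using assms by auto
  ultimately show ?thesis
    using assms by (subst sum_permutations_of_set_Cons) (simp_all add: sum_distrib_left)
qed

lemma sum_permutations_last:
  fixes S :: "nat set" and v :: "nat \<Rightarrow> int poly"
  assumes "finite S" "card S = Suc k"
  shows "(\<Sum>w\<in>perms S. tvar ^ npairs (<) w * v (last w)) =
    qfact k * (\<Sum>y\<in>S. tvar ^ card {z\<in>S. z < y} * v y)"
proof -
  have "(\<Sum>w\<in>perms (S - {y}). tvar ^ npairs (<) (w @ [y]) * v (last (w @ [y]))) =
      qfact k * (tvar ^ card {z\<in>S. z < y} * v y)" if "y \<in> S" for y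
  proof -
    have "{z \<in> S - {y}. z < y} = {z\<in>S. z < y}" by auto
    then have "(\<Sum>w\<in>perms (S - {y}). tvar ^ npairs (<) (w @ [y]) * v (last (w @ [y]))) =
       (\<Sum>w\<in>perms (S - {y}). tvar ^ card {z\<in>S. z < y} * v y * tvar ^ npairs (<) w)"
      by (intro sum.cong) (simp_all add: length_filter_permutation npairs_snoc power_add)
    then show ?thesis
      using assms that
      by (simp add: sum_permutations_tvar_npairs_less flip: sum_distrib_left)
  qed
  moreover have "S \<noteq> {}" using assms by auto
  ultimately show ?thesis
    using assms by (subst sum_permutations_of_set_snoc) (simp_all add: sum_distrib_left)
qed

text \<open>The pair formed by the first and the last letter is counted with the first, so the
  exponent of the last letter y is taken in \<open>S - {x}\<close>. This, and the restriction to
  distinct x and y, keep the double sum from being a product.\<close>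

lemma sum_permutations_hd_last:
  fixes S :: "nat set" and u v :: "nat \<Rightarrow> int poly"
  assumes "finite S" "card S = Suc (Suc k)"
  shows "(\<Sum>w\<in>perms S. tvar ^ npairs (<) w * (u (hd w) * v (last w))) =
    qfact k * (\<Sum>x\<in>S. \<Sum>y\<in>S - {x}. tvar ^ (card {z\<in>S. x < z} + card {z\<in>S - {x}. z < y}) * (u x * v y))"
proof -
  have "(\<Sum>w\<in>perms (S - {x}). tvar ^ npairs (<) (x # w) * (u (hd (x # w)) * v (last (x # w)))) =
      qfact k * (\<Sum>y\<in>S - {x}. tvar ^ (card {z\<in>S. x < z} + card {z\<in>S - {x}. z < y}) * (u x * v y))"
    if "x \<in> S" for x
  proof -
    have "{z \<in> S - {x}. x < z} = {z\<in>S. x < z}" by auto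
    moreover have "w \<noteq> []" if "w \<in> perms (S - {x})" for w
      using that assms \<open>x \<in> S\<close> length_finite_permutations_of_set[OF that] by auto
    ultimately have "(\<Sum>w\<in>perms (S - {x}).
          tvar ^ npairs (<) (x # w) * (u (hd (x # w)) * v (last (x # w)))) =
       (\<Sum>w\<in>perms (S - {x}). tvar ^ card {z\<in>S. x < z} * u x * (tvar ^ npairs (<) w * v (last w)))"
      by (intro sum.cong) (simp_all add: length_filter_permutation power_add)
    also have "\<dots> = tvar ^ card {z\<in>S. x < z} * u x *
        (qfact k * (\<Sum>y\<in>S - {x}. tvar ^ card {z\<in>S - {x}. z < y} * v y))"
      using assms that by (simp add: sum_permutations_last flip: sum_distrib_left)
    finally show ?thesis
      by (simp add: sum_distrib_left power_add mult_ac)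
  qed
  moreover have "S \<noteq> {}" using assms by auto
  ultimately show ?thesis
    using assms by (subst sum_permutations_of_set_Cons) (simp_all add: sum_distrib_left)
qed

text \<open>Contribution of a neighbour of colour x to t^asc when vertex 1 has colour p (resp. a neighbour of
  colour y when vertex n has colour q); the value 0 excludes improper colourings.\<close>

definition above_weight :: "nat \<Rightarrow> nat \<Rightarrow> int poly" where
  "above_weight p x = (if x < p then 1 else if x = p then 0 else tvar)"

definition below_weight :: "nat \<Rightarrow> nat \<Rightarrow> int poly" where
  "below_weight q y = (if y < q then tvar else if y = q then 0 else 1)"

section \<open>Corner values of the end-weighted sum and their mixed difference\<close>

lemma end_sum_0_0:
  assumes "finite S"
  shows "end_sum f g S 0 0 = qfact (card S)"
proof -
  have "drop (card S) w = []" if "w \<in> perms S" for w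
    using that by (simp add: length_finite_permutations_of_set)
  then show ?thesis
    using assms by (simp add: end_sum_def sum_permutations_tvar_npairs_less)
qed

lemma end_sum_1_0:
  assumes "finite S" "card S = Suc k"
  shows "end_sum f g S 1 0 = (\<Sum>w\<in>perms S. tvar ^ npairs (<) w * f (hd w))"
  unfolding end_sum_def
proof (rule sum.cong[OF refl])
  fix w assume "w \<in> perms S"
  then have "length w = Suc k"
    using assms by (simp add: length_finite_permutations_of_set)
  then show "tvar ^ npairs (<) w * (prod_list (map f (take 1 w)) * prod_list (map g (drop (card S - 0) w))) =
      tvar ^ npairs (<) w * f (hd w)"
    using assms by (cases w) auto
qed

lemma end_sum_0_1:
  assumes "finite S" "card S = Suc k"
  shows "end_sum f g S 0 1 = (\<Sum>w\<in>perms S. tvar ^ npairs (<) w * g (last w))"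
  unfolding end_sum_def
proof (rule sum.cong[OF refl])
  fix w assume "w \<in> perms S"
  then have "length w = Suc k"
    using assms by (simp add: length_finite_permutations_of_set)
  then show "tvar ^ npairs (<) w * (prod_list (map f (take 0 w)) * prod_list (map g (drop (card S - 1) w))) =
      tvar ^ npairs (<) w * g (last w)"
    using assms by (cases w rule: rev_cases) auto
qed

lemma end_sum_1_1:
  assumes "finite S" "card S = Suc k"
  shows "end_sum f g S 1 1 =
    (\<Sum>w\<in>perms S. tvar ^ npairs (<) w * (f (hd w) * g (last w)))"
  unfolding end_sum_def
proof (rule sum.cong[OF refl])
  fix w assume "w \<in> perms S"
  then have l: "length w = Suc k"
    using assms by (simp add: length_finite_permutations_of_set)
  then have "take 1 w = [hd w]" by (cases w) auto
  moreover have "drop (card S - 1) w = [last w]"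
    using assms l by (cases w rule: rev_cases) auto
  ultimately show "tvar ^ npairs (<) w * (prod_list (map f (take 1 w)) * prod_list (map g (drop (card S - 1) w))) =
      tvar ^ npairs (<) w * (f (hd w) * g (last w))"
    by simp
qed

text \<open>Up to a q-factorial, the mixed difference M(1,1) - M(1,0) - M(0,1) + M(0,0) of
  \<open>end_sum\<close>, hence the coefficient of [a] [b]. Taking differences replaces the weights
  at both ends by weight minus 1.\<close>

definition mixed_diff :: "nat set \<Rightarrow> nat \<Rightarrow> nat \<Rightarrow> int poly" where
  "mixed_diff S p q = (\<Sum>x\<in>S. \<Sum>y\<in>S - {x}.
     tvar ^ (card {z\<in>S. x < z} + card {z\<in>S - {x}. z < y}) * ((above_weight p x - 1) * (below_weight q y - 1)))"

text \<open>Beyond p every weight minus 1 equals t - 1, and the ranks in the tail above y are 0,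
  ..., j-1, so the sum is (t - 1)[j] = t^j - 1.\<close>

lemma sum_above_weight_greater:
  assumes "finite S" "p \<le> y"
  shows "(\<Sum>x | x \<in> S \<and> y < x. tvar ^ card {z\<in>S. x < z} * (above_weight p x - 1)) =
    tvar ^ card {z\<in>S. y < z} - 1"
proof -
  let ?A = "{x\<in>S. y < x}"
  have "(\<Sum>x\<in>?A. tvar ^ card {z\<in>S. x < z} * (above_weight p x - 1)) =
      (\<Sum>x\<in>?A. tvar ^ card {z\<in>?A. x < z} * (tvar - 1))"
  proof (rule sum.cong[OF refl])
    fix x assume x: "x \<in> ?A"
    then have "{z\<in>?A. x < z} = {z\<in>S. x < z}" by auto
    then show "tvar ^ card {z\<in>S. x < z} * (above_weight p x - 1) = tvar ^ card {z\<in>?A. x < z} * (tvar - 1)"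
      using x assms by (simp add: above_weight_def)
  qed
  also have "\<dots> = (tvar - 1) * qint (card ?A)"
    using assms sum_tvar_power_card_greater[of ?A] by (simp flip: sum_distrib_right)
  finally show ?thesis
    using tvar_power_eq[of "card ?A"] by simp
qed

lemma sum_below_weight_less:
  assumes "finite S" "y \<le> q"
  shows "(\<Sum>x | x \<in> S \<and> x < y. tvar ^ card {z\<in>S. z < x} * (below_weight q x - 1)) =
    tvar ^ card {z\<in>S. z < y} - 1"
proof -
  let ?A = "{x\<in>S. x < y}"
  have "(\<Sum>x\<in>?A. tvar ^ card {z\<in>S. z < x} * (below_weight q x - 1)) =
      (\<Sum>x\<in>?A. tvar ^ card {z\<in>?A. z < x} * (tvar - 1))"
  proof (rule sum.cong[OF refl])
    fix x assume x: "x \<in> ?A"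
    then have "{z\<in>?A. z < x} = {z\<in>S. z < x}" by auto
    then show "tvar ^ card {z\<in>S. z < x} * (below_weight q x - 1) = tvar ^ card {z\<in>?A. z < x} * (tvar - 1)"
      using x assms by (simp add: below_weight_def)
  qed
  also have "\<dots> = (tvar - 1) * qint (card ?A)"
    using assms sum_tvar_power_card_less[of ?A] by (simp flip: sum_distrib_right)
  finally show ?thesis
    using tvar_power_eq[of "card ?A"] by simp
qed

lemma sum_split_at:
  fixes h :: "nat \<Rightarrow> int poly"
  assumes "finite S"
  shows "(\<Sum>x\<in>S. h x) = (\<Sum>x | x \<in> S \<and> x < p. h x) + (if p \<in> S then h p else 0) + (\<Sum>x | x \<in> S \<and> p < x. h x)"
proof -
  have "S = {x\<in>S. x < p} \<union> (S \<inter> {p}) \<union> {x\<in>S. p < x}" by auto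
  then have "(\<Sum>x\<in>S. h x) = (\<Sum>x\<in>{x\<in>S. x < p} \<union> (S \<inter> {p}) \<union> {x\<in>S. p < x}. h x)" by simp
  also have "\<dots> = (\<Sum>x | x \<in> S \<and> x < p. h x) + (\<Sum>x\<in>S \<inter> {p}. h x) + (\<Sum>x | x \<in> S \<and> p < x. h x)"
    using assms by (subst sum.union_disjoint; (subst sum.union_disjoint)?) auto
  also have "(\<Sum>x\<in>S \<inter> {p}. h x) = (if p \<in> S then h p else 0)"
    by auto
  finally show ?thesis .
qed

text \<open>Colours below p have weight 1 and drop out, the tail above p sums to t^j - 1, and p
  itself, if it lies in S, contributes -t^j.\<close>

lemma sum_above_weight:
  assumes "finite S"
  shows "(\<Sum>x\<in>S. tvar ^ card {z\<in>S. x < z} * (above_weight p x - 1)) =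
    (if p \<in> S then 0 else tvar ^ card {z\<in>S. p < z}) - 1"
proof -
  have "(\<Sum>x | x \<in> S \<and> x < p. tvar ^ card {z\<in>S. x < z} * (above_weight p x - 1)) = 0"
    by (rule sum.neutral) (simp add: above_weight_def)
  then show ?thesis
    using assms by (subst sum_split_at[of S _ p])
      (simp_all add: sum_above_weight_greater, simp add: above_weight_def)
qed

lemma sum_below_weight:
  assumes "finite S"
  shows "(\<Sum>x\<in>S. tvar ^ card {z\<in>S. z < x} * (below_weight q x - 1)) =
    (if q \<in> S then 0 else tvar ^ card {z\<in>S. z < q}) - 1"
proof -
  have "(\<Sum>x | x \<in> S \<and> q < x. tvar ^ card {z\<in>S. z < x} * (below_weight q x - 1)) = 0"
    by (rule sum.neutral) (simp add: below_weight_def)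
  then show ?thesis
    using assms by (subst sum_split_at[of S _ q])
      (simp_all add: sum_below_weight_less, simp add: below_weight_def)
qed

lemma card_split_at:
  fixes S :: "nat set"
  assumes "finite S"
  shows "card S = card {z\<in>S. z < p} + (if p \<in> S then 1 else 0) + card {z\<in>S. p < z}"
proof -
  have "S = {x\<in>S. x < p} \<union> (S \<inter> {p}) \<union> {x\<in>S. p < x}" by auto
  then have "card S = card ({x\<in>S. x < p} \<union> (S \<inter> {p}) \<union> {x\<in>S. p < x})" by simp
  also have "\<dots> = card {z\<in>S. z < p} + card (S \<inter> {p}) + card {z\<in>S. p < z}"
    using assms by (subst card_Un_disjoint; (subst card_Un_disjoint)?) auto
  finally show ?thesis by auto
qed

text \<open>The double sum is rewritten as a sum over y of \<open>v y\<close> times a sum over x.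
  The latter depends on y only through its position relative to p: colours x below p contribute
  nothing if y \<le> p, and for y > p the powers of t that involve y cancel.\<close>

lemma mixed_diff_iterated:
  fixes S :: "nat set" and p q :: nat
  assumes "finite S"
  defines "v \<equiv> \<lambda>y. tvar ^ card {z\<in>S. z < y} * (below_weight q y - 1)"
    and "U \<equiv> (if p \<in> S then 0 else tvar ^ card {z\<in>S. p < z}) - 1"
  shows "tvar * mixed_diff S p q =
    tvar * U * (\<Sum>y | y \<in> S \<and> y < p. v y) +
    (if p \<in> S then v p * (tvar ^ Suc (card {z\<in>S. p < z}) - tvar) else 0) +
    (U + 1 - tvar) * (\<Sum>y | y \<in> S \<and> p < y. v y)"
proof -
  define u where "u x = tvar ^ card {z\<in>S. x < z} * (above_weight p x - 1)" for x
  \<comment> \<open>Removing x lowers the number of colours below y exactly if x < y. With the extra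
    factor t no negative exponent arises: the result is the power for the full rank of y in S, times
    t if y < x.\<close>
  have tpow: "tvar * tvar ^ card {z\<in>S - {x}. z < y} = tvar ^ card {z\<in>S. z < y} * (if y < x then tvar else 1)"
    if "x \<in> S" "x \<noteq> y" for x y
  proof (cases "x < y")
    case True
    then have "{z\<in>S. z < y} = insert x {z\<in>S - {x}. z < y}"
      using that by auto
    then have "card {z\<in>S. z < y} = Suc (card {z\<in>S - {x}. z < y})"
      using assms by simp
    then show ?thesis using True by simp
  next
    case False
    then have "{z\<in>S. z < y} = {z\<in>S - {x}. z < y}"
      by auto
    then show ?thesis using False that by simp
  qed
  have "tvar * mixed_diff S p q =
      (\<Sum>x\<in>S. \<Sum>y\<in>S - {x}. u x * v y * (if y < x then tvar else 1))"
    unfolding mixed_diff_def sum_distrib_left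
  proof (intro sum.cong refl)
    fix x y assume xy: "x \<in> S" "y \<in> S - {x}"
    have "x \<noteq> y" using xy by auto
    have "tvar * (tvar ^ (card {z\<in>S. x < z} + card {z\<in>S - {x}. z < y}) *
          ((above_weight p x - 1) * (below_weight q y - 1))) =
        u x * (tvar * tvar ^ card {z\<in>S - {x}. z < y}) * (below_weight q y - 1)"
      by (simp only: u_def power_add mult_ac)
    also have "\<dots> = u x * v y * (if y < x then tvar else 1)"
      unfolding tpow[OF xy(1) \<open>x \<noteq> y\<close>] v_def by (simp only: mult_ac)
    finally show "tvar * (tvar ^ (card {z\<in>S. x < z} + card {z\<in>S - {x}. z < y}) *
          ((above_weight p x - 1) * (below_weight q y - 1))) = u x * v y * (if y < x then tvar else 1)" .
  qed
  also have "\<dots> = (\<Sum>x\<in>S. \<Sum>y | y \<in> S \<and> x \<noteq> y. u x * v y * (if y < x then tvar else 1))"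
    by (intro sum.cong refl) auto
  also have "\<dots> = (\<Sum>y\<in>S. \<Sum>x | x \<in> S \<and> x \<noteq> y. u x * v y * (if y < x then tvar else 1))"
    using assms(1) by (rule sum.swap_restrict[OF _ assms(1)])
  also have "\<dots> = (\<Sum>y\<in>S. v y * ((\<Sum>x | x \<in> S \<and> x < y. u x) + tvar * (\<Sum>x | x \<in> S \<and> y < x. u x)))"
  proof (intro sum.cong refl)
    fix y assume "y \<in> S"
    have ne: "{x \<in> S. x \<noteq> y} = {x\<in>S. x < y} \<union> {x\<in>S. y < x}"
      by auto
    have "(\<Sum>x | x \<in> S \<and> x \<noteq> y. u x * v y * (if y < x then tvar else 1)) =
        (\<Sum>x | x \<in> S \<and> x < y. u x * v y * (if y < x then tvar else 1)) +
        (\<Sum>x | x \<in> S \<and> y < x. u x * v y * (if y < x then tvar else 1))"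
      unfolding ne by (rule sum.union_disjoint) (auto simp: assms(1))
    also have "\<dots> = (\<Sum>x | x \<in> S \<and> x < y. u x * v y) + (\<Sum>x | x \<in> S \<and> y < x. u x * v y * tvar)"
      by (intro arg_cong2[where f = "(+)"] sum.cong) auto
    finally show "(\<Sum>x | x \<in> S \<and> x \<noteq> y. u x * v y * (if y < x then tvar else 1)) =
        v y * ((\<Sum>x | x \<in> S \<and> x < y. u x) + tvar * (\<Sum>x | x \<in> S \<and> y < x. u x))"
      by (simp add: sum_distrib_left distrib_left mult_ac)
  qed
  also have "\<dots> = (\<Sum>y\<in>S. v y * (if y < p then tvar * U
      else if y = p then tvar ^ Suc (card {z\<in>S. p < z}) - tvar else U + 1 - tvar))"
  proof (intro sum.cong refl arg_cong[where f = "(*) _"])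
    fix y assume y: "y \<in> S"
    have total: "(\<Sum>x | x \<in> S \<and> x < y. u x) + u y + (\<Sum>x | x \<in> S \<and> y < x. u x) = U"
      using sum_above_weight[OF assms(1), of p] sum_split_at[OF assms(1), of u y] y
      by (simp add: u_def U_def)
    show "(\<Sum>x | x \<in> S \<and> x < y. u x) + tvar * (\<Sum>x | x \<in> S \<and> y < x. u x) =
        (if y < p then tvar * U
         else if y = p then tvar ^ Suc (card {z\<in>S. p < z}) - tvar else U + 1 - tvar)"
    proof (cases "p \<le> y")
      case False
      then have "(\<Sum>x | x \<in> S \<and> x < y. u x) = 0" "u y = 0"
        by (auto simp: u_def above_weight_def intro!: sum.neutral)
      then show ?thesis using False total by simp
    next
      case True
      then have gr: "(\<Sum>x | x \<in> S \<and> y < x. u x) = tvar ^ card {z\<in>S. y < z} - 1"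
        unfolding u_def using assms(1) by (rule sum_above_weight_greater[rotated])
      show ?thesis
      proof (cases "p = y")
        case True
        then have "(\<Sum>x | x \<in> S \<and> x < y. u x) = 0"
          by (auto simp: u_def above_weight_def intro!: sum.neutral)
        then show ?thesis unfolding gr using True by (simp add: algebra_simps)
      next
        case False
        then have "u y = tvar ^ card {z\<in>S. y < z} * (tvar - 1)"
          using \<open>p \<le> y\<close> by (simp add: u_def above_weight_def)
        then have "(\<Sum>x | x \<in> S \<and> x < y. u x) = U + 1 - tvar * tvar ^ card {z\<in>S. y < z}"
          using total gr by (simp add: algebra_simps)
        then show ?thesis using False \<open>p \<le> y\<close> by (simp add: gr right_diff_distrib)
      qed
    qed
  qed
  also have "\<dots> = (\<Sum>y | y \<in> S \<and> y < p. v y * (tvar * U)) +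
      (if p \<in> S then v p * (tvar ^ Suc (card {z\<in>S. p < z}) - tvar) else 0) +
      (\<Sum>y | y \<in> S \<and> p < y. v y * (U + 1 - tvar))"
    by (subst sum_split_at[OF assms(1), of _ p]) (auto intro!: arg_cong2[where f = "(+)"] sum.cong)
  finally show ?thesis
    by (simp add: sum_distrib_left mult_ac)
qed

text \<open>For q < p the terms \<open>v y\<close> vanish from p on, and the product t U V remains.
  For p \<le> q the part of the v-sum below p is geometric, and the part above p is what is missing
  to the total V.\<close>

lemma mixed_diff_eq:
  fixes S :: "nat set" and p q :: nat
  assumes "finite S"
  defines "k \<equiv> card {z\<in>S. p < z}" and "l \<equiv> card {z\<in>S. z < q}"
  shows "tvar * mixed_diff S p q =
    tvar - tvar ^ card S - (if p \<in> S then 0 else tvar ^ Suc k) - (if q \<in> S then 0 else tvar ^ Suc l) +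
    (if p < q then tvar ^ Suc (card S) + (if p \<in> S \<or> q \<in> S then 0 else tvar ^ (k + l))
     else if q < p then tvar ^ card S + (if p \<in> S \<or> q \<in> S then 0 else tvar ^ Suc (k + l))
     else if p \<in> S then 0 else tvar ^ card S + tvar ^ Suc (card S))"
proof -
  define v where "v = (\<lambda>y. tvar ^ card {z\<in>S. z < y} * (below_weight q y - 1))"
  define U where "U = (if p \<in> S then 0 else tvar ^ k) - 1"
  define V where "V = (if q \<in> S then 0 else tvar ^ l) - 1"
  define lp where "lp = card {z\<in>S. z < p}"
  have it: "tvar * mixed_diff S p q = tvar * U * (\<Sum>y | y \<in> S \<and> y < p. v y) +
      (if p \<in> S then v p * (tvar ^ Suc k - tvar) else 0) + (U + 1 - tvar) * (\<Sum>y | y \<in> S \<and> p < y. v y)"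
    unfolding v_def U_def k_def by (rule mixed_diff_iterated[OF assms(1)])
  have total: "(\<Sum>y | y \<in> S \<and> y < p. v y) + (if p \<in> S then v p else 0) + (\<Sum>y | y \<in> S \<and> p < y. v y) = V"
    using sum_below_weight[OF assms(1), of q, folded l_def V_def] sum_split_at[OF assms(1), of v p]
    unfolding v_def by metis
  have low: "(\<Sum>y | y \<in> S \<and> y < p. v y) = tvar ^ lp - 1" if "p \<le> q"
    unfolding v_def lp_def using assms(1) that by (rule sum_below_weight_less)
  have N: "card S = lp + (if p \<in> S then 1 else 0) + k"
    unfolding lp_def k_def by (rule card_split_at[OF assms(1)])
  have high: "(\<Sum>y | y \<in> S \<and> p < y. v y) = V - (\<Sum>y | y \<in> S \<and> y < p. v y) - (if p \<in> S then v p else 0)"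
    using total by (simp add: algebra_simps)
  consider "p < q" | "p = q" | "q < p" by linarith
  then show ?thesis
  proof cases
    case 1
    then have vp: "v p = tvar ^ lp * (tvar - 1)"
      by (simp add: v_def below_weight_def lp_def)
    show ?thesis
      unfolding it high vp low[OF less_imp_le[OF 1]] N U_def V_def using 1
      by (simp add: power_add algebra_simps)
  next
    case 2
    then have vp: "v p = - (tvar ^ lp)" and l: "l = lp"
      by (simp_all add: v_def below_weight_def lp_def l_def)
    show ?thesis
      unfolding it high vp low[OF eq_refl[OF 2]] N U_def V_def l using 2
      by (simp add: power_add algebra_simps)
  next
    case 3
    then have "(\<Sum>y | y \<in> S \<and> p < y. v y) = 0" "v p = 0"
      by (auto simp: v_def below_weight_def intro!: sum.neutral)
    moreover from this have "(\<Sum>y | y \<in> S \<and> y < p. v y) = V"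
      using total by (auto split: if_splits)
    ultimately have UV: "tvar * mixed_diff S p q = tvar * U * V"
      using it by simp
    show ?thesis
      unfolding UV U_def V_def using 3 by (simp add: power_add algebra_simps)
  qed
qed

text \<open>The two first differences and the mixed difference of the corner values are sums over
  permutations with end weights f - 1 and g - 1, which the preceding lemmas evaluate.\<close>

lemma end_sum_closed_form:
  assumes "finite S" "card S = Suc (Suc k)" "1 \<le> a" "1 \<le> b" "a + b \<le> card S"
  shows "end_sum (above_weight p) (below_weight q) S a b =
     qfact (Suc (Suc k)) +
     qint a * (qfact (Suc k) * ((if p \<in> S then 0 else tvar ^ card {z\<in>S. p < z}) - 1)) +
     qint b * (qfact (Suc k) * ((if q \<in> S then 0 else tvar ^ card {z\<in>S. z < q}) - 1)) +
     qint a * qint b * (qfact k * mixed_diff S p q)"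
proof -
  let ?f = "above_weight p" and ?g = "below_weight q"
  let ?M = "end_sum ?f ?g S" and ?P = "perms S"
  have M00: "?M 0 0 = (\<Sum>w\<in>?P. tvar ^ npairs (<) w)"
    using assms by (simp add: end_sum_0_0 sum_permutations_tvar_npairs_less)
  have "?M 1 0 - ?M 0 0 = (\<Sum>w\<in>?P. tvar ^ npairs (<) w * (?f (hd w) - 1))"
    using assms unfolding M00 by (simp only: end_sum_1_0) (simp add: algebra_simps sum_subtractf)
  then have f: "?M 1 0 - ?M 0 0 = qfact (Suc k) * ((if p \<in> S then 0 else tvar ^ card {z\<in>S. p < z}) - 1)"
    using assms by (simp only: sum_permutations_hd[of S "Suc k" "\<lambda>x. ?f x - 1"] sum_above_weight)
  have "?M 0 1 - ?M 0 0 = (\<Sum>w\<in>?P. tvar ^ npairs (<) w * (?g (last w) - 1))"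
    using assms unfolding M00 by (simp only: end_sum_0_1) (simp add: algebra_simps sum_subtractf)
  then have g: "?M 0 1 - ?M 0 0 = qfact (Suc k) * ((if q \<in> S then 0 else tvar ^ card {z\<in>S. z < q}) - 1)"
    using assms by (simp only: sum_permutations_last[of S "Suc k" "\<lambda>x. ?g x - 1"] sum_below_weight)
  have "?M 1 1 - ?M 1 0 - ?M 0 1 + ?M 0 0 =
      (\<Sum>w\<in>?P. tvar ^ npairs (<) w * ((?f (hd w) - 1) * (?g (last w) - 1)))"
    using assms unfolding M00 by (simp only: end_sum_0_1 end_sum_1_0 end_sum_1_1)
       (simp add: algebra_simps sum_subtractf sum.distrib)
  then have fg: "?M 1 1 - ?M 1 0 - ?M 0 1 + ?M 0 0 = qfact k * mixed_diff S p q"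
    using assms by (simp only: sum_permutations_hd_last[of S k "\<lambda>x. ?f x - 1" "\<lambda>x. ?g x - 1"]
        mixed_diff_def)
  have "?M a b = ?M 0 0 + qint a * (?M 1 0 - ?M 0 0) + qint b * (?M 0 1 - ?M 0 0) +
     qint a * qint b * (?M 1 1 - ?M 1 0 - ?M 0 1 + ?M 0 0)"
    using assms by (intro end_sum_bilinear) (auto simp: above_weight_def below_weight_def)
  then show ?thesis
    unfolding f g fg using assms by (simp add: end_sum_0_0)
qed

section \<open>Summation over contents\<close>

text \<open>Set tuples contributing to the coefficient of a monomial, given as a multiset A, in e_k, e_k e_1,
  e_k e_1 e_1 and e_k e_2.\<close>

definition esets1 :: "nat \<Rightarrow> nat multiset \<Rightarrow> nat set set" where
  "esets1 k A = {S. finite S \<and> card S = k \<and> mset_set S = A}"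

definition esets2 :: "nat \<Rightarrow> nat multiset \<Rightarrow> (nat set \<times> nat) set" where
  "esets2 k A = {(S, p). finite S \<and> card S = k \<and> add_mset p (mset_set S) = A}"

definition esets3 :: "nat \<Rightarrow> nat multiset \<Rightarrow> (nat set \<times> nat \<times> nat) set" where
  "esets3 k A = {(S, p, q). finite S \<and> card S = k \<and> add_mset p (add_mset q (mset_set S)) = A}"

definition esets22 :: "nat \<Rightarrow> nat multiset \<Rightarrow> (nat set \<times> nat set) set" where
  "esets22 k A = {(S, U). finite S \<and> card S = k \<and> finite U \<and> card U = 2 \<and> mset_set S + mset_set U = A}"

lemma finite_esets1: "finite (esets1 k A)"
  by (rule finite_subset[of _ "Pow (set_mset A)"]) (auto simp: esets1_def)

lemma finite_esets2: "finite (esets2 k A)"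
  by (rule finite_subset[of _ "Pow (set_mset A) \<times> set_mset A"]) (auto simp: esets2_def)

lemma finite_esets3: "finite (esets3 k A)"
  by (rule finite_subset[of _ "Pow (set_mset A) \<times> set_mset A \<times> set_mset A"]) (auto simp: esets3_def)

lemma sum_esets3_swap: "(\<Sum>(S, p, q)\<in>esets3 k A. h S p q) = (\<Sum>(S, p, q)\<in>esets3 k A. h S q p)"
  by (rule sum.reindex_bij_witness[of _ "\<lambda>(S, p, q). (S, q, p)" "\<lambda>(S, p, q). (S, q, p)"])
    (auto simp: esets3_def add_mset_commute)

text \<open>A triple with p outside S is the same as a pair (\<open>insert p S\<close>, q) together
  with a marked element p of its set.\<close>

lemma sum_esets3_notin:
  fixes h :: "nat set \<Rightarrow> nat \<Rightarrow> 'b::comm_monoid_add"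
  shows "(\<Sum>(S, p, q)\<in>esets3 k A. if p \<in> S then 0 else h (insert p S) p) =
    (\<Sum>(S, q)\<in>esets2 (Suc k) A. \<Sum>p\<in>S. h S p)"
proof -
  have "(\<Sum>(S, p, q)\<in>esets3 k A. if p \<in> S then 0 else h (insert p S) p) =
      (\<Sum>(S, p, q)\<in>{(S, p, q) \<in> esets3 k A. p \<notin> S}. h (insert p S) p)"
    by (rule sum.mono_neutral_cong_right) (auto simp: finite_esets3)
  also have "\<dots> = (\<Sum>(Q, p)\<in>Sigma (esets2 (Suc k) A) fst. h (fst Q) p)"
    by (rule sum.reindex_bij_witness[of _ "\<lambda>((S, q), p). (S - {p}, p, q)" "\<lambda>(S, p, q). ((insert p S, q), p)"])
      (auto simp: esets3_def esets2_def insert_absorb mset_set.insert_remove add_mset_commute mset_set.remove)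
  also have "\<dots> = (\<Sum>Q\<in>esets2 (Suc k) A. \<Sum>p\<in>fst Q. h (fst Q) p)"
    by (subst sum.Sigma[OF finite_esets2]) (auto simp: esets2_def)
  finally show ?thesis by (simp add: case_prod_beta)
qed

lemma sum_esets3_notin_greater:
  "(\<Sum>(S, p, q)\<in>esets3 k A. if p \<in> S then 0 else tvar ^ card {z\<in>S. p < z}) =
    qint (Suc k) * of_nat (card (esets2 (Suc k) A))"
proof -
  have *: "{z \<in> insert p S. p < z} = {z\<in>S. p < z}" for p :: nat and S
    by auto
  have "(\<Sum>(S, p, q)\<in>esets3 k A. if p \<in> S then 0 else tvar ^ card {z\<in>S. p < z}) =
      (\<Sum>(S, q)\<in>esets2 (Suc k) A. \<Sum>p\<in>S. tvar ^ card {z\<in>S. p < z})"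
    using sum_esets3_notin[of "\<lambda>S p. tvar ^ card {z\<in>S. p < z}" k A] unfolding * .
  also have "\<dots> = (\<Sum>(S, q)\<in>esets2 (Suc k) A. qint (Suc k))"
    by (rule sum.cong) (auto simp: esets2_def sum_tvar_power_card_greater)
  finally show ?thesis by (simp add: mult.commute case_prod_beta)
qed

lemma sum_esets3_notin_less:
  "(\<Sum>(S, p, q)\<in>esets3 k A. if q \<in> S then 0 else tvar ^ card {z\<in>S. z < q}) =
    qint (Suc k) * of_nat (card (esets2 (Suc k) A))"
proof -
  have *: "{z \<in> insert p S. z < p} = {z\<in>S. z < p}" for p :: nat and S
    by auto
  have "(\<Sum>(S, p, q)\<in>esets3 k A. if p \<in> S then 0 else tvar ^ card {z\<in>S. z < p}) =
      (\<Sum>(S, q)\<in>esets2 (Suc k) A. \<Sum>p\<in>S. tvar ^ card {z\<in>S. z < p})"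
    using sum_esets3_notin[of "\<lambda>S p. tvar ^ card {z\<in>S. z < p}" k A] unfolding * .
  also have "\<dots> = (\<Sum>(S, q)\<in>esets2 (Suc k) A. qint (Suc k))"
    by (rule sum.cong) (auto simp: esets2_def sum_tvar_power_card_less)
  finally show ?thesis
    by (subst sum_esets3_swap) (simp add: mult.commute case_prod_beta)
qed

lemma card_esets3_less: "card {(S, p, q) \<in> esets3 k A. p < q} = card (esets22 k A)"
proof (rule bij_betw_same_card)
  have two: "\<exists>p q. U = {p, q} \<and> p < q" if "card U = 2" for U :: "nat set"
    using that by (auto simp: card_2_iff) (metis insert_commute linorder_neqE_nat)
  show "bij_betw (\<lambda>(S, p, q). (S, {p, q})) {(S, p, q) \<in> esets3 k A. p < q} (esets22 k A)"
  proof (rule bij_betwI')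
    fix T assume "T \<in> esets22 k A"
    then obtain S p q where "T = (S, {p, q})" "p < q" "(S, {p, q}) \<in> esets22 k A"
      using two by (fastforce simp: esets22_def)
    then show "\<exists>X\<in>{(S, p, q) \<in> esets3 k A. p < q}. T = (\<lambda>(S, p, q). (S, {p, q})) X"
      by (intro bexI[of _ "(S, p, q)"]) (auto simp: esets3_def esets22_def)
  qed (auto simp: esets3_def esets22_def doubleton_eq_iff)
qed

lemma sum_esets3_less:
  "(\<Sum>(S, p, q)\<in>esets3 k A. if p < q then c else 0) = (c :: int poly) * of_nat (card (esets22 k A))"
proof -
  have "(\<Sum>(S, p, q)\<in>esets3 k A. if p < q then c else 0) = (\<Sum>(S, p, q)\<in>{(S, p, q) \<in> esets3 k A. p < q}. c)"
    by (rule sum.mono_neutral_cong_right) (auto simp: finite_esets3 split: if_splits)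
  then show ?thesis
    unfolding card_esets3_less[symmetric] by (simp add: case_prod_beta mult.commute)
qed

lemma card_esets2_notin: "card {(S, p) \<in> esets2 k A. p \<notin> S} = Suc k * card (esets1 (Suc k) A)"
proof -
  have "bij_betw (\<lambda>(S, p). (insert p S, p)) {(S, p) \<in> esets2 k A. p \<notin> S}
      (Sigma (esets1 (Suc k) A) (\<lambda>W. W))"
    by (rule bij_betwI[where g = "\<lambda>(W, p). (W - {p}, p)"])
      (auto simp: esets2_def esets1_def mset_set.remove insert_absorb)
  then have "card {(S, p) \<in> esets2 k A. p \<notin> S} = card (Sigma (esets1 (Suc k) A) (\<lambda>W. W))"
    by (rule bij_betw_same_card)
  also have "\<dots> = (\<Sum>W\<in>esets1 (Suc k) A. card W)"
    using finite_esets1 by (rule card_SigmaI) (auto simp: esets1_def)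
  also have "\<dots> = (\<Sum>W\<in>esets1 (Suc k) A. Suc k)"
    by (rule sum.cong) (auto simp: esets1_def)
  finally show ?thesis by simp
qed

text \<open>Putting p into S identifies these triples with the pairs (W, p) in \<open>esets2\<close>
  having p \<in> W. The pairs with p \<notin> W arise from a set of k+2 elements by singling out one
  of them, which explains the multiplicity.\<close>

lemma card_esets3_diagonal:
  "card {(S, p, q) \<in> esets3 k A. p = q \<and> p \<notin> S} + Suc (Suc k) * card (esets1 (Suc (Suc k)) A) =
    card (esets2 (Suc k) A)"
proof -
  have "bij_betw (\<lambda>(S, p, q). (insert p S, p)) {(S, p, q) \<in> esets3 k A. p = q \<and> p \<notin> S}
      {(S, p) \<in> esets2 (Suc k) A. p \<in> S}"
    by (rule bij_betwI[where g = "\<lambda>(W, p). (W - {p}, p, p)"])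
      (auto simp: esets2_def esets3_def mset_set.remove insert_absorb)
  then have *: "card {(S, p, q) \<in> esets3 k A. p = q \<and> p \<notin> S} = card {(S, p) \<in> esets2 (Suc k) A. p \<in> S}"
    by (rule bij_betw_same_card)
  have "esets2 (Suc k) A = {(S, p) \<in> esets2 (Suc k) A. p \<in> S} \<union> {(S, p) \<in> esets2 (Suc k) A. p \<notin> S}"
    by auto
  then have "card (esets2 (Suc k) A) =
      card ({(S, p) \<in> esets2 (Suc k) A. p \<in> S} \<union> {(S, p) \<in> esets2 (Suc k) A. p \<notin> S})"
    by simp
  also have "\<dots> = card {(S, p) \<in> esets2 (Suc k) A. p \<in> S} + card {(S, p) \<in> esets2 (Suc k) A. p \<notin> S}"
    by (rule card_Un_disjoint) (auto intro: finite_subset[OF _ finite_esets2])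
  finally show ?thesis
    by (simp add: * card_esets2_notin)
qed

lemma sum_esets3_diagonal:
  "(\<Sum>(S, p, q)\<in>esets3 k A. if p = q \<and> p \<notin> S then c else 0) =
    (c :: int poly) * (of_nat (card (esets2 (Suc k) A)) - of_nat (Suc (Suc k)) * of_nat (card (esets1 (Suc (Suc k)) A)))"
proof -
  have "(\<Sum>(S, p, q)\<in>esets3 k A. if p = q \<and> p \<notin> S then c else 0) =
      (\<Sum>(S, p, q)\<in>{(S, p, q) \<in> esets3 k A. p = q \<and> p \<notin> S}. c)"
    by (rule sum.mono_neutral_cong_right) (auto simp: finite_esets3 split: if_splits)
  also have "\<dots> = c * of_nat (card {(S, p, q) \<in> esets3 k A. p = q \<and> p \<notin> S})"
    by (simp add: case_prod_beta mult.commute)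
  also have "of_nat (card {(S, p, q) \<in> esets3 k A. p = q \<and> p \<notin> S}) =
     (of_nat (card (esets2 (Suc k) A)) - of_nat (Suc (Suc k)) * of_nat (card (esets1 (Suc (Suc k)) A)) :: int poly)"
    unfolding card_esets3_diagonal[of k A, symmetric] of_nat_add of_nat_mult by simp
  finally show ?thesis .
qed

lemma mset_set_remove2:
  "finite W \<Longrightarrow> p \<in> W \<Longrightarrow> q \<in> W \<Longrightarrow> p \<noteq> q \<Longrightarrow>
    add_mset p (add_mset q (mset_set (W - {p, q}))) = mset_set W"
  using mset_set.remove[of W p] mset_set.remove[of "W - {p}" q]
  by (simp add: Diff_insert2[symmetric] insert_commute)

lemma sum_esets3_notin_both:
  fixes h :: "nat set \<Rightarrow> nat \<Rightarrow> nat \<Rightarrow> 'b::comm_monoid_add"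
  shows "(\<Sum>(S, p, q)\<in>esets3 k A. if p \<in> S \<or> q \<in> S \<or> p = q then 0 else h (insert p (insert q S)) p q) =
    (\<Sum>W\<in>esets1 (Suc (Suc k)) A. \<Sum>p\<in>W. \<Sum>q\<in>W - {p}. h W p q)"
proof -
  have "(\<Sum>(S, p, q)\<in>esets3 k A. if p \<in> S \<or> q \<in> S \<or> p = q then 0 else h (insert p (insert q S)) p q) =
      (\<Sum>(S, p, q)\<in>{(S, p, q) \<in> esets3 k A. p \<notin> S \<and> q \<notin> S \<and> p \<noteq> q}. h (insert p (insert q S)) p q)"
    by (rule sum.mono_neutral_cong_right) (auto simp: finite_esets3)
  also have "\<dots> = (\<Sum>(W, p, q)\<in>(SIGMA W:esets1 (Suc (Suc k)) A. SIGMA p:W. W - {p}). h W p q)"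
    by (rule sum.reindex_bij_witness[of _ "\<lambda>(W, p, q). (W - {p, q}, p, q)" "\<lambda>(S, p, q). (insert p (insert q S), p, q)"])
      (auto simp: esets3_def esets1_def mset_set_remove2 card_Diff_subset insert_absorb)
  also have "\<dots> = (\<Sum>W\<in>esets1 (Suc (Suc k)) A. \<Sum>(p, q)\<in>(SIGMA p:W. W - {p}). h W p q)"
    by (subst sum.Sigma[OF finite_esets1]) (auto simp: esets1_def)
  also have "\<dots> = (\<Sum>W\<in>esets1 (Suc (Suc k)) A. \<Sum>p\<in>W. \<Sum>q\<in>W - {p}. h W p q)"
    by (rule sum.cong[OF refl], subst sum.Sigma) (auto simp: esets1_def)
  finally show ?thesis .
qed

text \<open>The offset 3 and the subtracted terms avoid natural-number subtraction; for card W \<ge> 3 the last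
  factor is t^3 [card W - 3].\<close>

lemma sum_pairs_tvar_power:
  fixes W :: "nat set"
  assumes "finite W"
  shows "(\<Sum>p\<in>W. \<Sum>q\<in>W - {p}. tvar ^ (card {z\<in>W. p < z} + card {z\<in>W. z < q} + (if q < p then 3 else 0))) =
    of_nat (card W) * (tvar ^ card W + tvar ^ Suc (card W)) + qint (card W) * (qint (card W) - 1 - tvar - tvar ^ 2)"
  using assms
proof (induction rule: finite_linorder_max_induct)
  case (insert b W)
  let ?h = "\<lambda>W p q. tvar ^ (card {z\<in>W. p < z} + card {z\<in>W. z < q} + (if q < p then 3 else 0))"
  let ?V = "insert b W"
  have b: "b \<notin> W" "finite W" and lt: "\<And>x. x \<in> W \<Longrightarrow> x < b"
    using insert.hyps by auto
  have up: "card {z\<in>?V. p < z} = Suc (card {z\<in>W. p < z})" if "p \<in> W" for p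
  proof -
    have "{z\<in>?V. p < z} = insert b {z\<in>W. p < z}" using lt that by auto
    then show ?thesis using b by simp
  qed
  have lo: "card {z\<in>?V. z < q} = card {z\<in>W. z < q}" if "q \<in> W" for q
    using lt[OF that] by (intro arg_cong[where f = card]) auto
  \<comment> \<open>Pairs are sorted by whether the new maximum b is their first component, their
    second, or neither. A pair without b gains one from \<open>up\<close> and nothing from
    \<open>lo\<close>, hence the factor t in the third part.\<close>
  have "(\<Sum>p\<in>?V. \<Sum>q\<in>?V - {p}. ?h ?V p q) =
      (\<Sum>q\<in>W. ?h ?V b q) + (\<Sum>p\<in>W. \<Sum>q\<in>?V - {p}. ?h ?V p q)"
    using b by (simp add: Diff_insert_absorb)
  also have "(\<Sum>p\<in>W. \<Sum>q\<in>?V - {p}. ?h ?V p q) = (\<Sum>p\<in>W. ?h ?V p b + (\<Sum>q\<in>W - {p}. ?h ?V p q))"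
  proof (rule sum.cong[OF refl])
    fix p assume "p \<in> W"
    then have "?V - {p} = insert b (W - {p})" using b by auto
    then show "(\<Sum>q\<in>?V - {p}. ?h ?V p q) = ?h ?V p b + (\<Sum>q\<in>W - {p}. ?h ?V p q)"
      using b by simp
  qed
  also have "\<dots> = (\<Sum>p\<in>W. ?h ?V p b) + (\<Sum>p\<in>W. \<Sum>q\<in>W - {p}. ?h ?V p q)"
    by (simp add: sum.distrib)
  also have "(\<Sum>q\<in>W. ?h ?V b q) = (\<Sum>q\<in>W. tvar ^ 3 * tvar ^ card {z\<in>W. z < q})"
  proof (rule sum.cong[OF refl])
    fix q assume q: "q \<in> W"
    have "{z\<in>?V. b < z} = {}" using lt by force
    then show "?h ?V b q = tvar ^ 3 * tvar ^ card {z\<in>W. z < q}"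
      unfolding lo[OF q] by (simp only: lt[OF q]) (simp add: power_add mult.commute)
  qed
  also have "\<dots> = tvar ^ 3 * qint (card W)"
    using sum_tvar_power_card_less[OF b(2)] by (simp flip: sum_distrib_left)
  also have "(\<Sum>p\<in>W. ?h ?V p b) = (\<Sum>p\<in>W. tvar ^ Suc (card W) * tvar ^ card {z\<in>W. p < z})"
  proof (rule sum.cong[OF refl])
    fix p assume p: "p \<in> W"
    have "{z\<in>?V. z < b} = W" using lt by force
    then show "?h ?V p b = tvar ^ Suc (card W) * tvar ^ card {z\<in>W. p < z}"
      unfolding up[OF p] using lt[OF p] by (simp only:) (simp add: power_add mult_ac)
  qed
  also have "\<dots> = tvar ^ Suc (card W) * qint (card W)"
    using sum_tvar_power_card_greater[OF b(2)] by (simp flip: sum_distrib_left)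
  also have "(\<Sum>p\<in>W. \<Sum>q\<in>W - {p}. ?h ?V p q) = (\<Sum>p\<in>W. \<Sum>q\<in>W - {p}. tvar * ?h W p q)"
  proof (intro sum.cong refl)
    fix p q assume "p \<in> W" "q \<in> W - {p}"
    then show "?h ?V p q = tvar * ?h W p q"
      using up[of p] lo[of q] by (simp only: DiffE) simp
  qed
  also have "\<dots> = tvar * (\<Sum>p\<in>W. \<Sum>q\<in>W - {p}. ?h W p q)"
    by (simp add: sum_distrib_left)
  also note insert.IH
  finally have eq: "(\<Sum>p\<in>?V. \<Sum>q\<in>?V - {p}. ?h ?V p q) = tvar ^ 3 * qint (card W) +
      (tvar ^ Suc (card W) * qint (card W) + tvar * (of_nat (card W) * (tvar ^ card W + tvar ^ Suc (card W)) +
        qint (card W) * (qint (card W) - 1 - tvar - tvar ^ 2)))" .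
  have card: "card ?V = Suc (card W)" using b by simp
  have "of_nat (Suc (card W)) = (1 + of_nat (card W) :: int poly)" by simp
  then show ?case
    unfolding eq card qint_Suc_shift power_Suc tvar_power_eq[of "card W"] by algebra
qed simp

text \<open>The diagonal p = q supplies (t^N + t^(N+1)) (E2 - (N+2) E1), and its second part cancels
  the term with the integer N+2 in the sum over pairs outside S. The factors t and t^2 that avoid
  negative exponents are finally cancelled, as \<open>int poly\<close> has no zero divisors.\<close>

lemma sum_mixed_diff:
  defines "E1 \<equiv> \<lambda>k A. of_nat (card (esets1 k A)) :: int poly"
    and "E2 \<equiv> \<lambda>k A. of_nat (card (esets2 k A)) :: int poly"
    and "E3 \<equiv> \<lambda>k A. of_nat (card (esets3 k A)) :: int poly"
    and "E22 \<equiv> \<lambda>k A. of_nat (card (esets22 k A)) :: int poly"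
  assumes N: "N = Suc k"
  shows "(\<Sum>(S, p, q)\<in>esets3 N A. mixed_diff S p q) =
    (1 - tvar ^ k) * E3 N A - (2 * qint k + tvar ^ k + tvar ^ Suc k) * E2 (Suc N) A +
    (tvar ^ k + tvar ^ Suc k) * E22 N A + qint (N + 2) * qint k * E1 (N + 2) A"
proof -
  define both where "both = (\<lambda>(S::nat set, p::nat, q::nat). if p \<in> S \<or> q \<in> S \<or> p = q then 0
     else tvar ^ (card {z\<in>S. p < z} + card {z\<in>S. z < q} + (if q < p then 1 else 0)))"
  \<comment> \<open>Passing from S to the union of S and {p, q} raises both ranks by one if p < q
    and neither of them if q < p. The factor t^2 makes up for the former and turns the exponent 1
    that \<open>both\<close> has for q < p into 3.\<close>
  have "(\<Sum>T\<in>esets3 N A. tvar ^ 2 * both T) = (\<Sum>(S, p, q)\<in>esets3 N A. if p \<in> S \<or> q \<in> S \<or> p = q then 0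
     else (\<lambda>W p q. tvar ^ (card {z\<in>W. p < z} + card {z\<in>W. z < q} + (if q < p then 3 else 0))) (insert p (insert q S)) p q)"
  proof (rule sum.cong[OF refl])
    fix T assume "T \<in> esets3 N A"
    then obtain S p q where T: "T = (S, p, q)" and S: "finite S"
      by (auto simp: esets3_def)
    have up: "card {z \<in> insert p (insert q S). p < z} = card {z\<in>S. p < z} + (if p < q then 1 else 0)"
      if "q \<notin> S"
    proof -
      have "{z \<in> insert p (insert q S). p < z} = (if p < q then insert q {z\<in>S. p < z} else {z\<in>S. p < z})"
        by auto
      then show ?thesis using S that by simp
    qed
    have lo: "card {z \<in> insert p (insert q S). z < q} = card {z\<in>S. z < q} + (if p < q then 1 else 0)"
      if "p \<notin> S"
    proof -
      have "{z \<in> insert p (insert q S). z < q} = (if p < q then insert p {z\<in>S. z < q} else {z\<in>S. z < q})"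
        by auto
      then show ?thesis using S that by simp
    qed
    show "tvar ^ 2 * both T = (case T of (S, p, q) \<Rightarrow> if p \<in> S \<or> q \<in> S \<or> p = q then 0
     else (\<lambda>W p q. tvar ^ (card {z\<in>W. p < z} + card {z\<in>W. z < q} + (if q < p then 3 else 0))) (insert p (insert q S)) p q)"
      using up lo by (auto simp: T both_def power_add power2_eq_square power3_eq_cube)
  qed
  also have "\<dots> = (\<Sum>W\<in>esets1 (Suc (Suc N)) A. \<Sum>p\<in>W. \<Sum>q\<in>W - {p}.
      tvar ^ (card {z\<in>W. p < z} + card {z\<in>W. z < q} + (if q < p then 3 else 0)))"
    by (rule sum_esets3_notin_both)
  also have "\<dots> = (\<Sum>W\<in>esets1 (Suc (Suc N)) A. of_nat (N + 2) * (tvar ^ (N + 2) + tvar ^ Suc (N + 2)) +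
      qint (N + 2) * (qint (N + 2) - 1 - tvar - tvar ^ 2))"
    by (rule sum.cong[OF refl], subst sum_pairs_tvar_power) (auto simp: esets1_def)
  also have "\<dots> = (of_nat (N + 2) * (tvar ^ (N + 2) + tvar ^ Suc (N + 2)) +
      qint (N + 2) * (qint (N + 2) - 1 - tvar - tvar ^ 2)) * E1 (N + 2) A"
    by (simp add: E1_def mult.commute)
  also have "qint (N + 2) - 1 - tvar - tvar ^ 2 = tvar ^ 3 * qint k"
    unfolding N by (simp add: qint_Suc_shift algebra_simps power2_eq_square power3_eq_cube)
  finally have "tvar ^ 2 * (\<Sum>T\<in>esets3 N A. both T) =
      tvar ^ 2 * ((of_nat (N + 2) * (tvar ^ N + tvar ^ Suc N) + tvar * qint (N + 2) * qint k) * E1 (N + 2) A)"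
    by (simp add: sum_distrib_left power_add power2_eq_square power3_eq_cube algebra_simps)
  moreover have "tvar \<noteq> 0"
    by (simp add: tvar_def)
  ultimately have both: "(\<Sum>T\<in>esets3 N A. both T) =
      (of_nat (N + 2) * (tvar ^ N + tvar ^ Suc N) + tvar * qint (N + 2) * qint k) * E1 (N + 2) A"
    by simp
  have "tvar * (\<Sum>(S, p, q)\<in>esets3 N A. mixed_diff S p q) =
     (\<Sum>(S, p, q)\<in>esets3 N A. (tvar - tvar ^ N)
        - tvar * (if p \<in> S then 0 else tvar ^ card {z\<in>S. p < z})
        - tvar * (if q \<in> S then 0 else tvar ^ card {z\<in>S. z < q})
        + (if p < q then tvar ^ Suc N else 0) + (if q < p then tvar ^ N else 0)
        + (if p = q \<and> p \<notin> S then tvar ^ N + tvar ^ Suc N else 0) + both (S, p, q))"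
    unfolding sum_distrib_left
  proof (rule sum.cong[OF refl])
    fix T assume "T \<in> esets3 N A"
    then obtain S p q where T: "T = (S, p, q)" and S: "finite S" "card S = N"
      by (auto simp: esets3_def)
    show "tvar * (case T of (S, p, q) \<Rightarrow> mixed_diff S p q) =
      (case T of (S, p, q) \<Rightarrow> (tvar - tvar ^ N)
        - tvar * (if p \<in> S then 0 else tvar ^ card {z\<in>S. p < z})
        - tvar * (if q \<in> S then 0 else tvar ^ card {z\<in>S. z < q})
        + (if p < q then tvar ^ Suc N else 0) + (if q < p then tvar ^ N else 0)
        + (if p = q \<and> p \<notin> S then tvar ^ N + tvar ^ Suc N else 0) + both (S, p, q))"
      unfolding T case_prod_conv mixed_diff_eq[OF S(1)] S(2) both_def
      by (cases "p < q"; cases "q < p") auto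
  qed
  also have "\<dots> = (\<Sum>(S, p, q)\<in>esets3 N A. tvar - tvar ^ N)
     - tvar * (\<Sum>(S, p, q)\<in>esets3 N A. if p \<in> S then 0 else tvar ^ card {z\<in>S. p < z})
     - tvar * (\<Sum>(S, p, q)\<in>esets3 N A. if q \<in> S then 0 else tvar ^ card {z\<in>S. z < q})
     + (\<Sum>(S, p, q)\<in>esets3 N A. if p < q then tvar ^ Suc N else 0)
     + (\<Sum>(S, p, q)\<in>esets3 N A. if q < p then tvar ^ N else 0)
     + (\<Sum>(S, p, q)\<in>esets3 N A. if p = q \<and> p \<notin> S then tvar ^ N + tvar ^ Suc N else 0)
     + (\<Sum>T\<in>esets3 N A. both T)"
    unfolding sum_distrib_left sum_subtractf[symmetric] sum.distrib[symmetric]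
    by (rule sum.cong) auto
  also have "(\<Sum>(S, p, q)\<in>esets3 N A. if q < p then tvar ^ N else 0) =
      (\<Sum>(S, p, q)\<in>esets3 N A. if p < q then tvar ^ N else 0)"
    by (rule sum_esets3_swap)
  also have "(\<Sum>(S, p, q)\<in>esets3 N A. tvar - tvar ^ N) = (tvar - tvar ^ N) * E3 N A"
    by (simp add: E3_def case_prod_beta mult.commute)
  finally have "tvar * (\<Sum>(S, p, q)\<in>esets3 N A. mixed_diff S p q) =
     (tvar - tvar ^ N) * E3 N A - 2 * tvar * qint (Suc N) * E2 (Suc N) A
     + (tvar ^ N + tvar ^ Suc N) * (E22 N A + E2 (Suc N) A) + tvar * qint (N + 2) * qint k * E1 (N + 2) A"
    unfolding sum_esets3_notin_greater sum_esets3_notin_less sum_esets3_less sum_esets3_diagonal both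
    by (simp add: E1_def E2_def E22_def algebra_simps)
  also have "\<dots> = tvar * ((1 - tvar ^ k) * E3 N A - (2 * qint k + tvar ^ k + tvar ^ Suc k) * E2 (Suc N) A +
    (tvar ^ k + tvar ^ Suc k) * E22 N A + qint (N + 2) * qint k * E1 (N + 2) A)"
    unfolding N qint_Suc[of "Suc k"] qint_Suc[of k] power_Suc by algebra
  finally show ?thesis
    using \<open>tvar \<noteq> 0\<close> by simp
qed

text \<open>The right-hand side is the expansion of X in elementary functions, with the coefficients
  in the raw form delivered by the colourings. Here k = N - 2, so \<open>sum_mixed_diff\<close>
  enters with \<open>Suc k\<close>.\<close>

lemma sum_esets3_end_weighted:
  defines "E1 \<equiv> \<lambda>k A. of_nat (card (esets1 k A)) :: int poly"
    and "E2 \<equiv> \<lambda>k A. of_nat (card (esets2 k A)) :: int poly"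
    and "E3 \<equiv> \<lambda>k A. of_nat (card (esets3 k A)) :: int poly"
    and "E22 \<equiv> \<lambda>k A. of_nat (card (esets22 k A)) :: int poly"
  assumes N: "N = Suc (Suc k)" and ab: "1 \<le> a" "1 \<le> b" "a + b \<le> N"
  shows "(\<Sum>(S, p, q)\<in>esets3 N A. end_sum (above_weight p) (below_weight q) S a b) =
    qfact N * E3 N A +
    (qint a + qint b) * qfact (Suc k) * (qint (Suc N) * E2 (Suc N) A - E3 N A) +
    qint a * qint b * qfact k *
     ((1 - tvar ^ Suc k) * E3 N A - (2 * qint (Suc k) + tvar ^ Suc k + tvar ^ Suc (Suc k)) * E2 (Suc N) A +
      (tvar ^ Suc k + tvar ^ Suc (Suc k)) * E22 N A + qint (N + 2) * qint (Suc k) * E1 (N + 2) A)"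
proof -
  have "(\<Sum>(S, p, q)\<in>esets3 N A. end_sum (above_weight p) (below_weight q) S a b) =
    (\<Sum>(S, p, q)\<in>esets3 N A. qfact N - (qint a + qint b) * qfact (Suc k)
      + (qint a * qfact (Suc k)) * (if p \<in> S then 0 else tvar ^ card {z\<in>S. p < z})
      + (qint b * qfact (Suc k)) * (if q \<in> S then 0 else tvar ^ card {z\<in>S. z < q})
      + (qint a * qint b * qfact k) * mixed_diff S p q)"
  proof (rule sum.cong[OF refl], clarify)
    fix S p q assume "(S, p, q) \<in> esets3 N A"
    then have "finite S" "card S = N"
      by (auto simp: esets3_def)
    then show "end_sum (above_weight p) (below_weight q) S a b =
      qfact N - (qint a + qint b) * qfact (Suc k)
      + (qint a * qfact (Suc k)) * (if p \<in> S then 0 else tvar ^ card {z\<in>S. p < z})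
      + (qint b * qfact (Suc k)) * (if q \<in> S then 0 else tvar ^ card {z\<in>S. z < q})
      + (qint a * qint b * qfact k) * mixed_diff S p q"
      using end_sum_closed_form[of S k a b p q] ab N by (simp add: algebra_simps)
  qed
  also have "\<dots> = (\<Sum>(S, p, q)\<in>esets3 N A. qfact N - (qint a + qint b) * qfact (Suc k))
      + (qint a * qfact (Suc k)) * (\<Sum>(S, p, q)\<in>esets3 N A. if p \<in> S then 0 else tvar ^ card {z\<in>S. p < z})
      + (qint b * qfact (Suc k)) * (\<Sum>(S, p, q)\<in>esets3 N A. if q \<in> S then 0 else tvar ^ card {z\<in>S. z < q})
      + (qint a * qint b * qfact k) * (\<Sum>(S, p, q)\<in>esets3 N A. mixed_diff S p q)"
    unfolding sum_distrib_left sum.distrib[symmetric] by (rule sum.cong) auto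
  also have "(\<Sum>(S, p, q)\<in>esets3 N A. qfact N - (qint a + qint b) * qfact (Suc k)) =
      (qfact N - (qint a + qint b) * qfact (Suc k)) * E3 N A"
    by (simp add: E3_def case_prod_beta mult.commute)
  finally have eq: "(\<Sum>(S, p, q)\<in>esets3 N A. end_sum (above_weight p) (below_weight q) S a b) =
      (qfact N - (qint a + qint b) * qfact (Suc k)) * E3 N A
      + (qint a * qfact (Suc k)) * (qint (Suc N) * E2 (Suc N) A)
      + (qint b * qfact (Suc k)) * (qint (Suc N) * E2 (Suc N) A)
      + (qint a * qint b * qfact k) * (\<Sum>(S, p, q)\<in>esets3 N A. mixed_diff S p q)"
    unfolding sum_esets3_notin_greater sum_esets3_notin_less E2_def .
  show ?thesis
    unfolding eq sum_mixed_diff[OF N] E1_def E2_def E3_def E22_def by algebra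
qed

section \<open>The chromatic quasisymmetric function\<close>

lemma ex_multiset_of_content: "\<exists>A. \<forall>c. count A c = Poly_Mapping.lookup \<alpha> c"
proof -
  have "finite {c. 0 < Poly_Mapping.lookup \<alpha> c}"
    using finite_lookup[of \<alpha>] by simp
  then show ?thesis
    by (intro exI[of _ "Abs_multiset (Poly_Mapping.lookup \<alpha>)"]) (simp add: count_Abs_multiset)
qed

lemma elem_eq_0:
  assumes "Poly_Mapping.lookup \<alpha> 0 \<noteq> 0"
  shows "elem mu \<alpha> = 0"
proof -
  have "elem_sets mu \<alpha> = {}"
  proof (rule ccontr)
    assume "elem_sets mu \<alpha> \<noteq> {}"
    then obtain Ss where "Ss \<in> elem_sets mu \<alpha>" by blast
    then have Ss: "length Ss = length mu" "\<forall>k<length mu. 0 \<notin> Ss ! k"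
      "length (filter (\<lambda>S. 0 \<in> S) Ss) = Poly_Mapping.lookup \<alpha> 0"
      by (auto simp: elem_sets_def)
    then have "filter (\<lambda>S. 0 \<in> S) Ss = []"
      by (auto simp: filter_empty_conv in_set_conv_nth)
    then show False using Ss(3) assms by simp
  qed
  then show ?thesis by (simp add: elem_def)
qed

context
  fixes \<alpha> :: "nat \<Rightarrow>\<^sub>0 nat" and A :: "nat multiset"
  assumes cnt: "\<And>c. count A c = Poly_Mapping.lookup \<alpha> c" and zero: "0 \<notin># A"
begin

lemma elem1_eq: "elem [k] \<alpha> = of_nat (card (esets1 k A))"
proof -
  have "bij_betw (\<lambda>S. [S]) (esets1 k A) (elem_sets [k] \<alpha>)"
  proof (rule bij_betwI')
    fix S assume "S \<in> esets1 k A"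
    then show "[S] \<in> elem_sets [k] \<alpha>"
      using zero by (auto simp: elem_sets_def esets1_def count_mset_set' simp flip: cnt)
  next
    fix Ss assume "Ss \<in> elem_sets [k] \<alpha>"
    then obtain S where "Ss = [S]" "finite S" "card S = k"
        "\<forall>c. count A c = length (filter (\<lambda>X. c \<in> X) [S])"
      by (auto simp: elem_sets_def length_Suc_conv cnt simp del: filter.simps)
    then show "\<exists>S\<in>esets1 k A. Ss = [S]"
      by (auto simp: esets1_def multiset_eq_iff count_mset_set')
  qed simp
  then show ?thesis
    by (simp add: elem_def bij_betw_same_card)
qed

lemma elem2_eq: "elem [k, 1] \<alpha> = of_nat (card (esets2 k A))"
proof -
  have "bij_betw (\<lambda>(S, p). [S, {p}]) (esets2 k A) (elem_sets [k, 1] \<alpha>)"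
  proof (rule bij_betwI')
    fix T assume "T \<in> esets2 k A"
    then show "(\<lambda>(S, p). [S, {p}]) T \<in> elem_sets [k, 1] \<alpha>"
      using zero by (auto simp: elem_sets_def esets2_def count_mset_set' less_Suc_eq simp flip: cnt)
  next
    fix Ss assume "Ss \<in> elem_sets [k, 1] \<alpha>"
    then obtain S U where S: "Ss = [S, U]" "finite S" "card S = k" "card U = 1"
        "\<forall>c. count A c = length (filter (\<lambda>X. c \<in> X) [S, U])"
      by (auto simp: elem_sets_def length_Suc_conv cnt All_less_Suc2 simp del: filter.simps)
    then obtain p where "U = {p}"
      by (auto simp: card_1_singleton_iff)
    with S show "\<exists>T\<in>esets2 k A. Ss = (\<lambda>(S, p). [S, {p}]) T"
      by (intro bexI[of _ "(S, p)"]) (auto simp: esets2_def multiset_eq_iff count_mset_set' split: if_splits)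
  qed auto
  then show ?thesis
    by (simp add: elem_def bij_betw_same_card)
qed

lemma elem22_eq: "elem [k, 2] \<alpha> = of_nat (card (esets22 k A))"
proof -
  have "bij_betw (\<lambda>(S, U). [S, U]) (esets22 k A) (elem_sets [k, 2] \<alpha>)"
  proof (rule bij_betwI')
    fix T assume "T \<in> esets22 k A"
    then show "(\<lambda>(S, U). [S, U]) T \<in> elem_sets [k, 2] \<alpha>"
      using zero by (auto simp: elem_sets_def esets22_def count_mset_set' less_Suc_eq simp flip: cnt)
  next
    fix Ss assume "Ss \<in> elem_sets [k, 2] \<alpha>"
    then obtain S U where S: "Ss = [S, U]" "finite S" "card S = k" "finite U" "card U = 2"
        "\<forall>c. count A c = length (filter (\<lambda>X. c \<in> X) [S, U])"
      by (auto simp: elem_sets_def length_Suc_conv cnt All_less_Suc2 simp del: filter.simps)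
    then show "\<exists>T\<in>esets22 k A. Ss = (\<lambda>(S, U). [S, U]) T"
      by (intro bexI[of _ "(S, U)"]) (auto simp: esets22_def multiset_eq_iff count_mset_set' split: if_splits)
  qed auto
  then show ?thesis
    by (simp add: elem_def bij_betw_same_card)
qed

lemma elem3_eq: "elem [k, 1, 1] \<alpha> = of_nat (card (esets3 k A))"
proof -
  have "bij_betw (\<lambda>(S, p, q). [S, {p}, {q}]) (esets3 k A) (elem_sets [k, 1, 1] \<alpha>)"
  proof (rule bij_betwI')
    fix T assume "T \<in> esets3 k A"
    then show "(\<lambda>(S, p, q). [S, {p}, {q}]) T \<in> elem_sets [k, 1, 1] \<alpha>"
      using zero by (auto simp: elem_sets_def esets3_def count_mset_set' less_Suc_eq simp flip: cnt)
  next
    fix Ss assume "Ss \<in> elem_sets [k, 1, 1] \<alpha>"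
    then obtain S U V where S: "Ss = [S, U, V]" "finite S" "card S = k" "card U = 1" "card V = 1"
        "\<forall>c. count A c = length (filter (\<lambda>X. c \<in> X) [S, U, V])"
      by (auto simp: elem_sets_def length_Suc_conv cnt All_less_Suc2 simp del: filter.simps)
    then obtain p q where "U = {p}" "V = {q}"
      by (auto simp: card_1_singleton_iff)
    with S show "\<exists>T\<in>esets3 k A. Ss = (\<lambda>(S, p, q). [S, {p}, {q}]) T"
      by (intro bexI[of _ "(S, p, q)"]) (auto simp: esets3_def multiset_eq_iff count_mset_set' split: if_splits)
  qed auto
  then show ?thesis
    by (simp add: elem_def bij_betw_same_card)
qed

end

lemma prod_above_weight:
  "p \<notin> set w \<Longrightarrow> prod_list (map (above_weight p) w) = tvar ^ length (filter (\<lambda>x. p < x) w)"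
  by (induction w) (auto simp: above_weight_def)

lemma prod_below_weight:
  "q \<notin> set w \<Longrightarrow> prod_list (map (below_weight q) w) = tvar ^ length (filter (\<lambda>x. x < q) w)"
  by (induction w) (auto simp: below_weight_def)

lemma prod_above_weight_eq_0: "p \<in> set w \<Longrightarrow> prod_list (map (above_weight p) w) = 0"
  by (induction w) (auto simp: above_weight_def)

lemma prod_below_weight_eq_0: "q \<in> set w \<Longrightarrow> prod_list (map (below_weight q) w) = 0"
  by (induction w) (auto simp: below_weight_def)

lemma upt_append_upt: "i \<le> j \<Longrightarrow> j \<le> k \<Longrightarrow> [i..<k] = [i..<j] @ [j..<k]"
  by (metis le_iff_add upt_add_eq_append)

section \<open>Colourings of the clique with two extra vertices\<close>

locale two_end_order =
  fixes n r s :: nat and m :: "nat \<Rightarrow> nat"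
  assumes n: "5 \<le> n" and r: "2 \<le> r" and rs: "r < s" and sn: "s < n - 1"
    and m_1: "m 1 = r"
    and m_mid: "\<And>i. 2 \<le> i \<Longrightarrow> i \<le> s \<Longrightarrow> m i = n - 1"
    and m_top: "\<And>i. s + 1 \<le> i \<Longrightarrow> i \<le> n - 1 \<Longrightarrow> m i = n"
begin

lemma inc_edge_iff:
  "inc_edge n m i j \<longleftrightarrow> 1 \<le> i \<and> i < j \<and> j \<le> n \<and> (i = 1 \<longrightarrow> j \<le> r) \<and> (j = n \<longrightarrow> s < i)"
proof -
  consider "i = 0" | "i = 1" | "2 \<le> i" "i \<le> s" | "s < i" "i \<le> n - 1" | "n \<le> i"
    by linarith
  then show ?thesis
    using n r rs sn m_1 m_mid[of i] m_top[of i] by cases (auto simp: inc_edge_def)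
qed

lemma nuio_less_iff:
  "nuio_less n m i j \<longleftrightarrow> 1 \<le> i \<and> j \<le> n \<and> (i = 1 \<and> r < j \<or> i \<le> s \<and> j = n)"
proof -
  consider "i = 0" | "i = 1" | "2 \<le> i" "i \<le> s" | "s < i" "i \<le> n - 1" | "n \<le> i"
    by linarith
  then show ?thesis
    using n r rs sn m_1 m_mid[of i] m_top[of i] by cases (auto simp: nuio_less_def)
qed

lemma upt_split: "[1..<Suc n] = 1 # [2..<n] @ [n]"
  using n upt_conv_Cons[of 1 n] by (simp add: numeral_2_eq_2)

lemma take_mid: "take (r - 1) [2..<n] = [2..<Suc r]"
  using r rs sn by (simp add: take_upt)

lemma drop_mid: "drop (n - 2 - (n - 1 - s)) [2..<n] = [Suc s..<n]"
proof -
  have "2 + (n - 2 - (n - 1 - s)) = Suc s"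
    using r rs sn by linarith
  then show ?thesis by (simp only: drop_upt)
qed

text \<open>Vertices 1 and n are not adjacent, so every edge lies in the clique or joins one of
  these two to a clique vertex.\<close>

lemma asc_eq:
  "asc {1..n} (inc_edge n m) \<kappa> = npairs (<) (map \<kappa> [2..<n]) +
     length (filter (\<lambda>x. \<kappa> 1 < x) (map \<kappa> [2..<Suc r])) +
     length (filter (\<lambda>x. x < \<kappa> n) (map \<kappa> [Suc s..<n]))"
proof -
  let ?R = "\<lambda>i j. i < j \<and> inc_edge n m i j \<and> \<kappa> i < \<kappa> j"
  have "asc {1..n} (inc_edge n m) \<kappa> = card {(i, j). i \<in> set [1..<Suc n] \<and> j \<in> set [1..<Suc n] \<and> ?R i j}"
    unfolding asc_def by (intro arg_cong[where f = card]) auto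
  also have "\<dots> = npairs ?R [1..<Suc n]"
    by (rule card_ordered_pairs_eq_npairs)
      (auto simp: sorted_wrt_iff_nth_less nth_append simp del: upt_Suc)
  also have "\<dots> = length (filter (?R 1) ([2..<n] @ [n])) + npairs ?R [2..<n] + length (filter (\<lambda>i. ?R i n) [2..<n])"
    unfolding upt_split by (simp add: npairs_snoc)
  also have "filter (?R 1) ([2..<n] @ [n]) = filter (\<lambda>j. \<kappa> 1 < \<kappa> j) [2..<Suc r]"
  proof -
    have "[2..<n] = [2..<Suc r] @ [Suc r..<n]"
      using r rs sn by (intro upt_append_upt) auto
    then show ?thesis
      using r rs sn by (auto simp: inc_edge_iff filter_empty_conv intro!: filter_cong)
  qed
  also have "filter (\<lambda>i. ?R i n) [2..<n] = filter (\<lambda>i. \<kappa> i < \<kappa> n) [Suc s..<n]"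
  proof -
    have "[2..<n] = [2..<Suc s] @ [Suc s..<n]"
      using r rs sn by (intro upt_append_upt) auto
    then show ?thesis
      using r rs sn by (auto simp: inc_edge_iff filter_empty_conv intro!: filter_cong)
  qed
  also have "npairs ?R [2..<n] = npairs (\<lambda>i j. i < j \<and> \<kappa> i < \<kappa> j) [2..<n]"
    by (rule npairs_cong) (auto simp: inc_edge_iff)
  also have "\<dots> = npairs (<) (map \<kappa> [2..<n])"
  proof -
    have "npairs (\<lambda>i j. i < j \<and> \<kappa> i < \<kappa> j) xs = npairs (\<lambda>i j. \<kappa> i < \<kappa> j) xs" if "sorted_wrt (<) xs" for xs :: "nat list"
      using that by (induction xs) (auto intro!: arg_cong[where f = length] filter_cong)
    then show ?thesis by (simp add: npairs_map)
  qed
  finally show ?thesis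
    by (simp add: filter_map comp_def)
qed

text \<open>A colouring is cut into the colours p and q of 1 and n, the colour set S of the clique
  and the word of clique colours. Properness inside the clique is distinctness of the word;
  properness at 1 and n is enforced only by the weights.\<close>

lemma chrom_qsym_eq_sum_esets3:
  assumes cnt: "\<And>c. count A c = Poly_Mapping.lookup \<alpha> c" and zero: "0 \<notin># A"
  shows "chrom_qsym {1..n} (inc_edge n m) \<alpha> =
    (\<Sum>(S, p, q)\<in>esets3 (n - 2) A. end_sum (above_weight p) (below_weight q) S (r - 1) (n - 1 - s))"
proof -
  let ?N = "n - 2" and ?a = "r - 1" and ?b = "n - 1 - s"
  define wt where "wt = (\<lambda>((S :: nat set, p, q), w). tvar ^ npairs (<) w *
     (prod_list (map (above_weight p) (take ?a w)) * prod_list (map (below_weight q) (drop (?N - ?b) w))))"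
  define D where "D = Sigma (esets3 ?N A) (\<lambda>(S, p, q). perms S)"
  \<comment> \<open>The data of proper colourings; on \<open>D - D'\<close> a factor of
    \<open>wt\<close> is 0.\<close>
  define D' where "D' = {((S, p, q), w) \<in> D. p \<notin> set (take ?a w) \<and> q \<notin> set (drop (?N - ?b) w)}"
  define K where "K = proper_colorings_content {1..n} (inc_edge n m) \<alpha>"
  define mk where "mk = (\<lambda>((S :: nat set, p, q), w) v.
     if v = 1 then p else if v = n then q else if 2 \<le> v \<and> v < n then w ! (v - 2) else (0 :: nat))"
  have fin_D: "finite D"
    unfolding D_def by (rule finite_SigmaI) (auto simp: finite_esets3)
  \<comment> \<open>Positivity of the colours is carried by the content, since 0 does not occur in
    \<open>A\<close>.\<close>
  have K_iff: "\<kappa> \<in> K \<longleftrightarrow> (\<forall>v. v \<notin> {1..n} \<longrightarrow> \<kappa> v = 0) \<and> mset (map \<kappa> [1..<Suc n]) = A \<and>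
      distinct (map \<kappa> [2..<n]) \<and> \<kappa> 1 \<notin> set (map \<kappa> [2..<Suc r]) \<and> \<kappa> n \<notin> set (map \<kappa> [Suc s..<n])" for \<kappa>
  proof -
    have cont: "mset (map \<kappa> [1..<Suc n]) = A \<longleftrightarrow> (\<forall>c. card {v\<in>{1..n}. \<kappa> v = c} = Poly_Mapping.lookup \<alpha> c)"
      using mset_map_eq_iff_card[of "[1..<Suc n]" A "Poly_Mapping.lookup \<alpha>" \<kappa>] cnt
      by (simp add: atLeastLessThanSuc_atLeastAtMost del: upt_Suc)
    have pos: "\<forall>v\<in>{1..n}. 1 \<le> \<kappa> v" if "mset (map \<kappa> [1..<Suc n]) = A"
    proof
      fix v assume "v \<in> {1..n}"
      then have "\<kappa> v \<in># mset (map \<kappa> [1..<Suc n])" by (auto simp del: upt_Suc)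
      then have "\<kappa> v \<noteq> 0" using that zero by metis
      then show "1 \<le> \<kappa> v" by simp
    qed
    have "(\<forall>i\<in>{1..n}. \<forall>j\<in>{1..n}. i < j \<and> inc_edge n m i j \<longrightarrow> \<kappa> i \<noteq> \<kappa> j) \<longleftrightarrow>
       distinct (map \<kappa> [2..<n]) \<and> \<kappa> 1 \<notin> set (map \<kappa> [2..<Suc r]) \<and> \<kappa> n \<notin> set (map \<kappa> [Suc s..<n])"
       (is "?L \<longleftrightarrow> ?R")
    proof
      assume L: ?L
      have "inj_on \<kappa> {2..<n}"
      proof (rule linorder_inj_onI)
        fix x y assume "x < y" "x \<in> {2..<n}" "y \<in> {2..<n}"
        then show "\<kappa> x \<noteq> \<kappa> y" using L by (auto simp: inc_edge_iff)
      qed auto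
      moreover have "\<kappa> 1 \<noteq> \<kappa> j" if "j \<in> {2..<Suc r}" for j
        using L that rs sn by (auto simp: inc_edge_iff)
      moreover have "\<kappa> j \<noteq> \<kappa> n" if "j \<in> {Suc s..<n}" for j
        using L that rs sn by (auto simp: inc_edge_iff)
      ultimately show ?R by (fastforce simp: distinct_map)
    next
      assume R: ?R
      then have inj: "inj_on \<kappa> {2..<n}" by (simp add: distinct_map)
      show ?L
      proof (intro ballI impI)
        fix i j assume ij: "i \<in> {1..n}" "j \<in> {1..n}" "i < j \<and> inc_edge n m i j"
        consider "i = 1" | "j = n" | "i \<in> {2..<n}" "j \<in> {2..<n}"
          using ij by fastforce
        then show "\<kappa> i \<noteq> \<kappa> j"
        proof cases
          case 1
          then have "j \<in> {2..<Suc r}" using ij by (auto simp: inc_edge_iff)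
          then have "\<kappa> j \<in> \<kappa> ` {2..<Suc r}" by blast
          then show ?thesis using 1 R by (metis set_map set_upt)
        next
          case 2
          then have "i \<in> {Suc s..<n}" using ij by (auto simp: inc_edge_iff)
          then have "\<kappa> i \<in> \<kappa> ` {Suc s..<n}" by blast
          then show ?thesis using 2 R by (metis set_map set_upt)
        next
          case 3
          then show ?thesis using inj ij by (auto dest: inj_onD)
        qed
      qed
    qed
    then show ?thesis
      unfolding K_def proper_colorings_content_def mem_Collect_eq using cont pos by blast
  qed
  have "(\<Sum>(S, p, q)\<in>esets3 ?N A. end_sum (above_weight p) (below_weight q) S ?a ?b) =
      (\<Sum>T\<in>esets3 ?N A. \<Sum>w\<in>(case T of (S, p, q) \<Rightarrow> perms S). wt (T, w))"
    by (rule sum.cong) (auto simp: end_sum_def wt_def esets3_def)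
  also have "\<dots> = (\<Sum>X\<in>D. wt X)"
    unfolding D_def by (subst sum.Sigma) (auto simp: finite_esets3)
  also have "\<dots> = (\<Sum>X\<in>D'. wt X)"
  proof (rule sum.mono_neutral_right[OF fin_D])
    show "\<forall>X\<in>D - D'. wt X = 0"
      by (auto simp: D'_def wt_def prod_above_weight_eq_0 prod_below_weight_eq_0)
  qed (auto simp: D'_def)
  also have "\<dots> = (\<Sum>\<kappa>\<in>K. monom 1 (asc {1..n} (inc_edge n m) \<kappa>))"
  proof (rule sum.reindex_bij_witness[of _
        "\<lambda>\<kappa>. ((\<kappa> ` {2..<n}, \<kappa> 1, \<kappa> n), map \<kappa> [2..<n])" mk])
    fix X assume X: "X \<in> D'"
    then obtain S p q w where Xeq: "X = ((S, p, q), w)" and S: "finite S" "card S = ?N"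
      "add_mset p (add_mset q (mset_set S)) = A" and w: "distinct w" "set w = S"
      and pq: "p \<notin> set (take ?a w)" "q \<notin> set (drop (?N - ?b) w)"
      by (auto simp: D'_def D_def esets3_def permutations_of_set_def)
    have lw: "length w = ?N"
      using w S by (metis distinct_card)
    have mid: "map (mk X) [2..<n] = w"
      by (rule nth_equalityI) (auto simp: lw mk_def Xeq)
    have ends: "mk X 1 = p" "mk X n = q"
      using n by (auto simp: mk_def Xeq)
    have tk: "map (mk X) [2..<Suc r] = take ?a w" "map (mk X) [Suc s..<n] = drop (?N - ?b) w"
      using mid take_mid drop_mid by (metis take_map, metis drop_map)
    have "mset w = mset_set S"
      using w by (metis mset_set_set)
    then have "mset (map (mk X) [1..<Suc n]) = A"
      unfolding upt_split using S(3) mid ends by (simp add: add_mset_commute)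
    moreover have "\<forall>v. v \<notin> {1..n} \<longrightarrow> mk X v = 0"
      using n by (auto simp: mk_def Xeq)
    ultimately show "mk X \<in> K"
      unfolding K_iff mid tk ends using w pq by blast
    have "mk X ` {2..<n} = set (map (mk X) [2..<n])"
      by simp
    then show "((mk X ` {2..<n}, mk X 1, mk X n), map (mk X) [2..<n]) = X"
      unfolding mid ends using w by (simp add: Xeq)
    show "monom 1 (asc {1..n} (inc_edge n m) (mk X)) = wt X"
      unfolding asc_eq mid tk ends using pq
      by (simp add: wt_def Xeq prod_above_weight prod_below_weight monom_one_eq_tvar_power power_add)
  next
    fix \<kappa> assume "\<kappa> \<in> K"
    then have \<kappa>: "\<forall>v. v \<notin> {1..n} \<longrightarrow> \<kappa> v = 0" "mset (map \<kappa> [1..<Suc n]) = A" "distinct (map \<kappa> [2..<n])"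
      "\<kappa> 1 \<notin> set (map \<kappa> [2..<Suc r])" "\<kappa> n \<notin> set (map \<kappa> [Suc s..<n])"
      unfolding K_iff by auto
    have tk: "map \<kappa> [2..<Suc r] = take ?a (map \<kappa> [2..<n])" "map \<kappa> [Suc s..<n] = drop (?N - ?b) (map \<kappa> [2..<n])"
      using take_mid drop_mid by (metis take_map, metis drop_map)
    have "card (\<kappa> ` {2..<n}) = ?N"
      using \<kappa>(3) by (simp add: distinct_map card_image)
    moreover have "mset (map \<kappa> [2..<n]) = mset_set (\<kappa> ` {2..<n})"
      using mset_set_set[OF \<kappa>(3)] by simp
    then have "add_mset (\<kappa> 1) (add_mset (\<kappa> n) (mset_set (\<kappa> ` {2..<n}))) = A"
      using \<kappa>(2) unfolding upt_split by (simp add: add_mset_commute)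
    ultimately show "((\<kappa> ` {2..<n}, \<kappa> 1, \<kappa> n), map \<kappa> [2..<n]) \<in> D'"
      using \<kappa>(3,4,5) unfolding D'_def D_def tk by (auto simp: esets3_def permutations_of_set_def)
    show "mk ((\<kappa> ` {2..<n}, \<kappa> 1, \<kappa> n), map \<kappa> [2..<n]) = \<kappa>"
    proof
      fix v show "mk ((\<kappa> ` {2..<n}, \<kappa> 1, \<kappa> n), map \<kappa> [2..<n]) v = \<kappa> v"
        using \<kappa>(1) le_add_diff_inverse[of 2 v] by (auto simp: mk_def)
    qed
  qed
  finally show ?thesis
    by (simp add: chrom_qsym_def K_def)
qed

lemma chrom_qsym_eq_0:
  assumes "Poly_Mapping.lookup \<alpha> 0 \<noteq> 0"
  shows "chrom_qsym {1..n} (inc_edge n m) \<alpha> = 0"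
proof -
  have "proper_colorings_content {1..n} (inc_edge n m) \<alpha> = {}"
  proof (rule ccontr)
    assume "proper_colorings_content {1..n} (inc_edge n m) \<alpha> \<noteq> {}"
    then obtain \<kappa> where "\<kappa> \<in> proper_colorings_content {1..n} (inc_edge n m) \<alpha>" by blast
    then have "\<forall>v\<in>{1..n}. 1 \<le> \<kappa> v" "card {v\<in>{1..n}. \<kappa> v = 0} = Poly_Mapping.lookup \<alpha> 0"
      unfolding proper_colorings_content_def by blast+
    moreover from this have "{v\<in>{1..n}. \<kappa> v = 0} = {}" by force
    ultimately show False using assms by (metis card.empty)
  qed
  then show ?thesis by (simp add: chrom_qsym_def)
qed

end

section \<open>Schur functions of near-column shapes\<close>

lemma schur_eq_0:
  assumes "Poly_Mapping.lookup \<alpha> 0 \<noteq> 0"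
  shows "schur la \<alpha> = 0"
proof -
  have "ssyt_content la \<alpha> = {}"
  proof (rule ccontr)
    assume "ssyt_content la \<alpha> \<noteq> {}"
    then obtain T where "T \<in> ssyt_content la \<alpha>" by blast
    then have "\<forall>c\<in>young la. 1 \<le> T c" "card {c\<in>young la. T c = 0} = Poly_Mapping.lookup \<alpha> 0"
      unfolding ssyt_content_def by blast+
    moreover from this have "{c\<in>young la. T c = 0} = {}" by force
    ultimately show False using assms by (metis card.empty)
  qed
  then show ?thesis by (simp add: schur_def)
qed

definition first_col :: "nat \<Rightarrow> (nat \<times> nat) list" where
  "first_col k = map (\<lambda>i. (i, 0)) [0..<k]"

lemma length_first_col [simp]: "length (first_col k) = k"
  and distinct_first_col [simp]: "distinct (first_col k)"
  and set_first_col: "set (first_col k) = {(i, j). i < k \<and> j = 0}"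
  and nth_first_col [simp]: "i < k \<Longrightarrow> first_col k ! i = (i, 0)"
  by (auto simp: first_col_def distinct_map inj_on_def)

lemma young_column: "young (replicate k 1) = set (first_col k)"
  and young_21: "young (2 # replicate k 1) = set (first_col (Suc k) @ [(0, 1)])"
  and young_31: "young (3 # replicate k 1) = set (first_col (Suc k) @ [(0, 1), (0, 2)])"
  and young_22: "young ([2, 2] @ replicate k 1) = set (first_col (Suc (Suc k)) @ [(0, 1), (1, 1)])"
  by (auto simp: young_def set_first_col nth_Cons less_Suc_eq_0_disj split: nat.splits)

lemma strict_column_iff_sorted:
  "sorted_wrt (<) (map T (first_col k)) \<longleftrightarrow> (\<forall>i. Suc i < k \<longrightarrow> T (i, 0) < (T (Suc i, 0) :: nat))"
  by (subst sorted_wrt_iff_nth_Suc_transp) auto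

text \<open>For the shapes at hand \<open>cs\<close> lists the first column first, so that its
  column condition is strict sortedness of a prefix and the at most two other cells come
  last.\<close>

lemma card_ssyt_content_eq:
  assumes cs: "young la = set cs" "distinct cs"
    and cnt: "\<And>c. count A c = Poly_Mapping.lookup \<alpha> c" and zero: "0 \<notin># A"
    and Q: "\<And>T. (\<forall>i j. (i, j + 1) \<in> young la \<longrightarrow> T (i, j) \<le> T (i, j + 1)) \<and>
         (\<forall>i j. (i + 1, j) \<in> young la \<longrightarrow> T (i, j) < T (i + 1, j)) \<longleftrightarrow> Q (map T cs)"
  shows "card (ssyt_content la \<alpha>) = card {xs. length xs = length cs \<and> Q xs \<and> mset xs = A}"
proof -
  have "ssyt_content la \<alpha> = {T. (\<forall>c. c \<notin> set cs \<longrightarrow> T c = 0) \<and> (Q (map T cs) \<and> mset (map T cs) = A)}"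
  proof -
    have "(\<forall>c\<in>young la. 1 \<le> T c)" if "mset (map T cs) = A" for T
    proof
      fix c assume "c \<in> young la"
      then have "T c \<in># A" using that cs by auto
      then have "T c \<noteq> 0" using zero by metis
      then show "1 \<le> T c" by simp
    qed
    moreover have "mset (map T cs) = A \<longleftrightarrow> (\<forall>k. card {c\<in>young la. T c = k} = Poly_Mapping.lookup \<alpha> k)" for T
      using mset_map_eq_iff_card[OF cs(2), of A "Poly_Mapping.lookup \<alpha>" T] cnt unfolding cs(1) by blast
    ultimately show ?thesis
      unfolding ssyt_content_def Q[symmetric] cs(1)[symmetric] by blast
  qed
  then show ?thesis
    using bij_betw_same_card[OF bij_betw_map_default[OF cs(2), of "\<lambda>xs. Q xs \<and> mset xs = A"]] by simp
qed

lemma strict_sorted_mset: "sorted_wrt (<) u \<Longrightarrow> mset u = mset_set (set u)" for u :: "nat list"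
  by (simp add: mset_set_set strict_sorted_iff)

lemma mset_sorted_list_of_set: "finite S \<Longrightarrow> mset (sorted_list_of_set S) = mset_set S" for S :: "nat set"
  using strict_sorted_mset[of "sorted_list_of_set S"] by simp

text \<open>The first column will be remembered only as the set of its entries, so the row
  conditions at its two top cells are expressed through that set, here for the smallest entry and
  next for the second smallest.\<close>

lemma strict_sorted_hd_le:
  fixes u :: "nat list"
  assumes "sorted_wrt (<) u" "u \<noteq> []"
  shows "u ! 0 \<le> y \<longleftrightarrow> (\<exists>x\<in>set u. x \<le> y)"
  using assms by (cases u) force+

lemma strict_sorted_second_le:
  fixes u :: "nat list"
  assumes "sorted_wrt (<) u" "2 \<le> length u"
  shows "u ! 1 \<le> z \<longleftrightarrow> (\<exists>x\<in>set u. \<exists>x'\<in>set u. x < x' \<and> x' \<le> z)"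
proof -
  obtain x0 x1 v where u: "u = x0 # x1 # v"
    using assms(2) by (cases u; cases "tl u") auto
  show ?thesis
    using assms(1) unfolding u by (force dest: less_imp_le intro: le_trans)
qed

lemma sorted_list_of_set_eqI: "sorted_wrt (<) u \<Longrightarrow> sorted_list_of_set (set u) = (u :: nat list)"
  by (simp add: strict_sorted_iff sorted_list_of_set.idem_if_sorted_distinct)

lemma card_split_triple:
  assumes "finite X"
  shows "card {(S, y, z) \<in> X. P S y z} =
    card {(S, y, z) \<in> X. P S y z \<and> Q S y z} + card {(S, y, z) \<in> X. P S y z \<and> \<not> Q S y z}"
  by (subst card_Un_disjoint[symmetric])
    (auto intro: finite_subset[OF _ assms] arg_cong[where f = card])

lemma card_split_subset: "finite X \<Longrightarrow> card X = card {x\<in>X. P x} + card {x\<in>X. \<not> P x}"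
  by (subst card_Un_disjoint[symmetric]) (auto intro: arg_cong[where f = card])

text \<open>Semistandard tableaux of shape 21..1, 31..1, 221..1, encoded by the set of entries of the first
  column and the remaining entries.\<close>

definition tab21 :: "nat \<Rightarrow> nat multiset \<Rightarrow> (nat set \<times> nat) set" where
  "tab21 k A = {(S, y) \<in> esets2 k A. \<exists>x\<in>S. x \<le> y}"

definition tab31 :: "nat \<Rightarrow> nat multiset \<Rightarrow> (nat set \<times> nat \<times> nat) set" where
  "tab31 k A = {(S, y, z) \<in> esets3 k A. (\<exists>x\<in>S. x \<le> y) \<and> y \<le> z}"

definition tab22 :: "nat \<Rightarrow> nat multiset \<Rightarrow> (nat set \<times> nat \<times> nat) set" where
  "tab22 k A = {(S, y, z) \<in> esets3 k A. y < z \<and> (\<exists>x\<in>S. x \<le> y) \<and> (\<exists>x\<in>S. \<exists>x'\<in>S. x < x' \<and> x' \<le> z)}"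

context
  fixes \<alpha> :: "nat \<Rightarrow>\<^sub>0 nat" and A :: "nat multiset"
  assumes cnt: "\<And>c. count A c = Poly_Mapping.lookup \<alpha> c" and zero: "0 \<notin># A"
begin

lemma schur_column_eq: "schur (replicate k 1) \<alpha> = of_nat (card (esets1 k A))"
proof -
  have "card (ssyt_content (replicate k 1) \<alpha>) =
      card {xs. length xs = length (first_col k) \<and> sorted_wrt (<) xs \<and> mset xs = A}"
    by (rule card_ssyt_content_eq[OF young_column _ cnt zero], simp, unfold young_column)
      (auto simp: strict_column_iff_sorted set_first_col)
  also have "\<dots> = card (esets1 k A)"
    by (intro bij_betw_same_card[of set] bij_betwI[where g = sorted_list_of_set])
      (auto simp: esets1_def strict_sorted_mset sorted_list_of_set_eqI strict_sorted_iff distinct_card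
        mset_sorted_list_of_set)
  finally show ?thesis by (simp add: schur_def)
qed

lemma schur_21_eq: "schur (2 # replicate k 1) \<alpha> = of_nat (card (tab21 (Suc k) A))"
proof -
  let ?Q = "\<lambda>xs. sorted_wrt (<) (take (Suc k) xs) \<and> xs ! 0 \<le> (xs ! Suc k :: nat)"
  have "card (ssyt_content (2 # replicate k 1) \<alpha>) =
      card {xs. length xs = length (first_col (Suc k) @ [(0, 1)]) \<and> ?Q xs \<and> mset xs = A}"
    by (rule card_ssyt_content_eq[OF young_21 _ cnt zero], simp add: set_first_col, unfold young_21)
      (auto simp: strict_column_iff_sorted set_first_col nth_append)
  also have "\<dots> = card (tab21 (Suc k) A)"
  proof (intro bij_betw_same_card[of "\<lambda>xs. (set (take (Suc k) xs), xs ! Suc k)"]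
      bij_betwI[where g = "\<lambda>(S, y). sorted_list_of_set S @ [y]"] Pi_I)
    fix xs assume "xs \<in> {xs. length xs = length (first_col (Suc k) @ [(0, 1)]) \<and> ?Q xs \<and> mset xs = A}"
    then obtain u y where xs: "xs = u @ [y]" "length u = Suc k" "sorted_wrt (<) u" "u ! 0 \<le> y" "mset (u @ [y]) = A"
      by (cases xs rule: rev_cases) (auto simp: nth_append split: if_splits)
    then show "(set (take (Suc k) xs), xs ! Suc k) \<in> tab21 (Suc k) A"
      using strict_sorted_hd_le[of u y]
      by (auto simp: tab21_def esets2_def strict_sorted_mset strict_sorted_iff distinct_card nth_append)
    show "(case (set (take (Suc k) xs), xs ! Suc k) of (S, y) \<Rightarrow> sorted_list_of_set S @ [y]) = xs"
      using xs by (simp add: sorted_list_of_set_eqI nth_append)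
  next
    fix T assume "T \<in> tab21 (Suc k) A"
    then obtain S y where T: "T = (S, y)" "finite S" "card S = Suc k" "add_mset y (mset_set S) = A" "\<exists>x\<in>S. x \<le> y"
      by (auto simp: tab21_def esets2_def)
    define u where "u = sorted_list_of_set S"
    have u: "length u = Suc k" "sorted_wrt (<) u" "set u = S" "mset u = mset_set S"
      using T by (simp_all add: u_def mset_sorted_list_of_set)
    moreover from this have "u \<noteq> []" by auto
    ultimately have "u ! 0 \<le> y"
      using T strict_sorted_hd_le[of u y] by metis
    show "(case T of (S, y) \<Rightarrow> sorted_list_of_set S @ [y]) \<in>
        {xs. length xs = length (first_col (Suc k) @ [(0, 1)]) \<and> ?Q xs \<and> mset xs = A}"
      using T u \<open>u ! 0 \<le> y\<close> by (auto simp: nth_append simp flip: u_def)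
    show "(set (take (Suc k) (case T of (S, y) \<Rightarrow> sorted_list_of_set S @ [y])),
        (case T of (S, y) \<Rightarrow> sorted_list_of_set S @ [y]) ! Suc k) = T"
      using T u by (simp add: nth_append flip: u_def)
  qed
  finally show ?thesis by (simp add: schur_def)
qed

lemma length_add2_conv: "length xs = k + 2 \<longleftrightarrow> (\<exists>u y z. xs = u @ [y, z] \<and> length u = k)"
proof
  assume "length xs = k + 2"
  then show "\<exists>u y z. xs = u @ [y, z] \<and> length u = k"
    by (intro exI[of _ "take k xs"] exI[of _ "xs ! k"] exI[of _ "xs ! Suc k"])
      (auto intro!: nth_equalityI simp: nth_append nth_Cons less_Suc_eq split: nat.splits)
qed auto

lemma schur_31_eq: "schur (3 # replicate k 1) \<alpha> = of_nat (card (tab31 (Suc k) A))"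
proof -
  let ?Q = "\<lambda>xs. sorted_wrt (<) (take (Suc k) xs) \<and> xs ! 0 \<le> xs ! Suc k \<and> xs ! Suc k \<le> (xs ! Suc (Suc k) :: nat)"
  let ?X = "{xs. length xs = length (first_col (Suc k) @ [(0, 1), (0, 2)]) \<and> ?Q xs \<and> mset xs = A}"
  have "card (ssyt_content (3 # replicate k 1) \<alpha>) = card ?X"
  proof (rule card_ssyt_content_eq[OF young_31 _ cnt zero])
    fix T :: "nat \<times> nat \<Rightarrow> nat"
    have "(\<forall>i j. (i, j + 1) \<in> young (3 # replicate k 1) \<longrightarrow> T (i, j) \<le> T (i, j + 1)) \<longleftrightarrow>
        T (0, 0) \<le> T (0, 1) \<and> T (0, 1) \<le> T (0, 2)"
      unfolding young_31 by (auto simp: set_first_col numeral_2_eq_2)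
    moreover have "(\<forall>i j. (i + 1, j) \<in> young (3 # replicate k 1) \<longrightarrow> T (i, j) < T (i + 1, j)) \<longleftrightarrow>
        sorted_wrt (<) (map T (first_col (Suc k)))"
      unfolding young_31 by (auto simp: strict_column_iff_sorted set_first_col)
    ultimately show "(\<forall>i j. (i, j + 1) \<in> young (3 # replicate k 1) \<longrightarrow> T (i, j) \<le> T (i, j + 1)) \<and>
      (\<forall>i j. (i + 1, j) \<in> young (3 # replicate k 1) \<longrightarrow> T (i, j) < T (i + 1, j)) \<longleftrightarrow>
        ?Q (map T (first_col (Suc k) @ [(0, 1), (0, 2)]))"
      by (auto simp: nth_append)
  qed (auto simp: set_first_col)
  also have "\<dots> = card (tab31 (Suc k) A)"
  proof (intro bij_betw_same_card[of "\<lambda>xs. (set (take (Suc k) xs), xs ! Suc k, xs ! Suc (Suc k))"]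
      bij_betwI[where g = "\<lambda>(S, y, z). sorted_list_of_set S @ [y, z]"] Pi_I)
    fix xs assume "xs \<in> ?X"
    moreover from this obtain u y z where "xs = u @ [y, z]" "length u = Suc k"
      using length_add2_conv[of xs "Suc k"] by auto
    ultimately have xs: "xs = u @ [y, z]" "length u = Suc k" "sorted_wrt (<) u" "u ! 0 \<le> y" "y \<le> z"
        "mset (u @ [y, z]) = A"
      by (auto simp: nth_append)
    then show "(set (take (Suc k) xs), xs ! Suc k, xs ! Suc (Suc k)) \<in> tab31 (Suc k) A"
      using strict_sorted_hd_le[of u y]
      by (auto simp: tab31_def esets3_def strict_sorted_mset strict_sorted_iff distinct_card nth_append)
    show "(case (set (take (Suc k) xs), xs ! Suc k, xs ! Suc (Suc k)) of (S, y, z) \<Rightarrow>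
        sorted_list_of_set S @ [y, z]) = xs"
      using xs by (simp add: sorted_list_of_set_eqI nth_append)
  next
    fix T assume "T \<in> tab31 (Suc k) A"
    then obtain S y z where T: "T = (S, y, z)" "finite S" "card S = Suc k"
      "add_mset y (add_mset z (mset_set S)) = A" "\<exists>x\<in>S. x \<le> y" "y \<le> z"
      by (auto simp: tab31_def esets3_def)
    define u where "u = sorted_list_of_set S"
    have u: "length u = Suc k" "sorted_wrt (<) u" "set u = S" "mset u = mset_set S"
      using T by (simp_all add: u_def mset_sorted_list_of_set)
    moreover from this have "u \<noteq> []" by auto
    ultimately have "u ! 0 \<le> y"
      using T strict_sorted_hd_le[of u y] by metis
    show "(case T of (S, y, z) \<Rightarrow> sorted_list_of_set S @ [y, z]) \<in> ?X"
      using T u \<open>u ! 0 \<le> y\<close> by (auto simp: nth_append simp flip: u_def)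
    show "(set (take (Suc k) (case T of (S, y, z) \<Rightarrow> sorted_list_of_set S @ [y, z])),
        (case T of (S, y, z) \<Rightarrow> sorted_list_of_set S @ [y, z]) ! Suc k,
        (case T of (S, y, z) \<Rightarrow> sorted_list_of_set S @ [y, z]) ! Suc (Suc k)) = T"
      using T u by (simp add: nth_append flip: u_def)
  qed
  finally show ?thesis by (simp add: schur_def)
qed

lemma schur_22_eq: "schur ([2, 2] @ replicate k 1) \<alpha> = of_nat (card (tab22 (Suc (Suc k)) A))"
proof -
  let ?k = "Suc (Suc k)"
  let ?Q = "\<lambda>xs. sorted_wrt (<) (take ?k xs) \<and> xs ! 0 \<le> xs ! ?k \<and> xs ! 1 \<le> xs ! Suc ?k \<and> xs ! ?k < (xs ! Suc ?k :: nat)"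
  let ?X = "{xs. length xs = length (first_col ?k @ [(0, 1), (1, 1)]) \<and> ?Q xs \<and> mset xs = A}"
  have "card (ssyt_content ([2, 2] @ replicate k 1) \<alpha>) = card ?X"
  proof (rule card_ssyt_content_eq[OF young_22 _ cnt zero])
    fix T :: "nat \<times> nat \<Rightarrow> nat"
    have "(\<forall>i j. (i, j + 1) \<in> young ([2, 2] @ replicate k 1) \<longrightarrow> T (i, j) \<le> T (i, j + 1)) \<longleftrightarrow>
        T (0, 0) \<le> T (0, 1) \<and> T (1, 0) \<le> T (1, 1)"
      unfolding young_22 by (auto simp: set_first_col)
    moreover have "(\<forall>i j. (i + 1, j) \<in> young ([2, 2] @ replicate k 1) \<longrightarrow> T (i, j) < T (i + 1, j)) \<longleftrightarrow>
        sorted_wrt (<) (map T (first_col ?k)) \<and> T (0, 1) < T (1, 1)"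
      unfolding young_22 by (auto simp: strict_column_iff_sorted set_first_col)
    ultimately show "(\<forall>i j. (i, j + 1) \<in> young ([2, 2] @ replicate k 1) \<longrightarrow> T (i, j) \<le> T (i, j + 1)) \<and>
      (\<forall>i j. (i + 1, j) \<in> young ([2, 2] @ replicate k 1) \<longrightarrow> T (i, j) < T (i + 1, j)) \<longleftrightarrow>
        ?Q (map T (first_col ?k @ [(0, 1), (1, 1)]))"
      by (auto simp: nth_append)
  qed (auto simp: set_first_col)
  also have "\<dots> = card (tab22 ?k A)"
  proof (intro bij_betw_same_card[of "\<lambda>xs. (set (take ?k xs), xs ! ?k, xs ! Suc ?k)"]
      bij_betwI[where g = "\<lambda>(S, y, z). sorted_list_of_set S @ [y, z]"] Pi_I)
    fix xs assume "xs \<in> ?X"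
    moreover from this obtain u y z where "xs = u @ [y, z]" "length u = ?k"
      using length_add2_conv[of xs ?k] by auto
    ultimately have xs: "xs = u @ [y, z]" "length u = ?k" "sorted_wrt (<) u" "u ! 0 \<le> y" "u ! 1 \<le> z" "y < z"
        "mset (u @ [y, z]) = A"
      by (auto simp: nth_append)
    then show "(set (take ?k xs), xs ! ?k, xs ! Suc ?k) \<in> tab22 ?k A"
      using strict_sorted_hd_le[of u y] strict_sorted_second_le[of u z]
      by (auto simp: tab22_def esets3_def strict_sorted_mset strict_sorted_iff distinct_card nth_append)
    show "(case (set (take ?k xs), xs ! ?k, xs ! Suc ?k) of (S, y, z) \<Rightarrow>
        sorted_list_of_set S @ [y, z]) = xs"
      using xs by (simp add: sorted_list_of_set_eqI nth_append)
  next
    fix T assume "T \<in> tab22 ?k A"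
    then obtain S y z where T: "T = (S, y, z)" "finite S" "card S = ?k"
      "add_mset y (add_mset z (mset_set S)) = A" "\<exists>x\<in>S. x \<le> y" "\<exists>x\<in>S. \<exists>x'\<in>S. x < x' \<and> x' \<le> z" "y < z"
      unfolding tab22_def esets3_def by blast
    define u where "u = sorted_list_of_set S"
    have u: "length u = ?k" "sorted_wrt (<) u" "set u = S" "mset u = mset_set S"
      using T by (simp_all add: u_def mset_sorted_list_of_set)
    have "u ! 0 \<le> y" "u ! 1 \<le> z"
      using T u strict_sorted_hd_le[of u y] strict_sorted_second_le[of u z] by force+
    then show "(case T of (S, y, z) \<Rightarrow> sorted_list_of_set S @ [y, z]) \<in> ?X"
      using T u by (auto simp: nth_append simp flip: u_def)
    show "(set (take ?k (case T of (S, y, z) \<Rightarrow> sorted_list_of_set S @ [y, z])),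
        (case T of (S, y, z) \<Rightarrow> sorted_list_of_set S @ [y, z]) ! ?k,
        (case T of (S, y, z) \<Rightarrow> sorted_list_of_set S @ [y, z]) ! Suc ?k) = T"
      using T u by (simp add: nth_append flip: u_def)
  qed
  finally show ?thesis by (simp add: schur_def)
qed

end

section \<open>Dual Pieri rules as bijections\<close>

lemma Min_less_Diff_Min: "finite W \<Longrightarrow> x \<in> W - {Min W} \<Longrightarrow> Min W < x"
  for W :: "'a::linorder set"
  by (metis DiffE Min_le insertI1 order_le_less)

lemma add_mset_Min_Diff: "finite W \<Longrightarrow> W \<noteq> {} \<Longrightarrow> add_mset (Min W) (mset_set (W - {Min W})) = mset_set W"
  for W :: "nat set"
  by (metis Min_in mset_set.remove)

text \<open>This is e_k e_1 = s_{2,1^{k-1}} + s_{1^{k+1}}. If y does not fit to the right of the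
  first column, it is smaller than all entries there and can be put on top; it is recovered as the
  minimum.\<close>

lemma card_tab21: "card (tab21 k A) + card (esets1 (Suc k) A) = card (esets2 k A)"
proof -
  have Min_eq: "Min (insert y S) = y" if "finite S" "\<forall>x\<in>S. y < x" for y :: nat and S
    using that by (intro Min_eqI) (auto dest: less_imp_le)
  have "card {T\<in>esets2 k A. \<not> (\<exists>x\<in>fst T. x \<le> snd T)} = card (esets1 (Suc k) A)"
  proof (intro bij_betw_same_card[of "\<lambda>(S, y). insert y S"] bij_betwI[where g = "\<lambda>W. (W - {Min W}, Min W)"] Pi_I)
    fix T assume "T \<in> {T\<in>esets2 k A. \<not> (\<exists>x\<in>fst T. x \<le> snd T)}"
    then obtain S y where T: "T = (S, y)" "finite S" "card S = k" "add_mset y (mset_set S) = A" "\<forall>x\<in>S. y < x"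
      by (auto simp: esets2_def not_le)
    then have "y \<notin> S" by auto
    then show "(case T of (S, y) \<Rightarrow> insert y S) \<in> esets1 (Suc k) A"
      using T by (simp add: esets1_def)
    show "((case T of (S, y) \<Rightarrow> insert y S) - {Min (case T of (S, y) \<Rightarrow> insert y S)},
        Min (case T of (S, y) \<Rightarrow> insert y S)) = T"
      using T \<open>y \<notin> S\<close> Min_eq[of S y] by auto
  next
    fix W assume "W \<in> esets1 (Suc k) A"
    then have W: "finite W" "card W = Suc k" "mset_set W = A"
      by (auto simp: esets1_def)
    then have "W \<noteq> {}" by auto
    then have "Min W \<in> W" using W by simp
    then show "(W - {Min W}, Min W) \<in> {T\<in>esets2 k A. \<not> (\<exists>x\<in>fst T. x \<le> snd T)}"
      using W \<open>W \<noteq> {}\<close> Min_less_Diff_Min[of W] by (auto simp: esets2_def add_mset_Min_Diff not_le)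
    show "(case (W - {Min W}, Min W) of (S, y) \<Rightarrow> insert y S) = W"
      using \<open>Min W \<in> W\<close> by auto
  qed
  moreover have "{T\<in>esets2 k A. \<exists>x\<in>fst T. x \<le> snd T} = tab21 k A"
    by (auto simp: tab21_def)
  ultimately show ?thesis
    using card_split_subset[OF finite_esets2, of k A "\<lambda>T. \<exists>x\<in>fst T. x \<le> snd T"] by simp
qed

text \<open>An entry y below all of S is put on top of the first column and recovered as the
  minimum; P and Q express the remaining condition before and after this move.\<close>

lemma card_esets3_below:
  assumes P: "\<And>S y z. finite S \<Longrightarrow> \<forall>x\<in>S. y < x \<Longrightarrow> P y z \<longleftrightarrow> Q (insert y S) z"
  shows "card {(S, y, z) \<in> esets3 k A. (\<forall>x\<in>S. y < x) \<and> P y z} =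
    card {(S, z) \<in> esets2 (Suc k) A. Q S z}"
proof -
  have Min_eq: "Min (insert y S) = y" if "finite S" "\<forall>x\<in>S. y < x" for y :: nat and S
    using that by (intro Min_eqI) (auto dest: less_imp_le)
  show ?thesis
  proof (intro bij_betw_same_card[of "\<lambda>(S, y, z). (insert y S, z)"]
      bij_betwI[where g = "\<lambda>(W, z). (W - {Min W}, Min W, z)"] Pi_I)
    fix T assume "T \<in> {(S, y, z) \<in> esets3 k A. (\<forall>x\<in>S. y < x) \<and> P y z}"
    then obtain S y z where T: "T = (S, y, z)" "finite S" "card S = k" "add_mset y (add_mset z (mset_set S)) = A"
      "\<forall>x\<in>S. y < x" "P y z"
      by (auto simp: esets3_def)
    then have "y \<notin> S" by auto
    then show "(case T of (S, y, z) \<Rightarrow> (insert y S, z)) \<in> {(S, z) \<in> esets2 (Suc k) A. Q S z}"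
      using T P by (auto simp: esets2_def add_mset_commute)
    show "(case (case T of (S, y, z) \<Rightarrow> (insert y S, z)) of (W, z) \<Rightarrow> (W - {Min W}, Min W, z)) = T"
      using T \<open>y \<notin> S\<close> Min_eq[of S y] by auto
  next
    fix T assume "T \<in> {(S, z) \<in> esets2 (Suc k) A. Q S z}"
    then obtain W z where T: "T = (W, z)" "finite W" "card W = Suc k" "add_mset z (mset_set W) = A" "Q W z"
      by (auto simp: esets2_def)
    then have "W \<noteq> {}" by auto
    then have "Min W \<in> W" using T by simp
    then have "insert (Min W) (W - {Min W}) = W" by auto
    moreover have "\<forall>x\<in>W - {Min W}. Min W < x"
      using T Min_less_Diff_Min[of W] by blast
    ultimately have "P (Min W) z"
      using P[of "W - {Min W}" "Min W" z] T by simp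
    then show "(case T of (W, z) \<Rightarrow> (W - {Min W}, Min W, z)) \<in> {(S, y, z) \<in> esets3 k A. (\<forall>x\<in>S. y < x) \<and> P y z}"
      using T \<open>W \<noteq> {}\<close> \<open>Min W \<in> W\<close> \<open>\<forall>x\<in>W - {Min W}. Min W < x\<close>
      by (auto simp: esets3_def add_mset_Min_Diff add_mset_commute[of _ z])
    show "(case (case T of (W, z) \<Rightarrow> (W - {Min W}, Min W, z)) of (S, y, z) \<Rightarrow> (insert y S, z)) = T"
      using T \<open>Min W \<in> W\<close> by auto
  qed
qed

text \<open>Triples with z < y make up e_k e_2. Those with y \<le> z make up e_k h_2 = s_{3,1^{k-1}}
  + s_{2,1^k}, where the second summand collects the triples whose y lies below the first
  column.\<close>

lemma card_tab31: "card (tab31 k A) + card (tab21 (Suc k) A) + card (esets22 k A) = card (esets3 k A)"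
proof -
  have "card (esets3 k A) = card {(S, y, z) \<in> esets3 k A. y \<le> z} + card {(S, y, z) \<in> esets3 k A. z < y}"
    using card_split_triple[OF finite_esets3, of k A "\<lambda>_ _ _. True" "\<lambda>S y z. y \<le> z"]
    by (simp add: not_le)
  also have "card {(S, y, z) \<in> esets3 k A. z < y} = card {(S, y, z) \<in> esets3 k A. y < z}"
    by (intro bij_betw_same_card[of "\<lambda>(S, y, z). (S, z, y)"] bij_betwI[where g = "\<lambda>(S, y, z). (S, z, y)"])
      (auto simp: esets3_def add_mset_commute)
  also note card_esets3_less
  also have "card {(S, y, z) \<in> esets3 k A. y \<le> z} =
      card (tab31 k A) + card {(S, y, z) \<in> esets3 k A. (\<forall>x\<in>S. y < x) \<and> y \<le> z}"
    using card_split_triple[OF finite_esets3, of k A "\<lambda>S y z. y \<le> z" "\<lambda>S y z. \<exists>x\<in>S. x \<le> y"]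
    unfolding tab31_def bex_simps(8) not_le by (simp only: conj_commute)
  also have "card {(S, y, z) \<in> esets3 k A. (\<forall>x\<in>S. y < x) \<and> y \<le> z} =
      card {(S, z) \<in> esets2 (Suc k) A. \<exists>x\<in>S. x \<le> z}"
    by (rule card_esets3_below) (auto dest: less_imp_le)
  finally show ?thesis by (simp add: tab21_def)
qed

text \<open>This is e_k e_2 = s_{2,2,1^{k-2}} + e_{k+1} e_1. A pair y < z can fail to be a second
  column in two ways. If y lies below S, it is put on top of the first column; this gives the pairs
  (W, z) in which z exceeds some element of W. If only the second row fails, then min S \<le> y < z
  < all other entries, and min S is traded for y and z; this gives the pairs (W, w) in which w
  exceeds no element of W. Together these are all pairs.\<close>

lemma card_tab22:
  assumes "2 \<le> k"
  shows "card (tab22 k A) + card (esets2 (Suc k) A) = card (esets22 k A)"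
proof -
  let ?L = "{(S, y, z) \<in> esets3 k A. y < z}"
  let ?second = "\<lambda>S z. \<exists>x\<in>S. \<exists>x'\<in>S. x < x' \<and> x' \<le> (z :: nat)"
  let ?M = "{(S, y, z) \<in> esets3 k A. y < z \<and> (\<exists>x\<in>S. x \<le> y) \<and> \<not> ?second S z}"
  have "card ?L = card {(S, y, z) \<in> esets3 k A. y < z \<and> (\<exists>x\<in>S. x \<le> y)} +
      card {(S, y, z) \<in> esets3 k A. (\<forall>x\<in>S. y < x) \<and> y < z}"
    using card_split_triple[OF finite_esets3, of k A "\<lambda>S y z. y < z" "\<lambda>S y z. \<exists>x\<in>S. x \<le> y"]
    unfolding bex_simps(8) not_le by (simp only: conj_commute)
  also have "card {(S, y, z) \<in> esets3 k A. y < z \<and> (\<exists>x\<in>S. x \<le> y)} = card (tab22 k A) + card ?M"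
    using card_split_triple[OF finite_esets3, of k A "\<lambda>S y z. y < z \<and> (\<exists>x\<in>S. x \<le> y)" "\<lambda>S y z. ?second S z"]
    unfolding tab22_def conj_assoc .
  also have "card {(S, y, z) \<in> esets3 k A. (\<forall>x\<in>S. y < x) \<and> y < z} =
      card {(S, z) \<in> esets2 (Suc k) A. \<exists>x\<in>S. x < z}"
    by (rule card_esets3_below) (auto dest: less_trans)
  also have "card ?M = card {(S, z) \<in> esets2 (Suc k) A. \<not> (\<exists>x\<in>S. x < z)}"
  proof (intro bij_betw_same_card[of "\<lambda>(S, y, z). (insert y (insert z (S - {Min S})), Min S)"]
      bij_betwI[where g = "\<lambda>(W, w). (insert w (W - {Min W, Min (W - {Min W})}), Min W, Min (W - {Min W}))"] Pi_I)
    fix T assume "T \<in> ?M"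
    then obtain S y z where T: "T = (S, y, z)" "finite S" "card S = k" "add_mset y (add_mset z (mset_set S)) = A"
      "y < z" "\<exists>x\<in>S. x \<le> y" "\<not> ?second S z"
      by (auto simp: esets3_def)
    define x where "x = Min S"
    define S' where "S' = S - {x}"
    have "x \<in> S"
      using T(2,6) unfolding x_def by (intro Min_in) auto
    then have xS: "x \<in> S" "x \<notin> S'" "S = insert x S'" "finite S'" "card S' = k - 1"
      using T(2,3) unfolding S'_def by auto
    have "x \<le> y"
      using T by (auto simp: x_def intro: Min_le order_trans)
    have S'_gt: "z < x'" if "x' \<in> S'" for x'
    proof -
      have "x < x'"
        using that T(2) Min_less_Diff_Min[of S x'] by (simp add: x_def S'_def)
      then show ?thesis using T(7) that xS by (auto simp: not_le)
    qed
    have nin: "y \<notin> S'" "z \<notin> S'" using S'_gt T(5) by force+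
    let ?W = "insert y (insert z S')"
    have "add_mset x (mset_set ?W) = add_mset y (add_mset z (mset_set S))"
      using nin xS T(5) by (simp add: add_mset_commute)
    moreover have "card ?W = Suc k"
      using nin xS T(5) assms by simp
    moreover have "\<not> (\<exists>w\<in>?W. w < x)"
      using S'_gt T(5) \<open>x \<le> y\<close> by force
    ultimately have "(?W, x) \<in> {(S, z) \<in> esets2 (Suc k) A. \<not> (\<exists>x\<in>S. x < z)}"
      using T(4) xS(4) unfolding esets2_def by blast
    then show "(case T of (S, y, z) \<Rightarrow> (insert y (insert z (S - {Min S})), Min S)) \<in>
        {(S, z) \<in> esets2 (Suc k) A. \<not> (\<exists>x\<in>S. x < z)}"
      by (simp only: T(1) prod.case S'_def x_def)
    have Min1: "Min ?W = y"
      using xS T(5) S'_gt by (intro Min_eqI) (auto dest: less_imp_le S'_gt)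
    have "?W - {y} = insert z S'"
      using nin T(5) by auto
    moreover have Min2: "Min (insert z S') = z"
      using xS S'_gt by (intro Min_eqI) (auto dest: less_imp_le S'_gt)
    moreover have "?W - {y, z} = S'"
      using nin by auto
    ultimately show "(case (case T of (S, y, z) \<Rightarrow> (insert y (insert z (S - {Min S})), Min S)) of
        (W, w) \<Rightarrow> (insert w (W - {Min W, Min (W - {Min W})}), Min W, Min (W - {Min W}))) = T"
      unfolding T(1) prod.case x_def[symmetric] S'_def[symmetric] by (simp only: Min1 xS(3)[symmetric])
  next
    fix T assume "T \<in> {(S, z) \<in> esets2 (Suc k) A. \<not> (\<exists>x\<in>S. x < z)}"
    then obtain W w where T: "T = (W, w)" "finite W" "card W = Suc k" "add_mset w (mset_set W) = A"
      "\<forall>x\<in>W. w \<le> x"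
      by (auto simp: esets2_def not_less)
    define y where "y = Min W"
    define z where "z = Min (W - {y})"
    define S' where "S' = W - {y, z}"
    have "W \<noteq> {}" using T by auto
    then have y: "y \<in> W" using T by (simp add: y_def)
    have "card (W - {y}) = k" using T y by simp
    then have "W - {y} \<noteq> {}" using assms by (metis card.empty not_numeral_le_zero)
    then have z: "z \<in> W - {y}" using T unfolding z_def by (intro Min_in) auto
    then have "y < z" using T Min_less_Diff_Min[of W z] by (simp add: y_def)
    have W: "W = insert y (insert z S')" "y \<notin> S'" "z \<notin> S'" "finite S'"
      using y z T by (auto simp: S'_def)
    have S'_gt: "z < x" if "x \<in> S'" for x
      using that T Min_less_Diff_Min[of "W - {y}" x] by (auto simp: S'_def z_def)
    have "w \<le> y" using T y by simp
    have w: "w \<notin> S'" using \<open>w \<le> y\<close> \<open>y < z\<close> S'_gt by force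
    have cS: "card S' = k - 1"
      using W T(3) \<open>y < z\<close> by simp
    have "add_mset y (add_mset z (mset_set (insert w S'))) = A"
      using W w T(4) \<open>y < z\<close> by (auto simp: add_mset_commute)
    moreover have "\<not> ?second (insert w S') z"
      using S'_gt \<open>w \<le> y\<close> \<open>y < z\<close> by force
    ultimately show "(case T of (W, w) \<Rightarrow> (insert w (W - {Min W, Min (W - {Min W})}), Min W, Min (W - {Min W}))) \<in> ?M"
      using w W(4) cS assms \<open>w \<le> y\<close> \<open>y < z\<close> by (simp add: T(1) esets3_def flip: y_def z_def S'_def)
    have "Min (insert w S') = w"
      using W(4) S'_gt \<open>w \<le> y\<close> \<open>y < z\<close> by (intro Min_eqI) (auto dest!: S'_gt)
    moreover have "insert w S' - {w} = S'" using w by auto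
    ultimately show "(case (case T of (W, w) \<Rightarrow> (insert w (W - {Min W, Min (W - {Min W})}), Min W, Min (W - {Min W}))) of
       (S, y, z) \<Rightarrow> (insert y (insert z (S - {Min S})), Min S)) = T"
      unfolding T(1) prod.case y_def[symmetric] z_def[symmetric] S'_def[symmetric]
      by (simp only: W(1)[symmetric])
  qed
  finally have "card ?L = card (tab22 k A) + (card {(S, z) \<in> esets2 (Suc k) A. \<exists>x\<in>S. x < z} +
      card {(S, z) \<in> esets2 (Suc k) A. \<not> (\<exists>x\<in>S. x < z)})" by simp
  also have "card {(S, z) \<in> esets2 (Suc k) A. \<exists>x\<in>S. x < z} +
      card {(S, z) \<in> esets2 (Suc k) A. \<not> (\<exists>x\<in>S. x < z)} = card (esets2 (Suc k) A)"
    by (subst card_Un_disjoint[symmetric])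
      (auto intro: finite_subset[OF _ finite_esets2] arg_cong[where f = card])
  finally show ?thesis
    by (simp add: card_esets3_less)
qed

section \<open>Tableaux as words\<close>

lemma npairs_cong_sorted_wrt:
  assumes "sorted_wrt P xs" "\<And>x y. x \<in> set xs \<Longrightarrow> y \<in> set xs \<Longrightarrow> P x y \<Longrightarrow> R x y = R' x y"
  shows "npairs R xs = npairs R' xs"
  using assms by (induction xs) (auto intro!: arg_cong[where f = length] filter_cong)

lemma successively_first_col:
  "successively D (map T (first_col k)) \<longleftrightarrow> (\<forall>i. Suc i < k \<longrightarrow> D (T (i, 0)) (T (Suc i, 0)))"
  by (auto simp: successively_conv_nth)

lemma first_col_Suc: "first_col (Suc k) = (0, 0) # map (\<lambda>i. (i, 0)) [1..<Suc k]"
  and first_col_Suc_Suc: "first_col (Suc (Suc k)) = (0, 0) # (1, 0) # map (\<lambda>i. (i, 0)) [2..<Suc (Suc k)]"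
  by (auto simp: first_col_def upt_rec[of 0] upt_rec[of "Suc 0"] numeral_2_eq_2 simp del: upt_Suc)

lemma sorted_column: "sorted_wrt (\<lambda>c d. fst c \<le> fst d) (map (\<lambda>i. (i, 0)) [j..<k])"
  by (simp add: sorted_wrt_map)

context two_end_order
begin

text \<open>For x before y in the row reading of a tableau this says that {x, y} is a G-inversion:
  an edge whose smaller end y sits further down.\<close>

abbreviation later :: "nat \<Rightarrow> nat \<Rightarrow> bool" where
  "later x y \<equiv> inc_edge n m y x"

abbreviation no_desc :: "nat \<Rightarrow> nat \<Rightarrow> bool" where
  "no_desc x y \<equiv> \<not> nuio_less n m y x"

lemma nuio_less_trans: "nuio_less n m x y \<Longrightarrow> nuio_less n m y z \<Longrightarrow> nuio_less n m x z"
  using r rs sn by (auto simp: nuio_less_iff)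

lemma nuio_less_not_inc_edge: "nuio_less n m x y \<Longrightarrow> \<not> inc_edge n m x y \<and> \<not> inc_edge n m y x"
  using r rs sn by (auto simp: nuio_less_iff inc_edge_iff)

lemma P_tableau_row_less:
  assumes "T \<in> P_tableaux n m la" "(i, j + Suc d) \<in> young la"
  shows "nuio_less n m (T (i, j)) (T (i, j + Suc d))"
  using assms(2)
proof (induction d)
  case 0
  then show ?case using assms(1) by (simp add: P_tableaux_def)
next
  case (Suc d)
  then have "(i, j + Suc d) \<in> young la" by (simp add: young_def)
  then have "nuio_less n m (T (i, j)) (T (i, j + Suc d))" by (rule Suc.IH)
  moreover have "nuio_less n m (T (i, j + Suc d)) (T (i, j + Suc d + 1))"
    using assms(1) Suc.prems by (simp add: P_tableaux_def)
  ultimately show ?case by (auto intro: nuio_less_trans)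
qed

lemma P_tableau_row_no_edge:
  assumes "T \<in> P_tableaux n m la" "c \<in> young la" "d \<in> young la" "fst c = fst d"
  shows "\<not> inc_edge n m (T c) (T d)"
proof -
  obtain i j j' where c: "c = (i, j)" and d: "d = (i, j')"
    using assms(4) by (cases c; cases d) auto
  consider "j = j'" | e where "j' = j + Suc e" | e where "j = j' + Suc e"
    by (metis less_iff_Suc_add add_Suc_right linorder_neqE_nat)
  then show ?thesis
  proof cases
    case 1
    then show ?thesis by (simp add: c d inc_edge_def)
  qed (use assms c d P_tableau_row_less nuio_less_not_inc_edge in blast)+
qed

text \<open>\<open>cs\<close> lists the cells row by row. Entries of one row are comparable in P and
  hence never adjacent, so the requirement of different rows in \<open>inv_G\<close> can be replaced
  by the order of positions.\<close>

lemma B_poly_eq_sum_words: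
  assumes cs: "young la = set cs" "distinct cs" "sorted_wrt (\<lambda>c d. fst c \<le> fst d) cs"
    and Q: "\<And>T. (\<forall>i j. (i, j + 1) \<in> young la \<longrightarrow> nuio_less n m (T (i, j)) (T (i, j + 1))) \<and>
         (\<forall>i j. (i + 1, j) \<in> young la \<longrightarrow> \<not> nuio_less n m (T (i + 1, j)) (T (i, j))) \<longleftrightarrow> Q (map T cs)"
    and len: "length cs = n"
  shows "B_poly n m la = (\<Sum>w | w \<in> perms {1..n} \<and> Q w. tvar ^ npairs later w)"
proof -
  have perm: "bij_betw T (young la) {1..n} \<longleftrightarrow> map T cs \<in> perms {1..n}" for T
    using cs by (auto simp: bij_betw_def permutations_of_set_def distinct_map)
  have P: "P_tableaux n m la = {T. (\<forall>c. c \<notin> set cs \<longrightarrow> T c = 0) \<and>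
      (map T cs \<in> perms {1..n} \<and> Q (map T cs))}"
    unfolding P_tableaux_def perm Q[symmetric] cs(1)[symmetric] by blast
  have inv: "inv_G n m la T = npairs later (map T cs)" if T: "T \<in> P_tableaux n m la" for T
  proof -
    have "inv_G n m la T = card {(d, c). d \<in> set cs \<and> c \<in> set cs \<and> (fst d < fst c \<and> inc_edge n m (T c) (T d))}"
      unfolding inv_G_def cs(1)
      by (rule bij_betw_same_card[of prod.swap], rule bij_betwI[where g = prod.swap]) auto
    also have "\<dots> = npairs (\<lambda>d c. fst d < fst c \<and> inc_edge n m (T c) (T d)) cs"
      by (rule card_ordered_pairs_eq_npairs[OF cs(2)])
        (auto intro: sorted_wrt_mono_rel[OF _ cs(3)])
    also have "\<dots> = npairs (\<lambda>d c. inc_edge n m (T c) (T d)) cs"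
      using P_tableau_row_no_edge[OF T] cs(1)
      by (intro npairs_cong_sorted_wrt[OF cs(3)]) (auto simp: le_less)
    finally show ?thesis by (simp add: npairs_map)
  qed
  have "bij_betw (\<lambda>T. map T cs) (P_tableaux n m la) {w. length w = length cs \<and> (w \<in> perms {1..n} \<and> Q w)}"
    unfolding P by (rule bij_betw_map_default[OF cs(2)])
  also have "{w. length w = length cs \<and> (w \<in> perms {1..n} \<and> Q w)} =
      {w. w \<in> perms {1..n} \<and> Q w}"
    using len by (auto simp: length_finite_permutations_of_set)
  finally show ?thesis
    unfolding B_poly_def using inv
    by (subst sum.reindex_bij_betw[symmetric]) (auto simp: monom_one_eq_tvar_power intro!: sum.cong)
qed

text \<open>Generating function of the one-column P-tableaux of the subposet induced on V; smaller
  sets V arise when a letter is split off.\<close>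

definition words_sum :: "nat set \<Rightarrow> int poly" where
  "words_sum V = (\<Sum>w | w \<in> perms V \<and> successively no_desc w. tvar ^ npairs later w)"

lemma B_column: "B_poly n m (replicate n 1) = words_sum {1..n}"
  unfolding words_sum_def
proof (rule B_poly_eq_sum_words[OF young_column])
  show "sorted_wrt (\<lambda>c d. fst c \<le> fst d) (first_col n)"
    by (auto simp: first_col_def sorted_wrt_map sorted_wrt_iff_nth_less)
  show "((\<forall>i j. (i, j + 1) \<in> young (replicate n 1) \<longrightarrow> nuio_less n m (T (i, j)) (T (i, j + 1))) \<and>
      (\<forall>i j. (i + 1, j) \<in> young (replicate n 1) \<longrightarrow> no_desc (T (i, j)) (T (i + 1, j)))) =
      successively no_desc (map T (first_col n))" for T
    unfolding young_column by (auto simp: successively_first_col set_first_col)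
qed simp_all

lemma B_21:
  "B_poly n m (2 # replicate (n - 2) 1) = (\<Sum>w | w \<in> perms {1..n} \<and>
     (\<exists>x y u. w = x # y # u \<and> nuio_less n m x y \<and> successively no_desc (x # u)). tvar ^ npairs later w)"
proof (rule B_poly_eq_sum_words)
  let ?cs = "(0, 0) # (0, 1) # map (\<lambda>i. (i, 0)) [1..<Suc (n - 2)] :: (nat \<times> nat) list"
  have fc: "first_col (Suc (n - 2)) = (0, 0) # map (\<lambda>i. (i, 0)) [1..<Suc (n - 2)]"
    by (rule first_col_Suc)
  show young: "young (2 # replicate (n - 2) 1) = set ?cs"
    unfolding young_21 fc by auto
  show "distinct ?cs"
    by (auto simp: distinct_map inj_on_def)
  show "sorted_wrt (\<lambda>c d. fst c \<le> fst d) ?cs"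
    by (auto simp: sorted_column simp del: upt_Suc)
  show "length ?cs = n" using n by (simp del: upt_Suc)
  fix T :: "nat \<times> nat \<Rightarrow> nat"
  have row: "(\<forall>i j. (i, j + 1) \<in> young (2 # replicate (n - 2) 1) \<longrightarrow> nuio_less n m (T (i, j)) (T (i, j + 1))) \<longleftrightarrow>
      nuio_less n m (T (0, 0)) (T (0, 1))"
    unfolding young_21 by (auto simp: set_first_col)
  have col: "(\<forall>i j. (i + 1, j) \<in> young (2 # replicate (n - 2) 1) \<longrightarrow> no_desc (T (i, j)) (T (i + 1, j))) \<longleftrightarrow>
      successively no_desc (map T (first_col (Suc (n - 2))))"
    unfolding young_21 by (auto simp: successively_first_col set_first_col)
  show "((\<forall>i j. (i, j + 1) \<in> young (2 # replicate (n - 2) 1) \<longrightarrow> nuio_less n m (T (i, j)) (T (i, j + 1))) \<and>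
      (\<forall>i j. (i + 1, j) \<in> young (2 # replicate (n - 2) 1) \<longrightarrow> no_desc (T (i, j)) (T (i + 1, j)))) =
      (\<exists>x y u. map T ?cs = x # y # u \<and> nuio_less n m x y \<and> successively no_desc (x # u))"
    unfolding row col fc by (simp del: upt_Suc)
qed

lemma B_31:
  "B_poly n m (3 # replicate (n - 3) 1) = (\<Sum>w | w \<in> perms {1..n} \<and>
     (\<exists>x y z u. w = x # y # z # u \<and> nuio_less n m x y \<and> nuio_less n m y z \<and> successively no_desc (x # u)).
     tvar ^ npairs later w)"
proof (rule B_poly_eq_sum_words)
  let ?cs = "(0, 0) # (0, 1) # (0, 2) # map (\<lambda>i. (i, 0)) [1..<Suc (n - 3)] :: (nat \<times> nat) list"
  have fc: "first_col (Suc (n - 3)) = (0, 0) # map (\<lambda>i. (i, 0)) [1..<Suc (n - 3)]"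
    by (rule first_col_Suc)
  show young: "young (3 # replicate (n - 3) 1) = set ?cs"
    unfolding young_31 fc by auto
  show "distinct ?cs"
    by (auto simp: distinct_map inj_on_def)
  show "sorted_wrt (\<lambda>c d. fst c \<le> fst d) ?cs"
    by (auto simp: sorted_column simp del: upt_Suc)
  show "length ?cs = n" using n by (simp del: upt_Suc)
  fix T :: "nat \<times> nat \<Rightarrow> nat"
  have row: "(\<forall>i j. (i, j + 1) \<in> young (3 # replicate (n - 3) 1) \<longrightarrow> nuio_less n m (T (i, j)) (T (i, j + 1))) \<longleftrightarrow>
      nuio_less n m (T (0, 0)) (T (0, 1)) \<and> nuio_less n m (T (0, 1)) (T (0, 2))"
    unfolding young_31 by (auto simp: set_first_col numeral_2_eq_2)
  have col: "(\<forall>i j. (i + 1, j) \<in> young (3 # replicate (n - 3) 1) \<longrightarrow> no_desc (T (i, j)) (T (i + 1, j))) \<longleftrightarrow>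
      successively no_desc (map T (first_col (Suc (n - 3))))"
    unfolding young_31 by (auto simp: successively_first_col set_first_col)
  show "((\<forall>i j. (i, j + 1) \<in> young (3 # replicate (n - 3) 1) \<longrightarrow> nuio_less n m (T (i, j)) (T (i, j + 1))) \<and>
      (\<forall>i j. (i + 1, j) \<in> young (3 # replicate (n - 3) 1) \<longrightarrow> no_desc (T (i, j)) (T (i + 1, j)))) =
      (\<exists>x y z u. map T ?cs = x # y # z # u \<and> nuio_less n m x y \<and> nuio_less n m y z \<and> successively no_desc (x # u))"
    unfolding row col fc by (simp del: upt_Suc)
qed

lemma B_22:
  "B_poly n m ([2, 2] @ replicate (n - 4) 1) = (\<Sum>w | w \<in> perms {1..n} \<and>
     (\<exists>x y x' y' u. w = x # y # x' # y' # u \<and> nuio_less n m x y \<and> nuio_less n m x' y' \<and> no_desc y y' \<and>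
        successively no_desc (x # x' # u)). tvar ^ npairs later w)"
proof (rule B_poly_eq_sum_words)
  let ?k = "Suc (Suc (n - 4))"
  let ?cs = "(0, 0) # (0, 1) # (1, 0) # (1, 1) # map (\<lambda>i. (i, 0)) [2..<?k] :: (nat \<times> nat) list"
  have fc: "first_col ?k = (0, 0) # (1, 0) # map (\<lambda>i. (i, 0)) [2..<?k]"
    by (rule first_col_Suc_Suc)
  show young: "young ([2, 2] @ replicate (n - 4) 1) = set ?cs"
    unfolding young_22 fc by auto
  show "distinct ?cs"
    by (auto simp: distinct_map inj_on_def)
  show "sorted_wrt (\<lambda>c d. fst c \<le> fst d) ?cs"
    by (auto simp: sorted_column simp del: upt_Suc)
  show "length ?cs = n" using n by (simp del: upt_Suc)
  fix T :: "nat \<times> nat \<Rightarrow> nat"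
  have row: "(\<forall>i j. (i, j + 1) \<in> young ([2, 2] @ replicate (n - 4) 1) \<longrightarrow> nuio_less n m (T (i, j)) (T (i, j + 1))) \<longleftrightarrow>
      nuio_less n m (T (0, 0)) (T (0, 1)) \<and> nuio_less n m (T (1, 0)) (T (1, 1))"
    unfolding young_22 by (auto simp: set_first_col)
  have col: "(\<forall>i j. (i + 1, j) \<in> young ([2, 2] @ replicate (n - 4) 1) \<longrightarrow> no_desc (T (i, j)) (T (i + 1, j))) \<longleftrightarrow>
      no_desc (T (0, 1)) (T (1, 1)) \<and> successively no_desc (map T (first_col ?k))"
    unfolding young_22 by (auto simp: successively_first_col set_first_col)
  show "((\<forall>i j. (i, j + 1) \<in> young ([2, 2] @ replicate (n - 4) 1) \<longrightarrow> nuio_less n m (T (i, j)) (T (i, j + 1))) \<and>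
      (\<forall>i j. (i + 1, j) \<in> young ([2, 2] @ replicate (n - 4) 1) \<longrightarrow> no_desc (T (i, j)) (T (i + 1, j)))) =
      (\<exists>x y x' y' u. map T ?cs = x # y # x' # y' # u \<and> nuio_less n m x y \<and> nuio_less n m x' y' \<and> no_desc y y' \<and>
        successively no_desc (x # x' # u))"
    unfolding row col fc by (auto simp del: upt_Suc)
qed

section \<open>Words in the clique and insertion of the two end vertices\<close>

lemma npairs_later_mid:
  assumes "set w \<subseteq> {2..<n}"
  shows "npairs later w = npairs (>) w"
  using assms by (intro npairs_cong) (auto simp: inc_edge_iff)

lemma successively_no_desc_mid: "set w \<subseteq> {2..<n} \<Longrightarrow> successively no_desc w"
proof (induction w)
  case (Cons x w)
  then show ?case by (cases w) (auto simp: nuio_less_iff)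
qed simp

lemma sum_permutations_later_mid:
  assumes "V \<subseteq> {2..<n}"
  shows "(\<Sum>w\<in>perms V. tvar ^ npairs later w) = qfact (card V)"
proof -
  have "(\<Sum>w\<in>perms V. tvar ^ npairs later w) = (\<Sum>w\<in>perms V. tvar ^ npairs (>) w)"
    using assms by (intro sum.cong) (auto simp: npairs_later_mid permutations_of_set_def)
  then show ?thesis
    using sum_permutations_tvar_npairs_greater[OF finite_subset[OF assms]] by simp
qed

lemma words_sum_mid:
  assumes "V \<subseteq> {2..<n}"
  shows "words_sum V = qfact (card V)"
proof -
  have "{w. w \<in> perms V \<and> successively no_desc w} = perms V"
    using assms successively_no_desc_mid by (auto simp: permutations_of_set_def)
  then show ?thesis
    using sum_permutations_later_mid[OF assms] by (simp add: words_sum_def)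
qed

text \<open>Nothing lies below 1 in P, so 1 may be followed by every letter; it may itself follow
  exactly its neighbours 2, ..., r, and these may be followed by every letter of V. This is the
  situation of \<open>sum_permutations_insert\<close>.\<close>

lemma words_sum_insert_1:
  assumes "V \<subseteq> {2..n}"
  shows "words_sum (insert 1 V) = qint (Suc (card (V \<inter> {2..r}))) * words_sum V"
  unfolding words_sum_def
proof (rule sum_permutations_insert)
  show "finite V" using assms finite_subset by auto
qed (use assms r rs sn in \<open>auto simp: nuio_less_iff inc_edge_iff\<close>)

text \<open>Reversing the words turns insertion of n directly before a neighbour or at the end into
  insertion directly behind a neighbour or in front.\<close>

lemma words_sum_insert_n:
  assumes "V \<subseteq> {1..<n}"
  shows "words_sum (insert n V) = qint (Suc (card (V \<inter> {s<..<n}))) * words_sum V"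
proof -
  have rev: "words_sum V = (\<Sum>w | w \<in> perms V \<and> successively (\<lambda>x y. no_desc y x) w.
      tvar ^ npairs (\<lambda>x y. later y x) w)" for V
    unfolding words_sum_def
    by (rule sum.reindex_bij_witness[of _ rev rev]) (auto simp: npairs_rev permutations_of_set_def)
  show ?thesis
    unfolding rev
  proof (rule sum_permutations_insert)
    show "finite V" using assms finite_subset by auto
  qed (use assms r rs sn in \<open>auto simp: nuio_less_iff inc_edge_iff\<close>)
qed

lemma interval_split: "{1..n} = insert 1 (insert n {2..<n})"
  using n by auto

lemma words_sum_full:
  assumes "V \<subseteq> {2..<n}"
  shows "words_sum (insert 1 (insert n V)) =
    qint (Suc (card (V \<inter> {2..r}))) * qint (Suc (card (V \<inter> {s<..<n}))) * qfact (card V)"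
proof -
  have "insert n V \<inter> {2..r} = V \<inter> {2..r}" using rs sn by auto
  moreover have "insert n V \<subseteq> {2..n}" "V \<subseteq> {1..<n}" using assms n by auto
  ultimately show ?thesis
    using words_sum_mid[OF assms] by (simp add: words_sum_insert_1[simplified] words_sum_insert_n mult.assoc)
qed

lemma card_mid_first: "card ({2..<n} \<inter> {2..r}) = r - 1"
proof -
  have "{2..<n} \<inter> {2..r} = {2..r}" using rs sn by auto
  then show ?thesis by simp
qed

lemma card_mid_last: "card ({2..<n} \<inter> {s<..<n}) = n - 1 - s"
proof -
  have "{2..<n} \<inter> {s<..<n} = {s<..<n}" using r rs by auto
  then show ?thesis by simp
qed

lemma B_column_eq: "B_poly n m (replicate n 1) = qint r * qint (n - s) * qfact (n - 2)"
proof -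
  have "Suc (r - 1) = r" "Suc (n - 1 - s) = n - s" using r sn by auto
  then show ?thesis
    unfolding B_column interval_split words_sum_full[OF subset_refl] card_mid_first card_mid_last by simp
qed

text \<open>Both generating functions come from words y # w with w free of descents and y arbitrary,
  and the right-hand side sorts them by y. If y and the head x of w form no descent, the word is a
  column. Otherwise x <_P y, and exchanging the two letters gives the row reading of a tableau of
  shape 21..1; the exponent is unchanged because comparable elements are not adjacent.\<close>

lemma B_column_plus_B_21:
  "B_poly n m (replicate n 1) + B_poly n m (2 # replicate (n - 2) 1) =
    (\<Sum>y\<in>{1..n}. tvar ^ card {v\<in>{1..n}. inc_edge n m v y} * words_sum ({1..n} - {y}))"
proof -
  let ?P = "perms {1..n}"
  let ?D = "{w. w \<in> ?P \<and> (\<exists>x y u. w = y # x # u \<and> nuio_less n m x y \<and> successively no_desc (x # u))}"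
  have fin: "finite {w. w \<in> perms V \<and> P w}" for V :: "nat set" and P
    by (rule finite_subset[of _ "perms V"]) auto
  have "(\<Sum>y\<in>{1..n}. tvar ^ card {v\<in>{1..n}. inc_edge n m v y} * words_sum ({1..n} - {y})) =
     (\<Sum>y\<in>{1..n}. \<Sum>w\<in>perms ({1..n} - {y}). if successively no_desc w then tvar ^ npairs later (y # w) else 0)"
  proof (rule sum.cong[OF refl])
    fix y assume "y \<in> {1..n}"
    have "{v\<in>{1..n} - {y}. inc_edge n m v y} = {v\<in>{1..n}. inc_edge n m v y}"
      by (auto simp: inc_edge_def)
    then have "(\<Sum>w\<in>perms ({1..n} - {y}). if successively no_desc w then tvar ^ npairs later (y # w) else 0) =
      (\<Sum>w\<in>perms ({1..n} - {y}). if successively no_desc w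
          then tvar ^ card {v\<in>{1..n}. inc_edge n m v y} * tvar ^ npairs later w else 0)"
      by (intro sum.cong) (simp_all add: length_filter_permutation power_add del: atLeastAtMost_iff)
    also have "\<dots> = tvar ^ card {v\<in>{1..n}. inc_edge n m v y} * words_sum ({1..n} - {y})"
      unfolding words_sum_def sum_distrib_left
      by (subst sum.inter_filter[symmetric]) auto
    finally show "tvar ^ card {v\<in>{1..n}. inc_edge n m v y} * words_sum ({1..n} - {y}) =
      (\<Sum>w\<in>perms ({1..n} - {y}). if successively no_desc w then tvar ^ npairs later (y # w) else 0)"
      by simp
  qed
  also have "\<dots> = (\<Sum>w\<in>?P. if successively no_desc (tl w) then tvar ^ npairs later w else 0)"
    using n by (subst sum_permutations_of_set_Cons) auto
  also have "\<dots> = (\<Sum>w | w \<in> ?P \<and> successively no_desc (tl w). tvar ^ npairs later w)"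
    by (subst sum.inter_filter[symmetric]) auto
  also have "{w. w \<in> ?P \<and> successively no_desc (tl w)} = {w. w \<in> ?P \<and> successively no_desc w} \<union> ?D"
  proof -
    have "successively no_desc (tl w) \<longleftrightarrow> successively no_desc w \<or>
        (\<exists>x y u. w = y # x # u \<and> nuio_less n m x y \<and> successively no_desc (x # u))" if "w \<in> ?P" for w
    proof -
      have "length w = n" using that by (simp add: length_finite_permutations_of_set)
      then obtain y x u where "w = y # x # u"
        using n by (cases w; cases "tl w") auto
      then show ?thesis by auto
    qed
    then show ?thesis by blast
  qed
  also have "(\<Sum>w\<in>{w. w \<in> ?P \<and> successively no_desc w} \<union> ?D. tvar ^ npairs later w) =
     words_sum {1..n} + (\<Sum>w\<in>?D. tvar ^ npairs later w)"
    unfolding words_sum_def by (rule sum.union_disjoint) (auto simp: fin)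
  also have "(\<Sum>w\<in>?D. tvar ^ npairs later w) = B_poly n m (2 # replicate (n - 2) 1)"
    unfolding B_21
  proof -
    define sw where "sw w = (w ! 1) # (w ! 0) # drop 2 w" for w :: "nat list"
    have sw: "sw (x # y # u) = y # x # u" for x y u
      by (simp add: sw_def)
    have perm: "x # y # u \<in> ?P \<Longrightarrow> y # x # u \<in> ?P" for x y u
      by (auto simp: permutations_of_set_def)
    let ?E = "{w. w \<in> ?P \<and> (\<exists>x y u. w = x # y # u \<and> nuio_less n m x y \<and> successively no_desc (x # u))}"
    have D: "sw w \<in> ?E \<and> sw (sw w) = w \<and> npairs later (sw w) = npairs later w" if wD: "w \<in> ?D" for w
    proof -
      obtain x y u where w: "w = y # x # u" "nuio_less n m x y" "successively no_desc (x # u)" "y # x # u \<in> ?P"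
        using wD by blast
      then show ?thesis
        using nuio_less_not_inc_edge[OF w(2)] perm[OF w(4)] unfolding w(1) sw by (simp add: add.left_commute)
    qed
    have E: "sw w \<in> ?D \<and> sw (sw w) = w" if wE: "w \<in> ?E" for w
    proof -
      obtain x y u where w: "w = x # y # u" "nuio_less n m x y" "successively no_desc (x # u)" "x # y # u \<in> ?P"
        using wE by blast
      then show ?thesis
        using perm[OF w(4)] unfolding w(1) sw by simp
    qed
    show "(\<Sum>w\<in>?D. tvar ^ npairs later w) = (\<Sum>w\<in>?E. tvar ^ npairs later w)"
      using D E by (intro sum.reindex_bij_witness[of _ sw sw]) auto
  qed
  finally show ?thesis
    unfolding B_column ..
qed

end

section \<open>Generating functions of the P-tableaux\<close>

lemma sum_tvar_power_shift:
  "d \<le> i \<Longrightarrow> (\<Sum>y\<in>{i..<i + k}. tvar ^ (y - d)) = tvar ^ (i - d) * qint k"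
proof (induction k)
  case (Suc k)
  then show ?case
    by (simp add: qint_Suc distrib_left flip: power_add)
qed simp

lemma append_in_permutations_of_set_iff:
  "xs @ u \<in> perms V \<longleftrightarrow>
    distinct xs \<and> set xs \<subseteq> V \<and> u \<in> perms (V - set xs)"
  unfolding permutations_of_set_def by auto

text \<open>The numbers a, b, c are those of the overview, and N = k + 2. The predecessors
  \<open>a'\<close>, \<open>b'\<close>, \<open>c'\<close> replace subtractions of natural numbers by
  successors in the arguments of q-integers.\<close>

locale two_end_order_param = two_end_order +
  fixes a' b' c' a b c k :: nat
  assumes a: "a = Suc a'" and b: "b = Suc b'" and c: "c = Suc c'"
    and r_eq: "r = Suc a" and s_eq: "s = Suc (a + c)" and n_eq: "n = Suc (Suc (a + b + c))"
    and k: "k = Suc (a' + b' + c')"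
begin

lemma N_eq: "a + b + c = Suc (Suc k)" "n - 2 = Suc (Suc k)"
  by (simp_all add: a b c k n_eq)

lemma B_column_param: "B_poly n m (replicate n 1) = qint (Suc a) * qint (Suc b) * qfact (Suc (Suc k))"
proof -
  have "n - s = Suc b" by (simp add: n_eq s_eq)
  then show ?thesis unfolding B_column_eq N_eq(2) r_eq by simp
qed

text \<open>The only chains of three elements are 1 <_P y <_P n with r < y \<le> s, and the rest of
  the column is any permutation of the other clique elements. In the exponent y contributes y - 2, n
  contributes b and 1 nothing; summing over y gives t^a [c].\<close>

lemma B_31_param: "B_poly n m (3 # replicate (n - 3) 1) = tvar ^ (a + b) * qint c * qfact (Suc k)"
proof -
  let ?Q = "{2..<n}"
  let ?I = "SIGMA y:{Suc r..<Suc r + c}. perms (?Q - {y})"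
  let ?W = "{w. w \<in> perms {1..n} \<and>
     (\<exists>x y z u. w = x # y # z # u \<and> nuio_less n m x y \<and> nuio_less n m y z \<and> successively no_desc (x # u))}"
  have W: "w \<in> ?W \<longleftrightarrow> (\<exists>y u. w = 1 # y # n # u \<and> (y, u) \<in> ?I)" for w
  proof
    assume "w \<in> ?W"
    then obtain x y z u where w: "w = x # y # z # u" "nuio_less n m x y" "nuio_less n m y z"
      and p: "w \<in> perms {1..n}"
      by blast
    then have "z = n" "x = 1" "r < y" "y \<le> s"
      using r rs sn by (auto simp: nuio_less_iff)
    moreover have "{1..n} - {1, y, n} = ?Q - {y}" by auto
    then have "u \<in> perms (?Q - {y})"
      using p append_in_permutations_of_set_iff[of "[1, y, n]" u "{1..n}"] unfolding w(1) \<open>z = n\<close> \<open>x = 1\<close> by simp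
    ultimately show "\<exists>y u. w = 1 # y # n # u \<and> (y, u) \<in> ?I"
      using w by (auto simp: r_eq s_eq)
  next
    assume "\<exists>y u. w = 1 # y # n # u \<and> (y, u) \<in> ?I"
    then obtain y u where w: "w = 1 # y # n # u" and y: "r < y" "y \<le> s"
      and u: "u \<in> perms (?Q - {y})"
      by (auto simp: r_eq s_eq)
    have "[1, y, n] @ u \<in> perms {1..n}"
    proof -
      have "distinct [1, y, n]" "set [1, y, n] \<subseteq> {1..n}" "{1..n} - set [1, y, n] = ?Q - {y}"
        using y n r rs sn by auto
      then show ?thesis
        using u by (simp only: append_in_permutations_of_set_iff simp_thms)
    qed
    then have "w \<in> perms {1..n}"
      by (simp add: w)
    moreover have "successively no_desc u"
      using permutations_of_setD(1)[OF u] by (intro successively_no_desc_mid) auto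
    moreover have "no_desc 1 v" for v
      using n r by (auto simp: nuio_less_iff)
    ultimately have "w \<in> perms {1..n}" "successively no_desc (1 # u)"
      by (simp_all add: successively_Cons)
    moreover have "nuio_less n m 1 y" "nuio_less n m y n"
      using y n r rs sn by (auto simp: nuio_less_iff)
    ultimately show "w \<in> ?W"
      using w by blast
  qed
  have "B_poly n m (3 # replicate (n - 3) 1) = (\<Sum>w\<in>?W. tvar ^ npairs later w)"
    by (rule B_31)
  also have "\<dots> = (\<Sum>(y, u)\<in>?I. tvar ^ npairs later (1 # y # n # u))"
    by (rule sum.reindex_bij_witness[of _ "\<lambda>(y, u). 1 # y # n # u" "\<lambda>w. (w ! 1, drop 3 w)"])
      (auto simp only: W, auto)
  also have "\<dots> = (\<Sum>y\<in>{Suc r..<Suc r + c}. \<Sum>u\<in>perms (?Q - {y}). tvar ^ npairs later (1 # y # n # u))"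
    by (subst sum.Sigma) auto
  also have "\<dots> = (\<Sum>y\<in>{Suc r..<Suc r + c}. tvar ^ (y - 2) * (tvar ^ b * qfact (Suc k)))"
  proof (rule sum.cong[OF refl])
    fix y assume "y \<in> {Suc r..<Suc r + c}"
    then have y: "r < y" "y \<le> s" by (auto simp: r_eq s_eq)
    have "npairs later (1 # y # n # u) = (y - 2) + b + npairs later u" if u: "u \<in> perms (?Q - {y})" for u
    proof -
      have set_u: "set u = ?Q - {y}" using u by (simp add: permutations_of_set_def)
      have 1: "filter (later 1) (y # n # u) = []"
        using set_u by (auto simp: inc_edge_iff filter_empty_conv)
      have "{v \<in> ?Q - {y}. later y v} = {2..<y}"
        using y r rs sn by (auto simp: inc_edge_iff)
      then have 2: "length (filter (later y) u) = y - 2"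
        using length_filter_permutation[OF u, of "later y"] by simp
      have "{v \<in> ?Q - {y}. later n v} = {s<..<n}"
        using y r rs sn by (auto simp: inc_edge_iff)
      then have 3: "length (filter (later n) u) = b"
        using length_filter_permutation[OF u, of "later n"] by (simp add: n_eq s_eq)
      have "\<not> later y n" by (simp add: inc_edge_iff)
      then show ?thesis using 1 2 3 by simp
    qed
    then have "(\<Sum>u\<in>perms (?Q - {y}). tvar ^ npairs later (1 # y # n # u)) =
        (\<Sum>u\<in>perms (?Q - {y}). tvar ^ (y - 2) * (tvar ^ b * tvar ^ npairs later u))"
      by (intro sum.cong) (simp_all only: power_add mult.assoc)
    also have "\<dots> = tvar ^ (y - 2) * (tvar ^ b * qfact (card (?Q - {y})))"
      by (subst sum_permutations_later_mid[symmetric]) (auto simp: sum_distrib_left)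
    also have "card (?Q - {y}) = Suc k"
      using y r rs sn N_eq by simp
    finally show "(\<Sum>u\<in>perms (?Q - {y}). tvar ^ npairs later (1 # y # n # u)) =
      tvar ^ (y - 2) * (tvar ^ b * qfact (Suc k))" .
  qed
  also have "\<dots> = tvar ^ (Suc r - 2) * qint c * (tvar ^ b * qfact (Suc k))"
    unfolding sum_distrib_right[symmetric] using r by (subst sum_tvar_power_shift) auto
  finally show ?thesis
    by (simp add: r_eq power_add)
qed

text \<open>The first two rows are 1, y and x, n, or else x, n and 1, y. In the first arrangement
  only r < y < n, 2 \<le> x \<le> s and x \<noteq> y are required, and the cases y \<le> s and y > s
  give the first two summands. In the second arrangement the column conditions force x \<le> r and y
  > s, which gives the third.\<close>

lemma B_22_param:
  "B_poly n m ([2, 2] @ replicate (n - 4) 1) = qfact k *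
     (tvar ^ (a + b) * qint c * qint (a + c') + tvar ^ Suc k * qint b * qint (a + c) +
      tvar ^ Suc (Suc k) * qint a * qint b)"
proof -
  let ?Q = "{2..<n}"
  let ?I1 = "SIGMA y:{r<..<n}. SIGMA x:{2..s} - {y}. perms (?Q - {x, y})"
  let ?I2 = "SIGMA x:{2..r}. SIGMA y:{s<..<n}. perms (?Q - {x, y})"
  let ?f1 = "\<lambda>(y, x, u). 1 # y # x # n # u" and ?f2 = "\<lambda>(x, y, u). x # n # 1 # y # u"
  let ?W = "{w. w \<in> perms {1..n} \<and>
     (\<exists>x y x' y' u. w = x # y # x' # y' # u \<and> nuio_less n m x y \<and> nuio_less n m x' y' \<and> no_desc y y' \<and>
        successively no_desc (x # x' # u))}"
  have W_sub: "w \<in> ?f1 ` ?I1 \<union> ?f2 ` ?I2" if wW: "w \<in> ?W" for w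
  proof -
    obtain x y x' y' u where w: "w = x # y # x' # y' # u" "nuio_less n m x y" "nuio_less n m x' y'" "no_desc y y'"
      "no_desc x x'" and "w \<in> perms {1..n}"
      using wW by auto
    then have p: "distinct [x, y, x', y']" "{x, y, x', y'} \<subseteq> {1..n}"
        "u \<in> perms ({1..n} - {x, y, x', y'})"
      using append_in_permutations_of_set_iff[of "[x, y, x', y']" u "{1..n}"] by simp_all
    show ?thesis
    proof (cases "y = n")
      case True
      then have eq: "x' = 1" "r < y'" "y' < n" "s < y'" "2 \<le> x" "x \<le> r"
        using w p n r rs sn by (auto simp: nuio_less_iff)
      have "{1..n} - {x, y, x', y'} = ?Q - {x, y'}" using eq(1) True by auto
      then have "u \<in> perms (?Q - {x, y'})" using p(3) by simp
      then have "(x, y', u) \<in> ?I2" using eq by auto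
      then have "?f2 (x, y', u) \<in> ?f2 ` ?I2" by (rule imageI)
      then show ?thesis using w(1) eq True by simp
    next
      case False
      then have eq: "x = 1" "r < y" "y < n" "y' = n" "2 \<le> x'" "x' \<le> s" "x' \<noteq> y"
        using w p n r rs sn by (auto simp: nuio_less_iff)
      have "{1..n} - {x, y, x', y'} = ?Q - {x', y}" using eq(1,4) by auto
      then have "u \<in> perms (?Q - {x', y})" using p(3) by simp
      then have "(y, x', u) \<in> ?I1" using eq by auto
      then have "?f1 (y, x', u) \<in> ?f1 ` ?I1" by (rule imageI)
      then show ?thesis using w(1) eq by simp
    qed
  qed
  have I1_sub: "?f1 T \<in> ?W" if TI: "T \<in> ?I1" for T
  proof -
    obtain y x u where T: "T = (y, x, u)" by (cases T)
    then have e: "r < y" "y < n" "2 \<le> x" "x \<le> s" "x \<noteq> y"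
      and u: "u \<in> perms (?Q - {x, y})"
      using TI by auto
    have "[1, y, x, n] @ u \<in> perms {1..n}"
    proof -
      have "distinct [1, y, x, n]" "set [1, y, x, n] \<subseteq> {1..n}" "{1..n} - set [1, y, x, n] = ?Q - {x, y}"
        using e n r rs sn by auto
      then show ?thesis
        using u by (simp only: append_in_permutations_of_set_iff simp_thms)
    qed
    then have perm: "1 # y # x # n # u \<in> perms {1..n}"
      by simp
    have "successively no_desc (x # u)"
      using permutations_of_setD(1)[OF u] e rs sn by (intro successively_no_desc_mid) auto
    moreover have "no_desc 1 x"
      using n r by (auto simp: nuio_less_iff)
    ultimately have "successively no_desc (1 # x # u)"
      by simp
    moreover have "nuio_less n m 1 y" "nuio_less n m x n" "no_desc y n"
      using e n r rs sn by (auto simp: nuio_less_iff)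
    ultimately show ?thesis
      using perm unfolding T prod.case by blast
  qed
  have I2_sub: "?f2 T \<in> ?W" if TI: "T \<in> ?I2" for T
  proof -
    obtain y x u where T: "T = (x, y, u)" by (cases T)
    then have e: "s < y" "y < n" "2 \<le> x" "x \<le> r"
      and u: "u \<in> perms (?Q - {x, y})"
      using TI by auto
    have "[x, n, 1, y] @ u \<in> perms {1..n}"
    proof -
      have "distinct [x, n, 1, y]" "set [x, n, 1, y] \<subseteq> {1..n}" "{1..n} - set [x, n, 1, y] = ?Q - {x, y}"
        using e n r rs sn by auto
      then show ?thesis
        using u by (simp only: append_in_permutations_of_set_iff simp_thms)
    qed
    then have perm: "x # n # 1 # y # u \<in> perms {1..n}"
      by simp
    have "successively no_desc u"
      using permutations_of_setD(1)[OF u] by (intro successively_no_desc_mid) auto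
    moreover have "no_desc 1 v" for v
      using n r by (auto simp: nuio_less_iff)
    moreover have "no_desc x 1"
      using e n rs sn by (auto simp: nuio_less_iff)
    ultimately have "successively no_desc (x # 1 # u)"
      by (simp add: successively_Cons)
    moreover have "nuio_less n m x n" "nuio_less n m 1 y" "no_desc n y"
      using e n r rs sn by (auto simp: nuio_less_iff)
    ultimately show ?thesis
      using perm unfolding T prod.case by blast
  qed
  have W: "?W = ?f1 ` ?I1 \<union> ?f2 ` ?I2"
  proof (intro subset_antisym subsetI)
    fix w assume "w \<in> ?f1 ` ?I1 \<union> ?f2 ` ?I2"
    then show "w \<in> ?W"
      by (elim UnE imageE) (simp_all only: I1_sub I2_sub)
  qed (rule W_sub)
  have fin: "finite ?I1" "finite ?I2"
    by (intro finite_SigmaI; simp)+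
  have inj: "inj_on ?f1 ?I1" "inj_on ?f2 ?I2"
    by (auto simp: inj_on_def)
  have "B_poly n m ([2, 2] @ replicate (n - 4) 1) = (\<Sum>w\<in>?W. tvar ^ npairs later w)"
    by (rule B_22)
  also have "\<dots> = (\<Sum>w\<in>?f1 ` ?I1. tvar ^ npairs later w) + (\<Sum>w\<in>?f2 ` ?I2. tvar ^ npairs later w)"
    unfolding W using fin by (intro sum.union_disjoint) auto
  also have "(\<Sum>w\<in>?f1 ` ?I1. tvar ^ npairs later w) = (\<Sum>(y, x, u)\<in>?I1. tvar ^ npairs later (1 # y # x # n # u))"
    by (subst sum.reindex[OF inj(1)]) (simp add: case_prod_beta comp_def)
  also have "\<dots> = (\<Sum>y\<in>{r<..<n}. \<Sum>x\<in>{2..s} - {y}. \<Sum>u\<in>perms (?Q - {x, y}).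
      tvar ^ npairs later (1 # y # x # n # u))"
    by (subst sum.Sigma, simp, simp)+ (simp add: case_prod_beta)
  also have "\<dots> = (\<Sum>y\<in>{r<..<n}. \<Sum>x\<in>{2..s} - {y}.
      tvar ^ card {v\<in>{2..s} - {y}. v < x} * (tvar ^ (y - 2) * (tvar ^ card ({s<..<n} - {y}) * qfact k)))"
  proof (intro sum.cong refl)
    fix y x assume "y \<in> {r<..<n}" "x \<in> {2..s} - {y}"
    then have y: "r < y" "y < n" and x: "2 \<le> x" "x \<le> s" "x \<noteq> y" by auto
    have "npairs later (1 # y # x # n # u) =
        card {v\<in>{2..s} - {y}. v < x} + ((y - 2) + (card ({s<..<n} - {y}) + npairs later u))"
      if u: "u \<in> perms (?Q - {x, y})" for u
    proof -
      have set_u: "set u = ?Q - {x, y}" using u by (simp add: permutations_of_set_def)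
      have 1: "filter (later 1) (y # x # n # u) = []"
        using set_u by (auto simp: inc_edge_iff filter_empty_conv)
      have "length (filter (later y) (x # n # u)) = card {v\<in>?Q - {y}. v < y}"
      proof -
        have "{v\<in>?Q - {y}. v < y} = (if x < y then insert x {v\<in>?Q - {x, y}. v < y} else {v\<in>?Q - {x, y}. v < y})"
          using x y sn by auto
        moreover have "{v\<in>?Q - {x, y}. later y v} = {v\<in>?Q - {x, y}. v < y}"
          using y by (auto simp: inc_edge_iff)
        moreover have "later y x \<longleftrightarrow> x < y" "\<not> later y n"
          using x y by (auto simp: inc_edge_iff)
        ultimately show ?thesis
          using length_filter_permutation[OF u, of "later y"] by simp
      qed
      also have "{v\<in>?Q - {y}. v < y} = {2..<y}"
        using y by auto
      finally have 2: "length (filter (later y) (x # n # u)) = y - 2" by simp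
      have "{v\<in>?Q - {x, y}. later x v} = {v\<in>{2..s} - {y}. v < x}"
        using x sn by (auto simp: inc_edge_iff)
      then have 3: "length (filter (later x) (n # u)) = card {v\<in>{2..s} - {y}. v < x}"
        using length_filter_permutation[OF u, of "later x"] by (simp add: inc_edge_iff)
      have "{v\<in>?Q - {x, y}. later n v} = {s<..<n} - {y}"
        using x r rs by (auto simp: inc_edge_iff)
      then have 4: "length (filter (later n) u) = card ({s<..<n} - {y})"
        using length_filter_permutation[OF u, of "later n"] by simp
      show ?thesis using 1 2 3 4 by simp
    qed
    then have "(\<Sum>u\<in>perms (?Q - {x, y}). tvar ^ npairs later (1 # y # x # n # u)) =
       (\<Sum>u\<in>perms (?Q - {x, y}). tvar ^ card {v\<in>{2..s} - {y}. v < x} * (tvar ^ (y - 2) *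
         (tvar ^ card ({s<..<n} - {y}) * tvar ^ npairs later u)))"
      by (intro sum.cong) (simp_all only: power_add)
    also have "\<dots> = tvar ^ card {v\<in>{2..s} - {y}. v < x} * (tvar ^ (y - 2) *
         (tvar ^ card ({s<..<n} - {y}) * qfact (card (?Q - {x, y}))))"
      by (subst sum_permutations_later_mid[symmetric]) (auto simp: sum_distrib_left)
    also have "card (?Q - {x, y}) = k"
      using x y sn r N_eq by (subst card_Diff_subset) auto
    finally show "(\<Sum>u\<in>perms (?Q - {x, y}). tvar ^ npairs later (1 # y # x # n # u)) =
       tvar ^ card {v\<in>{2..s} - {y}. v < x} * (tvar ^ (y - 2) * (tvar ^ card ({s<..<n} - {y}) * qfact k))" .
  qed
  also have "\<dots> = (\<Sum>y\<in>{r<..<n}. qint (card ({2..s} - {y})) *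
      (tvar ^ (y - 2) * (tvar ^ card ({s<..<n} - {y}) * qfact k)))"
    unfolding sum_distrib_right[symmetric] by (simp add: sum_tvar_power_card_less del: Diff_iff)
  \<comment> \<open>For y \<le> s the element y is missing among the choices 2, ..., s for x; for y
    > s it is missing among the neighbours of n that follow n in the word.\<close>
  also have "{r<..<n} = {Suc r..<Suc r + c} \<union> {Suc s..<Suc s + b}"
    by (auto simp: r_eq s_eq n_eq)
  also have "(\<Sum>y\<in>{Suc r..<Suc r + c} \<union> {Suc s..<Suc s + b}. qint (card ({2..s} - {y})) *
      (tvar ^ (y - 2) * (tvar ^ card ({s<..<n} - {y}) * qfact k))) =
      (\<Sum>y\<in>{Suc r..<Suc r + c}. tvar ^ (y - 2) * (qint (a + c') * (tvar ^ b * qfact k))) +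
      (\<Sum>y\<in>{Suc s..<Suc s + b}. tvar ^ (y - 2) * (qint (a + c) * (tvar ^ b' * qfact k)))"
  proof -
    have 1: "card ({2..s} - {y}) = a + c'" "card ({s<..<n} - {y}) = b" if "y \<in> {Suc r..<Suc r + c}" for y
    proof -
      have "y \<in> {2..s}" "y \<notin> {s<..<n}" using that r by (auto simp: r_eq s_eq)
      then show "card ({2..s} - {y}) = a + c'" "card ({s<..<n} - {y}) = b"
        by (simp_all add: s_eq n_eq c)
    qed
    have 2: "card ({2..s} - {y}) = a + c" "card ({s<..<n} - {y}) = b'" if "y \<in> {Suc s..<Suc s + b}" for y
    proof -
      have "y \<notin> {2..s}" "y \<in> {s<..<n}" using that by (auto simp: s_eq n_eq)
      then show "card ({2..s} - {y}) = a + c" "card ({s<..<n} - {y}) = b'"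
        by (simp_all add: s_eq n_eq b)
    qed
    have un: "(\<Sum>y\<in>{Suc r..<Suc r + c} \<union> {Suc s..<Suc s + b}. qint (card ({2..s} - {y})) *
        (tvar ^ (y - 2) * (tvar ^ card ({s<..<n} - {y}) * qfact k))) =
       (\<Sum>y\<in>{Suc r..<Suc r + c}. qint (card ({2..s} - {y})) * (tvar ^ (y - 2) * (tvar ^ card ({s<..<n} - {y}) * qfact k))) +
       (\<Sum>y\<in>{Suc s..<Suc s + b}. qint (card ({2..s} - {y})) * (tvar ^ (y - 2) * (tvar ^ card ({s<..<n} - {y}) * qfact k)))"
      by (rule sum.union_disjoint) (auto simp: r_eq s_eq)
    show ?thesis
      unfolding un by (intro arg_cong2[where f = "(+)"] sum.cong refl)
        (simp_all only: 1 2 mult.left_commute)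
  qed
  also have "\<dots> = qfact k * (tvar ^ (a + b) * qint c * qint (a + c') + tvar ^ Suc k * qint b * qint (a + c))"
  proof -
    have le: "2 \<le> Suc r" "2 \<le> Suc s" using r rs by auto
    have eqs: "Suc r - 2 = a" "Suc s - 2 = a + c" "Suc k = a + c + b'"
      by (simp_all add: r_eq s_eq k a c)
    show ?thesis
      unfolding sum_distrib_right[symmetric] sum_tvar_power_shift[OF le(1)] sum_tvar_power_shift[OF le(2)]
        eqs power_add
      by (simp add: algebra_simps)
  qed
  also have "(\<Sum>w\<in>?f2 ` ?I2. tvar ^ npairs later w) = (\<Sum>(x, y, u)\<in>?I2. tvar ^ npairs later (x # n # 1 # y # u))"
    by (subst sum.reindex[OF inj(2)]) (simp add: case_prod_beta comp_def)
  also have "\<dots> = (\<Sum>x\<in>{2..r}. \<Sum>y\<in>{s<..<n}. \<Sum>u\<in>perms (?Q - {x, y}).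
      tvar ^ npairs later (x # n # 1 # y # u))"
    by (subst sum.Sigma, simp, simp)+ (simp add: case_prod_beta)
  also have "\<dots> = (\<Sum>x\<in>{2..r}. \<Sum>y\<in>{s<..<n}. tvar ^ (y - 3) * (tvar ^ (x - 1) * (tvar ^ b * qfact k)))"
  proof (intro sum.cong refl)
    fix x y assume "x \<in> {2..r}" "y \<in> {s<..<n}"
    then have y: "s < y" "y < n" and x: "2 \<le> x" "x \<le> r" by auto
    \<comment> \<open>Behind x stand the x - 2 smaller clique elements and its neighbour 1. Behind y
      stand only y - 3 smaller clique elements, as x < y precedes it. Behind n stand all its b
      neighbours, y among them.\<close>
    have "npairs later (x # n # 1 # y # u) = (y - 3) + ((x - 1) + (b + npairs later u))"
      if u: "u \<in> perms (?Q - {x, y})" for u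
    proof -
      have set_u: "set u = ?Q - {x, y}" using u by (simp add: permutations_of_set_def)
      have 1: "filter (later 1) (y # u) = []"
        using set_u by (auto simp: inc_edge_iff filter_empty_conv)
      have "{v\<in>?Q - {x, y}. later x v} = {2..<x}"
        using x y rs by (auto simp: inc_edge_iff)
      then have "length (filter (later x) u) = x - 2"
        using length_filter_permutation[OF u, of "later x"] by simp
      moreover have "\<not> later x n" "later x 1" "\<not> later x y"
        using x y rs sn by (auto simp: inc_edge_iff)
      ultimately have 2: "length (filter (later x) (n # 1 # y # u)) = x - 1"
        using x by simp
      have "{v\<in>?Q - {x, y}. later n v} = {s<..<n} - {y}"
        using x r rs by (auto simp: inc_edge_iff)
      then have "length (filter (later n) u) = b - 1"
        using length_filter_permutation[OF u, of "later n"] y by (simp add: n_eq s_eq)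
      moreover have "\<not> later n 1" "later n y"
        using y r rs sn by (auto simp: inc_edge_iff)
      ultimately have 3: "length (filter (later n) (1 # y # u)) = b"
        by (simp add: b)
      have "{v\<in>?Q - {x, y}. later y v} = {2..<y} - {x}"
        using x y by (auto simp: inc_edge_iff)
      then have 4: "length (filter (later y) u) = y - 3"
        using length_filter_permutation[OF u, of "later y"] x y rs by simp
      show ?thesis using 1 2 3 4 by simp
    qed
    then have "(\<Sum>u\<in>perms (?Q - {x, y}). tvar ^ npairs later (x # n # 1 # y # u)) =
       (\<Sum>u\<in>perms (?Q - {x, y}). tvar ^ (y - 3) * (tvar ^ (x - 1) * (tvar ^ b * tvar ^ npairs later u)))"
      by (intro sum.cong) (simp_all only: power_add)
    also have "\<dots> = tvar ^ (y - 3) * (tvar ^ (x - 1) * (tvar ^ b * qfact (card (?Q - {x, y}))))"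
      by (subst sum_permutations_later_mid[symmetric]) (auto simp: sum_distrib_left)
    also have "card (?Q - {x, y}) = k"
      using x y sn rs r N_eq by (subst card_Diff_subset) auto
    finally show "(\<Sum>u\<in>perms (?Q - {x, y}). tvar ^ npairs later (x # n # 1 # y # u)) =
       tvar ^ (y - 3) * (tvar ^ (x - 1) * (tvar ^ b * qfact k))" .
  qed
  also have "\<dots> = (\<Sum>y\<in>{s<..<n}. tvar ^ (y - 3)) * (\<Sum>x\<in>{2..r}. tvar ^ (x - 1)) * (tvar ^ b * qfact k)"
    by (simp add: sum_distrib_right sum_distrib_left mult.assoc)
  also have "(\<Sum>y\<in>{s<..<n}. tvar ^ (y - 3)) = tvar ^ (Suc s - 3) * qint b"
  proof -
    have eq: "{s<..<n} = {Suc s..<Suc s + b}" by (auto simp: n_eq s_eq)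
    show ?thesis unfolding eq using r rs by (intro sum_tvar_power_shift) simp
  qed
  also have "(\<Sum>x\<in>{2..r}. tvar ^ (x - 1)) = tvar ^ (2 - 1) * qint a"
  proof -
    have eq: "{2..r} = {2..<2 + a}" by (auto simp: r_eq)
    show ?thesis unfolding eq by (rule sum_tvar_power_shift) simp
  qed
  finally show ?thesis
  proof -
    assume *: "B_poly n m ([2, 2] @ replicate (n - 4) 1) =
      qfact k * (tvar ^ (a + b) * qint c * qint (a + c') + tvar ^ Suc k * qint b * qint (a + c)) +
      tvar ^ (Suc s - 3) * qint b * (tvar ^ (2 - 1) * qint a) * (tvar ^ b * qfact k)"
    have pow: "tvar ^ (Suc s - 3) * tvar ^ (2 - 1) * tvar ^ b = tvar ^ Suc (Suc k)"
      unfolding power_add[symmetric] by (rule arg_cong[where f = "(^) tvar"]) (simp add: s_eq a b c k)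
    have "tvar ^ (Suc s - 3) * qint b * (tvar ^ (2 - 1) * qint a) * (tvar ^ b * qfact k) =
        (tvar ^ (Suc s - 3) * tvar ^ (2 - 1) * tvar ^ b) * qint a * qint b * qfact k"
      by (simp only: mult_ac)
    then show ?thesis
      unfolding * pow by (simp only: distrib_left mult_ac)
  qed
qed

text \<open>The sum over the first letter in \<open>B_column_plus_B_21\<close> is evaluated for 1,
  for n and for the three blocks of the clique, of sizes a, c and b. This gives the five positive
  terms in this order; the subtracted term is the column.\<close>

lemma B_21_param:
  "B_poly n m (2 # replicate (n - 2) 1) =
     qint (Suc b) * qfact (Suc (Suc k)) + tvar ^ b * qint (Suc a) * qfact (Suc (Suc k)) +
     tvar * qint a * qint a * qint (Suc b) * qfact (Suc k) +
     tvar ^ a * qint c * qint (Suc a) * qint (Suc b) * qfact (Suc k) +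
     tvar ^ (a + c) * qint b * qint (Suc a) * qint b * qfact (Suc k) -
     qint (Suc a) * qint (Suc b) * qfact (Suc (Suc k))"
proof -
  define g where "g y = tvar ^ card {v\<in>{1..n}. inc_edge n m v y} * words_sum ({1..n} - {y})" for y
  let ?Q = "{2..<n}"
  let ?A = "{2..<2 + a}" and ?C = "{Suc r..<Suc r + c}" and ?B = "{Suc s..<Suc s + b}"
  have cQ: "card ?Q = Suc (Suc k)" using N_eq by simp
  have b_eq: "n - 1 - s = b" and a_eq: "r - 1 = a" by (simp_all add: n_eq s_eq r_eq)
  have g1: "g 1 = qint (Suc b) * qfact (Suc (Suc k))"
  proof -
    have "{v\<in>{1..n}. inc_edge n m v 1} = {}" by (auto simp: inc_edge_iff)
    moreover have "{1..n} - {1} = insert n ?Q" using n by auto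
    moreover have "words_sum (insert n ?Q) = qint (Suc b) * qfact (Suc (Suc k))"
      using words_sum_insert_n[of ?Q] words_sum_mid[of ?Q] card_mid_last b_eq cQ by auto
    ultimately show ?thesis by (simp only: g_def card.empty power_0 mult_1_left)
  qed
  have gn: "g n = tvar ^ b * qint (Suc a) * qfact (Suc (Suc k))"
  proof -
    have "{v\<in>{1..n}. inc_edge n m v n} = {s<..<n}"
      using r rs sn by (auto simp: inc_edge_iff)
    moreover have "{1..n} - {n} = insert 1 ?Q" using n by auto
    moreover have "words_sum (insert 1 ?Q) = qint (Suc a) * qfact (Suc (Suc k))"
      using words_sum_insert_1[of ?Q] words_sum_mid[of ?Q] card_mid_first cQ a_eq by (auto simp: subset_eq)
    moreover have "card {s<..<n} = b" by (simp add: n_eq s_eq)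
    ultimately show ?thesis by (simp only: g_def mult.assoc)
  qed
  \<comment> \<open>A clique element y has y - 2 smaller neighbours in the clique and, if y \<le> r,
    also the neighbour 1. Splitting it off takes one place from the insertion of 1 or of n if y is
    their neighbour.\<close>
  have mid: "g y = tvar ^ (y - (if y \<le> r then 1 else 2)) *
      (qint (Suc (a - (if y \<le> r then 1 else 0))) * qint (Suc (b - (if s < y then 1 else 0))) * qfact (Suc k))"
    if y: "y \<in> ?Q" for y
  proof -
    have "{1..n} - {y} = insert 1 (insert n (?Q - {y}))"
      using y n by auto
    moreover have "card ((?Q - {y}) \<inter> {2..r}) = a - (if y \<le> r then 1 else 0)"
    proof -
      have "(?Q - {y}) \<inter> {2..r} = {2..r} - {y}" using rs sn by auto
      then show ?thesis using y by (simp add: r_eq)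
    qed
    moreover have "card ((?Q - {y}) \<inter> {s<..<n}) = b - (if s < y then 1 else 0)"
    proof -
      have "(?Q - {y}) \<inter> {s<..<n} = {s<..<n} - {y}" using r rs by auto
      then show ?thesis using y by (simp add: n_eq s_eq)
    qed
    moreover have "card (?Q - {y}) = Suc k"
      using y cQ by simp
    ultimately have "words_sum ({1..n} - {y}) =
        qint (Suc (a - (if y \<le> r then 1 else 0))) * qint (Suc (b - (if s < y then 1 else 0))) * qfact (Suc k)"
      using words_sum_full[of "?Q - {y}"] by simp
    moreover have "{v\<in>{1..n}. inc_edge n m v y} = (if y \<le> r then {1..<y} else {2..<y})"
      using y r rs sn by (auto simp: inc_edge_iff)
    then have "card {v\<in>{1..n}. inc_edge n m v y} = y - (if y \<le> r then 1 else 2)"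
      by simp
    ultimately show ?thesis by (simp only: g_def)
  qed
  have "B_poly n m (replicate n 1) + B_poly n m (2 # replicate (n - 2) 1) = (\<Sum>y\<in>{1..n}. g y)"
    unfolding g_def by (rule B_column_plus_B_21)
  also have "\<dots> = g 1 + (g n + (\<Sum>y\<in>?Q. g y))"
    unfolding interval_split using n by simp
  also have "?Q = ?A \<union> (?C \<union> ?B)"
    by (auto simp: n_eq r_eq s_eq)
  also have "(\<Sum>y\<in>?A \<union> (?C \<union> ?B). g y) = (\<Sum>y\<in>?A. g y) + ((\<Sum>y\<in>?C. g y) + (\<Sum>y\<in>?B. g y))"
    by (subst sum.union_disjoint, simp, simp, force simp: r_eq s_eq)
      (subst sum.union_disjoint, auto simp: r_eq s_eq)
  also have "(\<Sum>y\<in>?A. g y) = (\<Sum>y\<in>?A. tvar ^ (y - 1) * (qint a * qint (Suc b) * qfact (Suc k)))"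
  proof (rule sum.cong[OF refl])
    fix y assume "y \<in> ?A"
    then have "y \<in> ?Q" "y \<le> r" "\<not> s < y" by (auto simp: n_eq r_eq s_eq)
    then show "g y = tvar ^ (y - 1) * (qint a * qint (Suc b) * qfact (Suc k))"
      using mid[of y] by (simp add: a)
  qed
  also have "\<dots> = tvar * qint a * (qint a * qint (Suc b) * qfact (Suc k))"
    unfolding sum_distrib_right[symmetric] by (subst sum_tvar_power_shift) simp_all
  also have "(\<Sum>y\<in>?C. g y) = (\<Sum>y\<in>?C. tvar ^ (y - 2) * (qint (Suc a) * qint (Suc b) * qfact (Suc k)))"
  proof (rule sum.cong[OF refl])
    fix y assume "y \<in> ?C"
    then have "y \<in> ?Q" "\<not> y \<le> r" "\<not> s < y" by (auto simp: n_eq r_eq s_eq)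
    then show "g y = tvar ^ (y - 2) * (qint (Suc a) * qint (Suc b) * qfact (Suc k))"
      using mid[of y] by simp
  qed
  also have "\<dots> = tvar ^ a * qint c * (qint (Suc a) * qint (Suc b) * qfact (Suc k))"
    unfolding sum_distrib_right[symmetric] by (subst sum_tvar_power_shift) (simp_all add: r_eq a)
  also have "(\<Sum>y\<in>?B. g y) = (\<Sum>y\<in>?B. tvar ^ (y - 2) * (qint (Suc a) * qint b * qfact (Suc k)))"
  proof (rule sum.cong[OF refl])
    fix y assume "y \<in> ?B"
    then have "y \<in> ?Q" "\<not> y \<le> r" "s < y" by (auto simp: n_eq r_eq s_eq)
    then show "g y = tvar ^ (y - 2) * (qint (Suc a) * qint b * qfact (Suc k))"
      using mid[of y] by (simp add: b)
  qed
  also have "\<dots> = tvar ^ (a + c) * qint b * (qint (Suc a) * qint b * qfact (Suc k))"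
    unfolding sum_distrib_right[symmetric] by (subst sum_tvar_power_shift) (simp_all add: s_eq a)
  also note g1
  also note gn
  finally show ?thesis
    unfolding B_column_param by (simp add: algebra_simps)
qed

end

section \<open>Expansions\<close>

context two_end_order_param
begin

abbreviation "B1 \<equiv> B_poly n m (replicate n 1)"
abbreviation "B21 \<equiv> B_poly n m (2 # replicate (n - 2) 1)"
abbreviation "B22 \<equiv> B_poly n m ([2, 2] @ replicate (n - 4) 1)"
abbreviation "B31 \<equiv> B_poly n m (3 # replicate (n - 3) 1)"

text \<open>Once k + 1 = a + b + \<open>c'\<close> is substituted and q-integers of sums and powers
  of t are expanded, both sides are polynomials in t, [a], [b], [\<open>c'\<close>] and
  \<open>qfact k\<close>, and ring arithmetic finishes. The other coefficient identities are proved
  in the same way.\<close>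

lemma C_22: "B22 - B31 =
  tvar ^ Suc k * (1 + tvar) * qint a * qint b * qfact k"
proof -
  have k_eq: "Suc k = a + b + c'" by (simp add: k a b)
  show ?thesis
    unfolding B_22_param B_31_param qfact_Suc c
    unfolding k_eq add_Suc_right qint_Suc_shift qint_add power_add power_Suc tvar_power_eq
    by algebra
qed

lemma C_n: "B1 - B21 + B31 =
  qint (Suc (Suc (Suc (Suc k)))) * qint a * qint b * qfact (Suc k)"
proof -
  have k_eq: "Suc k = a + b + c'" by (simp add: k a b)
  show ?thesis
    unfolding B_column_param B_21_param B_31_param qfact_Suc c
    unfolding k_eq add_Suc_right qint_Suc_shift qint_add power_add power_Suc tvar_power_eq
    by algebra
qed

text \<open>The subtraction-free form of the coefficient, obtained by splitting one factor [N-1].\<close>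

lemma C_11: "B21 - B22 - B31 =
  qfact k * (qint (Suc k) * (tvar * tvar ^ a * tvar ^ b * qint c * (qint a + qint b) + tvar ^ a * qint b * qint (Suc b)) +
    tvar ^ b * qint a * qint (Suc a) * qint (a + c') + tvar ^ Suc (Suc (Suc k)) * qint a * qint b * qint a')"
proof -
  have k_eq: "Suc k = a + b + c'" by (simp add: k a b)
  show ?thesis
    unfolding B_21_param B_22_param B_31_param qfact_Suc c
    unfolding k_eq add_Suc_right qint_Suc_shift qint_add power_add power_Suc tvar_power_eq
    \<comment> \<open>The last term carries [a-1]: absorbing the negative term leaves t^(N-1) [a]
      [b] ([a+1] - [2]) = t^(N+1) [a] [b] [a-1]. Hence [a], too, has to be expanded, through
      [\<open>a'\<close>].\<close>
    unfolding a qint_Suc_shift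
    by algebra
qed

text \<open>The coefficients obtained from colourings are matched with those obtained from tableaux:
  \<open>C211\<close> and \<open>C11\<close> bring the latter into the raw form of the colouring
  sum, and \<open>C_22\<close> and \<open>C_n\<close> cover the other two.\<close>

lemma chrom_qsym_e_expansion:
  "chrom_qsym {1..n} (inc_edge n m) \<alpha> =
     B31 * elem [n - 2, 1, 1] \<alpha> +
     (B22 - B31) * elem [n - 2, 2] \<alpha> +
     (B21 - B22 - B31) * elem [n - 1, 1] \<alpha> +
     (B1 - B21 + B31) * elem [n] \<alpha>"
proof (cases "Poly_Mapping.lookup \<alpha> 0 = 0")
  case False
  then show ?thesis
    unfolding chrom_qsym_eq_0[OF False] elem_eq_0[OF False] by simp
next
  case True
  obtain A where cnt: "\<And>c. count A c = Poly_Mapping.lookup \<alpha> c"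
    using ex_multiset_of_content[of \<alpha>] by blast
  have zero: "0 \<notin># A"
    using True cnt[of 0] by (simp add: not_in_iff)
  have ab: "r - 1 = a" "n - 1 - s = b" "1 \<le> a" "1 \<le> b" "a + b \<le> Suc (Suc k)"
    by (simp_all add: r_eq s_eq n_eq a b k)
  have n1: "n - 1 = Suc (Suc (Suc k))" and n': "n = Suc (Suc k) + 2"
    using N_eq(2) n by auto
  have k_eq: "Suc k = a + b + c'" by (simp add: k a b)
  have X: "chrom_qsym {1..n} (inc_edge n m) \<alpha> =
     (\<Sum>(S, p, q)\<in>esets3 (Suc (Suc k)) A. end_sum (above_weight p) (below_weight q) S a b)"
    using chrom_qsym_eq_sum_esets3[OF cnt zero] unfolding ab N_eq(2) .
  have E: "elem [n - 2, 1, 1] \<alpha> = of_nat (card (esets3 (Suc (Suc k)) A))"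
    "elem [n - 2, 2] \<alpha> = of_nat (card (esets22 (Suc (Suc k)) A))"
    "elem [n - 1, 1] \<alpha> = of_nat (card (esets2 (Suc (Suc (Suc k))) A))"
    "elem [n] \<alpha> = of_nat (card (esets1 (Suc (Suc k) + 2) A))"
    unfolding elem1_eq[OF cnt zero] elem2_eq[OF cnt zero] elem22_eq[OF cnt zero] elem3_eq[OF cnt zero]
      N_eq(2) n1 n'[symmetric] by simp_all
  have C211: "B31 = qfact (Suc (Suc k)) - (qint a + qint b) * qfact (Suc k) +
      qint a * qint b * qfact k * (1 - tvar ^ Suc k)"
    unfolding B_31_param qfact_Suc c
    unfolding k_eq add_Suc_right qint_Suc_shift qint_add power_add power_Suc tvar_power_eq
    by algebra
  have C11: "B21 - B22 - B31 =
      (qint a + qint b) * qfact (Suc k) * qint (Suc (Suc (Suc k))) -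
      qint a * qint b * qfact k * (2 * qint (Suc k) + tvar ^ Suc k + tvar ^ Suc (Suc k))"
    unfolding B_21_param B_22_param B_31_param qfact_Suc c
    unfolding k_eq add_Suc_right qint_Suc_shift qint_add power_add power_Suc tvar_power_eq
    by algebra
  have sum_eq: "chrom_qsym {1..n} (inc_edge n m) \<alpha> = qfact (Suc (Suc k)) * elem [n - 2, 1, 1] \<alpha> +
    (qint a + qint b) * qfact (Suc k) *
      (qint (Suc (Suc (Suc k))) * elem [n - 1, 1] \<alpha> - elem [n - 2, 1, 1] \<alpha>) +
    qint a * qint b * qfact k *
     ((1 - tvar ^ Suc k) * elem [n - 2, 1, 1] \<alpha>
      - (2 * qint (Suc k) + tvar ^ Suc k + tvar ^ Suc (Suc k)) * elem [n - 1, 1] \<alpha> +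
      (tvar ^ Suc k + tvar ^ Suc (Suc k)) * elem [n - 2, 2] \<alpha> +
      qint (Suc (Suc k) + 2) * qint (Suc k) * elem [n] \<alpha>)"
    unfolding X E by (rule sum_esets3_end_weighted[OF refl ab(3,4,5)])
  have "qint (Suc (Suc (Suc (Suc k)))) = qint (Suc (Suc k) + 2)" by simp
  moreover have "qfact (Suc k) = qint (Suc k) * qfact k" "tvar ^ Suc (Suc k) = tvar * tvar ^ Suc k"
    by (simp_all add: qfact_Suc)
  ultimately show ?thesis
    unfolding sum_eq C11 C_22 C_n unfolding C211 by (simp only: algebra_simps)
qed

text \<open>The dual Pieri rules write each of the four Schur functions as an integer combination of
  the four elementary products. Substituting these and collecting terms produces exactly the
  coefficients of the e-expansion.\<close>

lemma chrom_qsym_s_expansion: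
  "chrom_qsym {1..n} (inc_edge n m) \<alpha> =
     B1 * schur (replicate n 1) \<alpha> +
     B21 * schur (2 # replicate (n - 2) 1) \<alpha> +
     B22 * schur ([2, 2] @ replicate (n - 4) 1) \<alpha> +
     B31 * schur (3 # replicate (n - 3) 1) \<alpha>"
proof (cases "Poly_Mapping.lookup \<alpha> 0 = 0")
  case False
  then show ?thesis
    unfolding chrom_qsym_eq_0[OF False] schur_eq_0[OF False] by simp
next
  case True
  obtain A where cnt: "\<And>c. count A c = Poly_Mapping.lookup \<alpha> c"
    using ex_multiset_of_content[of \<alpha>] by blast
  have zero: "0 \<notin># A"
    using True cnt[of 0] by (simp add: not_in_iff)
  note elems = elem1_eq[OF cnt zero] elem2_eq[OF cnt zero] elem22_eq[OF cnt zero] elem3_eq[OF cnt zero]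
  have ns: "Suc (n - 2) = n - 1" "Suc (n - 1) = n" "Suc (n - 3) = n - 2" "Suc (Suc (n - 4)) = n - 2"
    using n by auto
  have s1: "schur (replicate n 1) \<alpha> = elem [n] \<alpha>"
    unfolding schur_column_eq[OF cnt zero] elems ..
  have s21: "schur (2 # replicate (n - 2) 1) \<alpha> = elem [n - 1, 1] \<alpha> - elem [n] \<alpha>"
    unfolding schur_21_eq[OF cnt zero] elems ns card_tab21[of "n - 1" A, unfolded ns, symmetric] by simp
  have s22: "schur ([2, 2] @ replicate (n - 4) 1) \<alpha> = elem [n - 2, 2] \<alpha> - elem [n - 1, 1] \<alpha>"
  proof -
    have "card (tab22 (n - 2) A) + card (esets2 (n - 1) A) = card (esets22 (n - 2) A)"
      using card_tab22[of "n - 2" A] n unfolding ns by simp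
    then show ?thesis
      unfolding schur_22_eq[OF cnt zero] elems ns by (metis add_diff_cancel_right' of_nat_add)
  qed
  have s31: "schur (3 # replicate (n - 3) 1) \<alpha> =
      elem [n - 2, 1, 1] \<alpha> - elem [n - 2, 2] \<alpha> - schur (2 # replicate (n - 2) 1) \<alpha>"
    unfolding schur_31_eq[OF cnt zero] schur_21_eq[OF cnt zero] elems ns
      card_tab31[of "n - 2" A, unfolded ns, symmetric] by simp
  show ?thesis
    unfolding chrom_qsym_e_expansion s31 s22 s21 s1 by algebra
qed

lemma C_nonneg:
  "nonneg_coeffs (B31)"
  "nonneg_coeffs (B22 - B31)"
  "nonneg_coeffs (B21 - B22 - B31)"
  "nonneg_coeffs (B1 - B21 + B31)"
  unfolding C_22 C_11 C_n unfolding B_31_param by (intro nonneg_coeffs_intros)+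

end

lemma e_positiveI:
  assumes X: "\<And>\<alpha>. X \<alpha> = c1 * elem m1 \<alpha> + c2 * elem m2 \<alpha> + c3 * elem m3 \<alpha> + c4 * elem m4 \<alpha>"
    and "distinct [m1, m2, m3, m4]"
    and "\<And>mu. mu \<in> {m1, m2, m3, m4} \<Longrightarrow> is_partition mu"
    and "nonneg_coeffs c1" "nonneg_coeffs c2" "nonneg_coeffs c3" "nonneg_coeffs c4"
  shows "e_positive X"
proof -
  define C where "C = (\<lambda>mu. if mu = m1 then c1 else if mu = m2 then c2 else if mu = m3 then c3 else c4)"
  have "X \<alpha> = (\<Sum>mu\<in>{m1, m2, m3, m4}. C mu * elem mu \<alpha>)" for \<alpha>
    using assms(2) by (auto simp: X C_def)
  moreover have "\<forall>mu\<in>{m1, m2, m3, m4}. is_partition mu \<and> nonneg_coeffs (C mu)"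
    using assms(3-7) by (auto simp: C_def)
  ultimately show ?thesis
    unfolding e_positive_def by (intro exI[of _ "{m1, m2, m3, m4}"] exI[of _ C]) auto
qed

theorem theorem3p7:
  fixes n r s :: nat and m :: "nat \<Rightarrow> nat"
  assumes "n \<ge> 5"
    and "nat_unit_interval_order n m"
    and "m 1 = r" and "r \<ge> 2"
    and "\<forall>i. 2 \<le> i \<and> i \<le> s \<longrightarrow> m i = n - 1"
    and "\<forall>i. s + 1 \<le> i \<and> i \<le> n - 1 \<longrightarrow> m i = n"
    and "r < s" and "s < n - 1"
  shows
    "let X = chrom_qsym {1..n} (inc_edge n m);
         B = B_poly n m;
         l1 = replicate n 1;
         l21 = 2 # replicate (n - 2) 1;
         l22 = [2, 2] @ replicate (n - 4) 1;
         l31 = 3 # replicate (n - 3) 1;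
         C211 = B l31;
         C22 = B l22 - B l31;
         C11 = B l21 - B l22 - B l31;
         Cn = B l1 - B l21 + B l31
     in (\<forall>\<alpha>. X \<alpha> = B l1 * schur l1 \<alpha> + B l21 * schur l21 \<alpha> + B l22 * schur l22 \<alpha>
                    + B l31 * schur l31 \<alpha>) \<and>
        (\<forall>\<alpha>. X \<alpha> = C211 * elem [n - 2, 1, 1] \<alpha> + C22 * elem [n - 2, 2] \<alpha>
                    + C11 * elem [n - 1, 1] \<alpha> + Cn * elem [n] \<alpha>) \<and>
        nonneg_coeffs C211 \<and> nonneg_coeffs C22 \<and> nonneg_coeffs C11 \<and> nonneg_coeffs Cn \<and>
        e_positive X"
proof -
  \<comment> \<open>The assumptions r \<ge> 2, r < s and s < n - 1 say that a, c and b are positive;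
    \<open>a'\<close>, \<open>c'\<close> and \<open>b'\<close> are their predecessors.\<close>
  obtain a' where a': "r = Suc (Suc a')"
    using assms by (metis add_2_eq_Suc le_Suc_ex)
  obtain c' where c': "s = Suc (Suc a' + Suc c')"
    using assms(7) unfolding a' by (metis add_Suc add_Suc_right less_iff_Suc_add)
  obtain b' where b': "n = Suc (Suc (Suc a' + Suc b' + Suc c'))"
  proof -
    obtain d where "n - 1 = Suc (s + d)"
      using assms(8) less_iff_Suc_add by blast
    then show ?thesis
      using that[of d] by (simp add: c')
  qed
  interpret two_end_order_param n r s m a' b' c' "Suc a'" "Suc b'" "Suc c'" "Suc (a' + b' + c')"
    using assms a' b' c' by unfold_locales auto
  have "e_positive (chrom_qsym {1..n} (inc_edge n m))"
    using assms(1) by (intro e_positiveI[OF chrom_qsym_e_expansion _ _ C_nonneg])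
      (auto simp: is_partition_def)
  then show ?thesis
    unfolding Let_def using chrom_qsym_s_expansion chrom_qsym_e_expansion C_nonneg by blast
qed

end
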